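(* Let $\varphi_1,\dots,\varphi_n\in H^\infty(\mathbb D^2)$ and let $\epsilon>0$. Then the following are equivalent: (1) there exist $f_1,\dots,f_n\in H^\infty(\mathbb D^2)$ such that $\sup_{z\in\mathbb D^2}\big[|f_1(z)|^2+\dots+|f_n(z)|^2\big]\le\frac1{\epsilon^2}$ and $\sum_{i=1}^n\varphi_if_i=1$; (2) the map $(z,w)\mapsto\Big(\sum_{j=1}^n\varphi_j(z^{(1)},z^{(3)})\overline{\varphi_j(w^{(1)},w^{(3)})}-\epsilon^2\Big)k(z,w)$ on $\mathbb P\times\mathbb P$ is positive semi-definite for every $k\in AK(\mathbb P)$; (3) there exist positive kernels $\xi,\nabla:\mathbb P\times\mathbb P\to C(\overline{\mathbb D})^*$ and a weak kernel $\delta:\mathbb P\times\mathbb P\to\mathbb C$ such that for all $z,w\in\mathbb P$, $$\sum_{j=1}^n\varphi_j(z^{(1)},z^{(3)})\overline{\varphi_j(w^{(1)},w^{(3)})}-\epsilon^2=\xi(z,w)\big(1-\mathrm J(z)\overline{\mathrm J(w)}\big)+\nabla(z,w)\big(1-\mathrm j(z)\overline{\mathrm j(w)}\big)+\Big(1-\frac{z^{(2)}\overline{w}^{(2)}}{4}\Big)\delta(z,w).$$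
   Context: $\mathbb D$ is the open unit disc in $\mathbb C$, $\overline{\mathbb D}$ its closure, and $C(\overline{\mathbb D})$ is the space of continuous complex functions on $\overline{\mathbb D}$ with dual $C(\overline{\mathbb D})^*$. $H^\infty(\Omega)$ is the algebra of bounded holomorphic functions on $\Omega$. The pentablock is $\mathbb P=\{(a_{21},\operatorname{tr}A,\det A)\in\mathbb C^3: A=[a_{ij}]\in M_2(\mathbb C),\ \|A\|<1\}$; points are written $z=(z^{(1)},z^{(2)},z^{(3)})$. If $z\in\mathbb P$ then $(z^{(1)},z^{(3)})\in\mathbb D^2$. For $\alpha\in\overline{\mathbb D}$ put $$\Phi_\alpha(z^{(2)},z^{(3)})=\frac{2\alpha z^{(3)}-z^{(2)}}{2-\alpha z^{(2)}},\qquad \psi_\alpha(z^{(1)},z^{(2)},z^{(3)})=\frac{(1-|\alpha|^2)z^{(1)}}{1-\alpha z^{(2)}+\alpha^2z^{(3)}}.$$ For $z\in\mathbb P$ define the continuous functions $\mathrm J(z),\mathrm j(z)\in C(\overline{\mathbb D})$ by $\mathrm J(z)(\alpha)=\psi_\alpha(z)$ and $\mathrm j(z)(\alpha)=\Phi_\alpha(z^{(2)},z^{(3)})$; both have supremum norm $<1$. A function $k:\mathbb P\times\mathbb P\to\mathbb C$ is positive semi-definite (a weak kernel) if $\sum_{i,j=1}^N k(z_i,z_j)c_j\overline{c_i}\ge0$ for all $N$, $z_1,\dots,z_N\in\mathbb P$, $c_1,\dots,c_N\in\mathbb C$; it is a kernel if moreover $k(z,z)\ne0$ for all $z$. $AK(\mathbb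 P)$ is the set of (scalar) admissible kernels: kernels $k$ on $\mathbb P$ such that for all $\alpha\in\overline{\mathbb D}$ the functions $(1-\tfrac{z^{(2)}\overline{w}^{(2)}}{4})k(z,w)$, $(1-\Phi_\alpha(z^{(2)},z^{(3)})\overline{\Phi_\alpha(w^{(2)},w^{(3)})})k(z,w)$ and $(1-\psi_\alpha(z)\overline{\psi_\alpha(w)})k(z,w)$ are positive semi-definite in $(z,w)$. A positive kernel is a map $\xi:\mathbb P\times\mathbb P\to C(\overline{\mathbb D})^*$ such that $\sum_{i,j=1}^N\xi(z_i,z_j)(h_i\overline{h_j})c_j\overline{c_i}\ge0$ for all $N$, $z_i\in\mathbb P$, $h_i\in C(\overline{\mathbb D})$, $c_i\in\mathbb C$. *)

theory Defs
  imports "HOL-Analysis.Analysis"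
begin

text \<open>Elements of $H^\infty$, kernels and members of dual spaces are represented by total HOL
  functions; only their values on the indicated domains are ever constrained.\<close>

section \<open>Bounded holomorphic functions of two variables\<close>

text \<open>Intended for open \<open>\<Omega>\<close>: complex Frechet differentiability, i.e.\ the (real) derivative exists
  and is complex linear.\<close>

definition holomorphic2_on :: "(complex \<times> complex \<Rightarrow> complex) \<Rightarrow> (complex \<times> complex) set \<Rightarrow> bool" where
  "holomorphic2_on f \<Omega> \<longleftrightarrow>
     (\<forall>z\<in>\<Omega>. \<exists>a b. (f has_derivative (\<lambda>h. a * fst h + b * snd h)) (at z))"

definition Hinf :: "(complex \<times> complex) set \<Rightarrow> (complex \<times> complex \<Rightarrow> complex) set" where
  "Hinf \<Omega> = {f. holomorphic2_on f \<Omega> \<and> bounded (f ` \<Omega>)}"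

definition bidisc :: "(complex \<times> complex) set" where
  "bidisc = ball 0 1 \<times> ball 0 1"

section \<open>The pentablock\<close>

type_synonym cpoint = "complex \<times> complex \<times> complex"

abbreviation c1 :: "cpoint \<Rightarrow> complex" where "c1 z \<equiv> fst z"
abbreviation c2 :: "cpoint \<Rightarrow> complex" where "c2 z \<equiv> fst (snd z)"
abbreviation c3 :: "cpoint \<Rightarrow> complex" where "c3 z \<equiv> snd (snd z)"

text \<open>The norm on \<^typ>\<open>complex^2\<close> is the Euclidean one, so \<^const>\<open>onorm\<close> is the usual
  operator norm of a matrix.\<close>

definition pentablock :: "cpoint set" where
  "pentablock = {(A $ 2 $ 1, trace A, det A) | A :: complex^2^2. onorm (\<lambda>x. A *v x) < 1}"

definition Phi :: "complex \<Rightarrow> complex \<Rightarrow> complex \<Rightarrow> complex" where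
  "Phi \<alpha> s p = (2 * \<alpha> * p - s) / (2 - \<alpha> * s)"

definition psi :: "complex \<Rightarrow> cpoint \<Rightarrow> complex" where
  "psi \<alpha> z = (1 - (of_real (cmod \<alpha>))\<^sup>2) * c1 z / (1 - \<alpha> * c2 z + \<alpha>\<^sup>2 * c3 z)"

section \<open>Scalar kernels\<close>

text \<open>Membership in \<open>\<real>\<^sub>\<ge>\<^sub>0\<close> says that the complex number is real and non-negative.\<close>

definition psd_on :: "'a set \<Rightarrow> ('a \<Rightarrow> 'a \<Rightarrow> complex) \<Rightarrow> bool" where
  "psd_on X k \<longleftrightarrow>
     (\<forall>(N::nat) (z :: nat \<Rightarrow> 'a) (c :: nat \<Rightarrow> complex). (\<forall>i\<in>{1..N}. z i \<in> X) \<longrightarrow>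
        (\<Sum>i=1..N. \<Sum>j=1..N. k (z i) (z j) * c j * cnj (c i)) \<in> \<real>\<^sub>\<ge>\<^sub>0)"

abbreviation weak_kernel_on :: "'a set \<Rightarrow> ('a \<Rightarrow> 'a \<Rightarrow> complex) \<Rightarrow> bool" where
  "weak_kernel_on \<equiv> psd_on"

definition kernel_on :: "'a set \<Rightarrow> ('a \<Rightarrow> 'a \<Rightarrow> complex) \<Rightarrow> bool" where
  "kernel_on X k \<longleftrightarrow> weak_kernel_on X k \<and> (\<forall>z\<in>X. k z z \<noteq> 0)"

definition AK :: "(cpoint \<Rightarrow> cpoint \<Rightarrow> complex) set" where
  "AK = {k. kernel_on pentablock k \<and>
     (\<forall>\<alpha>\<in>cball 0 1.
        psd_on pentablock (\<lambda>z w. (1 - c2 z * cnj (c2 w) / 4) * k z w) \<and>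
        psd_on pentablock (\<lambda>z w. (1 - Phi \<alpha> (c2 z) (c3 z) * cnj (Phi \<alpha> (c2 w) (c3 w))) * k z w) \<and>
        psd_on pentablock (\<lambda>z w. (1 - psi \<alpha> z * cnj (psi \<alpha> w)) * k z w))}"

section \<open>Kernels with values in the dual of the continuous functions on the closed disc\<close>

definition Cdisc :: "(complex \<Rightarrow> complex) set" where
  "Cdisc = {h. continuous_on (cball 0 1) h}"

definition sup_norm :: "(complex \<Rightarrow> complex) \<Rightarrow> real" where
  "sup_norm h = (SUP \<alpha>\<in>cball 0 1. cmod (h \<alpha>))"

text \<open>Linearity and boundedness force \<open>L g = L h\<close> whenever \<open>g, h \<in> Cdisc\<close> agree on the closed
  disc, so such an \<open>L\<close> is a functional on the Banach space of continuous functions there.\<close>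

definition Cdisc_dual :: "((complex \<Rightarrow> complex) \<Rightarrow> complex) set" where
  "Cdisc_dual = {L.
     (\<forall>g\<in>Cdisc. \<forall>h\<in>Cdisc. L (\<lambda>\<alpha>. g \<alpha> + h \<alpha>) = L g + L h) \<and>
     (\<forall>c. \<forall>h\<in>Cdisc. L (\<lambda>\<alpha>. c * h \<alpha>) = c * L h) \<and>
     (\<exists>B. \<forall>h\<in>Cdisc. cmod (L h) \<le> B * sup_norm h)}"

definition positive_kernel_on ::
  "'a set \<Rightarrow> ('a \<Rightarrow> 'a \<Rightarrow> (complex \<Rightarrow> complex) \<Rightarrow> complex) \<Rightarrow> bool" where
  "positive_kernel_on X \<xi> \<longleftrightarrow>
     (\<forall>z\<in>X. \<forall>w\<in>X. \<xi> z w \<in> Cdisc_dual) \<and>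
     (\<forall>(N::nat) (z :: nat \<Rightarrow> 'a) (h :: nat \<Rightarrow> complex \<Rightarrow> complex) (c :: nat \<Rightarrow> complex).
        (\<forall>i\<in>{1..N}. z i \<in> X \<and> h i \<in> Cdisc) \<longrightarrow>
        (\<Sum>i=1..N. \<Sum>j=1..N.
            \<xi> (z i) (z j) (\<lambda>\<alpha>. h i \<alpha> * cnj (h j \<alpha>)) * c j * cnj (c i)) \<in> \<real>\<^sub>\<ge>\<^sub>0)"

definition Jpsi :: "cpoint \<Rightarrow> complex \<Rightarrow> complex" where
  "Jpsi z = (\<lambda>\<alpha>. psi \<alpha> z)"

definition jPhi :: "cpoint \<Rightarrow> complex \<Rightarrow> complex" where
  "jPhi z = (\<lambda>\<alpha>. Phi \<alpha> (c2 z) (c3 z))"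

end

theory Submission
  imports Defs "HOL-Complex_Analysis.Complex_Analysis"
begin

text \<open>Admissibility at \<open>\<alpha> = 0\<close> and \<open>\<alpha> = \<plusminus>1\<close> makes \<open>(1 - z\<^sub>1 w\<^sub>1\<^sup>*) k\<close> and \<open>(1 - z\<^sub>3 w\<^sub>3\<^sup>*) k\<close> positive, so (1) implies (2)
  by Ando's inequality for a row of bounded functions of two commuting contractions. Conversely, the
  points \<open>(a, 0, p)\<close> of the pentablock form a bidisc on which these two conditions already imply
  admissibility, since \<open>1 - \<psi>\<^sub>\<alpha> \<psi>\<^sub>\<alpha>\<^sup>*\<close> is an explicit combination of \<open>1 - a a\<^sup>*\<close> and \<open>1 - p p\<^sup>*\<close> there. Separating
  \<open>\<Sum> \<phi>\<^sub>j \<phi>\<^sub>j\<^sup>* - \<epsilon>\<^sup>2\<close> from the cone generated by the kernels \<open>v v\<^sup>* (1 - g g\<^sup>*)\<close>, with \<open>g\<close> in a given family of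
  test functions, yields (3) for the family of the \<open>\<psi>\<^sub>\<alpha>\<close>, the \<open>\<Phi>\<^sub>\<alpha>\<close> and \<open>z\<^sub>2 / 2\<close>, and a two-term
  decomposition on the bidisc for the two coordinate functions; from the latter a lurking isometry
  produces the \<open>f\<^sub>j\<close> on finite sets, and compactness does the rest. That (3) implies (2) is the Schur
  product theorem.\<close>

section \<open>Positive semi-definite kernels\<close>

text \<open>The obstacle is that the test family is infinite and (1) and (3) ask for objects on
  infinite sets, while Gram factors and unitaries are built only on finite sets. Everything infinite
  is therefore a pointwise limit of finite constructions with a bound at every argument, and each
  condition kept in the limit has to involve finitely many values. Holomorphy is not of this form;
  it is encoded by interpolation estimates, which are. The bounds themselves come from the strict
  inequality \<open>|g z| <= \<rho> z < 1\<close>, uniform over the test family at each point. In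
  the seminorm of an admissible kernel, multiplication by a coordinate is a diagonal contraction, so
  Ando's theorem is needed only for commuting diagonal operators. Its commuting isometries act on
  finitely supported sequences; the inequality for them comes from comparing an \<open>R\<close> by
  \<open>R\<close> Toeplitz array with its discrete Fourier transform as \<open>R\<close> grows. In
  (2) the data depend on the first and third coordinates alone, so testing on the slice loses
  nothing. The realization yields a row of norm at most 1 whose product with the data is
  \<open>\<epsilon>\<close>; division by \<open>\<epsilon>\<close> produces the bound in
  (1).\<close>

lemma psd_onI:
  assumes "\<And>(N::nat) (z :: nat \<Rightarrow> 'a) c. (\<And>i. i \<in> {1..N} \<Longrightarrow> z i \<in> X) \<Longrightarrow>
        (\<Sum>i=1..N. \<Sum>j=1..N. k (z i) (z j) * c j * cnj (c i)) \<in> \<real>\<^sub>\<ge>\<^sub>0"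
  shows "psd_on X k"
  using assms unfolding psd_on_def by blast

lemma psd_onD:
  assumes "psd_on X k" "\<And>i. i \<in> {1..N} \<Longrightarrow> z i \<in> X"
  shows "(\<Sum>i=1..N::nat. \<Sum>j=1..N. k (z i) (z j) * c j * cnj (c i)) \<in> \<real>\<^sub>\<ge>\<^sub>0"
  using assms unfolding psd_on_def by blast

lemma psd_on_cong:
  assumes "\<And>z w. z \<in> X \<Longrightarrow> w \<in> X \<Longrightarrow> k z w = k' z w"
  shows "psd_on X k \<longleftrightarrow> psd_on X k'"
proof -
  have "(\<Sum>i=1..N::nat. \<Sum>j=1..N. k (z i) (z j) * c j * cnj (c i)) =
        (\<Sum>i=1..N. \<Sum>j=1..N. k' (z i) (z j) * c j * cnj (c i))"
    if "\<forall>i\<in>{1..N}. z i \<in> X" for N z c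
    using that assms by (intro sum.cong) auto
  then show ?thesis unfolding psd_on_def by simp
qed

lemma psd_on_add:
  assumes "psd_on X k" "psd_on X k'"
  shows "psd_on X (\<lambda>z w. k z w + k' z w)"
proof (rule psd_onI)
  fix N :: nat and z :: "nat \<Rightarrow> _" and c :: "nat \<Rightarrow> complex" assume z: "\<And>i. i \<in> {1..N} \<Longrightarrow> z i \<in> X"
  show "(\<Sum>i=1..N. \<Sum>j=1..N. (k (z i) (z j) + k' (z i) (z j)) * c j * cnj (c i)) \<in> \<real>\<^sub>\<ge>\<^sub>0"
    using nonneg_Reals_add_I[OF psd_onD[OF assms(1) z, where N = N and c = c] psd_onD[OF assms(2) z,
        where N = N and c = c]]
    by (simp add: sum.distrib algebra_simps)
qed

lemma psd_on_zero: "psd_on X (\<lambda>z w. 0)"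
  by (rule psd_onI) simp

lemma psd_on_sum:
  assumes "\<And>s. s \<in> S \<Longrightarrow> psd_on X (k s)"
  shows "psd_on X (\<lambda>z w. \<Sum>s\<in>S. k s z w)"
  using assms by (induction S rule: infinite_finite_induct) (auto intro: psd_on_add simp: psd_on_zero)

lemma psd_on_conj_mult:
  assumes "psd_on X k"
  shows "psd_on X (\<lambda>z w. f z * cnj (f w) * k z w)"
proof (rule psd_onI)
  fix N :: nat and z :: "nat \<Rightarrow> _" and c :: "nat \<Rightarrow> complex" assume z: "\<And>i. i \<in> {1..N} \<Longrightarrow> z i \<in> X"
  show "(\<Sum>i=1..N. \<Sum>j=1..N. f (z i) * cnj (f (z j)) * k (z i) (z j) * c j * cnj (c i)) \<in> \<real>\<^sub>\<ge>\<^sub>0"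
    using psd_onD[OF assms(1) z, where N = N and c = "\<lambda>j. cnj (f (z j)) * c j"]
    by (simp add: algebra_simps)
qed

lemma psd_on_scale:
  assumes "psd_on X k" "r \<ge> 0"
  shows "psd_on X (\<lambda>z w. of_real r * k z w)"
proof -
  have "complex_of_real r = of_real (sqrt r) * cnj (of_real (sqrt r))"
    using assms(2) by (simp flip: of_real_mult)
  then show ?thesis using psd_on_conj_mult[OF assms(1), of "\<lambda>_. of_real (sqrt r)"] by simp
qed

lemma psd_on_pullback:
  assumes "psd_on Y k" "\<And>x. x \<in> X \<Longrightarrow> f x \<in> Y"
  shows "psd_on X (\<lambda>z w. k (f z) (f w))"
proof (rule psd_onI)
  fix N :: nat and z :: "nat \<Rightarrow> _" and c :: "nat \<Rightarrow> complex" assume z: "\<And>i. i \<in> {1..N} \<Longrightarrow> z i \<in> X"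
  show "(\<Sum>i=1..N. \<Sum>j=1..N. k (f (z i)) (f (z j)) * c j * cnj (c i)) \<in> \<real>\<^sub>\<ge>\<^sub>0"
    using psd_onD[OF assms(1), of N "\<lambda>i. f (z i)" c] z assms(2) by simp
qed

lemma psd_on_tendsto:
  assumes "\<And>n. psd_on X (k n)"
    and "\<And>z w. z \<in> X \<Longrightarrow> w \<in> X \<Longrightarrow> (\<lambda>n::nat. k n z w) \<longlonglongrightarrow> l z w"
  shows "psd_on X l"
proof (rule psd_onI)
  fix N :: nat and z :: "nat \<Rightarrow> _" and c :: "nat \<Rightarrow> complex" assume z: "\<And>i. i \<in> {1..N} \<Longrightarrow> z i \<in> X"
  have "(\<lambda>n. \<Sum>i=1..N. \<Sum>j=1..N. k n (z i) (z j) * c j * cnj (c i))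
     \<longlonglongrightarrow> (\<Sum>i=1..N. \<Sum>j=1..N. l (z i) (z j) * c j * cnj (c i))"
    using z assms(2) by (intro tendsto_sum tendsto_mult tendsto_const) auto
  then show "(\<Sum>i=1..N. \<Sum>j=1..N. l (z i) (z j) * c j * cnj (c i)) \<in> \<real>\<^sub>\<ge>\<^sub>0"
    using psd_onD[OF assms(1) z]
    by (intro Lim_in_closed_set[OF closed_nonneg_Reals_complex _ _]) auto
qed

lemma psd_on_gram:
  fixes e :: "'m \<Rightarrow> 'a \<Rightarrow> complex"
  assumes "\<And>z w. z \<in> X \<Longrightarrow> w \<in> X \<Longrightarrow> k z w = (\<Sum>m\<in>M. e m z * cnj (e m w))"
  shows "psd_on X k"
proof -
  have one: "psd_on X (\<lambda>z w. e m z * cnj (e m w))" for m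
  proof (rule psd_onI)
    fix N :: nat and z :: "nat \<Rightarrow> 'a" and c :: "nat \<Rightarrow> complex"
    have "(\<Sum>i=1..N. \<Sum>j=1..N. e m (z i) * cnj (e m (z j)) * c j * cnj (c i)) =
      (\<Sum>i=1..N. e m (z i) * cnj (c i)) * cnj (\<Sum>i=1..N. e m (z i) * cnj (c i))"
      unfolding cnj_sum sum_product by (intro sum.cong) (auto simp: mult_ac)
    then show "(\<Sum>i=1..N. \<Sum>j=1..N. e m (z i) * cnj (e m (z j)) * c j * cnj (c i)) \<in> \<real>\<^sub>\<ge>\<^sub>0"
      by (simp only: complex_norm_square[symmetric]) simp
  qed
  show ?thesis
    using psd_on_sum[of M X "\<lambda>m z w. e m z * cnj (e m w)", OF one] psd_on_cong[of X k, OF assms] by simp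
qed

lemma psd_on_setD:
  assumes "psd_on X k" "finite F" "F \<subseteq> X"
  shows "(\<Sum>z\<in>F. \<Sum>w\<in>F. k z w * c w * cnj (c z)) \<in> \<real>\<^sub>\<ge>\<^sub>0"
proof -
  obtain h where h: "bij_betw h {1..card F} F"
    using ex_bij_betw_nat_finite_1[OF assms(2)] by blast
  have "(\<Sum>i=1..card F. \<Sum>j=1..card F. k (h i) (h j) * c (h j) * cnj (c (h i))) \<in> \<real>\<^sub>\<ge>\<^sub>0"
    using h assms(3) by (intro psd_onD[OF assms(1)]) (auto simp: bij_betw_def)
  moreover have "(\<Sum>i=1..card F. \<Sum>j=1..card F. k (h i) (h j) * c (h j) * cnj (c (h i)))
     = (\<Sum>z\<in>F. \<Sum>w\<in>F. k z w * c w * cnj (c z))"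
    using sum.reindex_bij_betw[OF h, where g = "\<lambda>w. k (h _) w * c w * cnj (c (h _))"]
        sum.reindex_bij_betw[OF h, where g = "\<lambda>z. \<Sum>w\<in>F. k z w * c w * cnj (c z)"]
    by simp
  ultimately show ?thesis by simp
qed

lemma psd_on_diag: 
  assumes "psd_on X k" "z \<in> X"
  shows "k z z \<in> \<real>\<^sub>\<ge>\<^sub>0"
  using psd_on_setD[OF assms(1), of "{z}" "\<lambda>_. 1"] assms(2) by simp

lemma psd_on_two:
  assumes "psd_on X k" "z \<in> X" "w \<in> X" "z \<noteq> w"
  shows "k z z * (a * cnj a) + k z w * b * cnj a + k w z * a * cnj b + k w w * (b * cnj b) \<in> \<real>\<^sub>\<ge>\<^sub>0"
  using psd_on_setD[OF assms(1), of "{z,w}" "\<lambda>x. if x = z then a else b"] assms(2-4) 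
  by (simp add: algebra_simps)

text \<open>A nonnegative form is real: the coefficient pairs \<open>(1, 1)\<close> and
  \<open>(1, i)\<close> read off the imaginary and the real part of
  \<open>k w z - cnj (k z w)\<close>.\<close>

lemma psd_on_hermitian:
  assumes "psd_on X k" "z \<in> X" "w \<in> X"
  shows "k w z = cnj (k z w)"
proof (cases "z = w")
  case True
  with psd_on_diag[OF assms(1,2)] show ?thesis
    by (auto simp: complex_nonneg_Reals_iff complex_eq_iff)
next
  case False
  note d = psd_on_diag[OF assms(1,2)] psd_on_diag[OF assms(1,3)]
  note t = psd_on_two[OF assms False, of 1 1] psd_on_two[OF assms False, of 1 \<i>]
  from d t show ?thesis
    by (auto simp: complex_nonneg_Reals_iff complex_eq_iff)
qed

lemma psd_on_zero_diag:
  assumes "psd_on X k" "z \<in> X" "w \<in> X" "k z z = 0"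
  shows "k z w = 0"
proof (rule ccontr)
  assume n: "k z w \<noteq> 0"
  then have neq: "z \<noteq> w" using assms(4) by auto
  define B where "B = Re (k w w)"
  have kww: "k w w = of_real B" "B \<ge> 0"
    using psd_on_diag[OF assms(1,3)] by (auto simp: B_def complex_nonneg_Reals_iff complex_eq_iff)
  \<comment> \<open>With this \<open>t\<close> the form at the coefficients \<open>(a, 1)\<close>
    equals \<open>B - (B + 1) = -1\<close>.\<close>
  define t where "t = (B + 1) / (2 * (cmod (k z w))\<^sup>2)"
  have pos: "(cmod (k z w))\<^sup>2 > 0" using n by simp
  define a where "a = - of_real t * k z w"
  have "k z w * 1 * cnj a + k w z * a * cnj 1 = - of_real (2 * t * (cmod (k z w))\<^sup>2)"
    unfolding a_def psd_on_hermitian[OF assms(1-3)] using complex_norm_square[of "k z w"]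
    by (simp add: algebra_simps)
  also have "2 * t * (cmod (k z w))\<^sup>2 = B + 1" using pos by (simp add: t_def)
  finally have "k z w * 1 * cnj a + k w z * a * cnj 1 = - of_real (B + 1)" .
  with psd_on_two[OF assms(1-3) neq, of a 1] have "(- 1 :: complex) \<in> \<real>\<^sub>\<ge>\<^sub>0"
    by (simp add: assms(4) kww add.assoc[symmetric])
  then show False by (simp add: complex_nonneg_Reals_iff)
qed

lemma psd_on_subset: "psd_on X k \<Longrightarrow> Y \<subseteq> X \<Longrightarrow> psd_on Y k"
  unfolding psd_on_def by blast

section \<open>Schur complements, Gram factors and Schur products\<close>

text \<open>Completing the square: \<open>x\<close> is appended to the sample with the coefficient
  that minimises the form. It may already occur in the sample, since sample points may
  repeat.\<close>

lemma psd_on_schur_complement: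
  assumes psd: "psd_on X k" and x: "x \<in> X" and nz: "k x x \<noteq> 0"
  shows "psd_on X (\<lambda>z w. k z w - k z x * k x w / k x x)"
proof (rule psd_onI)
  fix N :: nat and z :: "nat \<Rightarrow> _" and c :: "nat \<Rightarrow> complex" assume z: "\<And>i. i \<in> {1..N} \<Longrightarrow> z i \<in> X"
  define z' where "z' = z(Suc N := x)"
  define S where "S = (\<Sum>j=1..N. k x (z j) * c j)"
  define c' where "c' = c(Suc N := - S / k x x)"
  have z': "z' i \<in> X" if "i \<in> {1..Suc N}" for i using that z x by (auto simp: z'_def)
  have kxx: "cnj (k x x) = k x x" using psd_on_hermitian[OF psd x x] by simp
  have S': "(\<Sum>i=1..N. k (z i) x * cnj (c i)) = cnj S"
    unfolding S_def using z x by (simp add: psd_on_hermitian[OF psd x])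
  have "(\<Sum>i=1..Suc N. \<Sum>j=1..Suc N. k (z' i) (z' j) * c' j * cnj (c' i)) =
     (\<Sum>i=1..N. \<Sum>j=1..N. k (z i) (z j) * c j * cnj (c i))
     + (\<Sum>i=1..N. k (z i) x * cnj (c i)) * (- S / k x x) + S * cnj (- S / k x x)
     + k x x * (- S / k x x) * cnj (- S / k x x)"
  proof -
    have split: "(\<Sum>i=1..Suc N. \<Sum>j=1..Suc N. f i j) = (\<Sum>i=1..N. \<Sum>j=1..N. f i j)
       + (\<Sum>i=1..N. f i (Suc N)) + (\<Sum>j=1..N. f (Suc N) j) + f (Suc N) (Suc N)" for f :: "nat \<Rightarrow> nat \<Rightarrow> complex"
      by (simp add: sum.distrib)
    have "(\<Sum>i=1..N. \<Sum>j=1..N. k (z' i) (z' j) * c' j * cnj (c' i)) =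
        (\<Sum>i=1..N. \<Sum>j=1..N. k (z i) (z j) * c j * cnj (c i))"
      by (intro sum.cong) (auto simp: z'_def c'_def)
    moreover have "(\<Sum>i=1..N. k (z' i) (z' (Suc N)) * c' (Suc N) * cnj (c' i)) =
        (\<Sum>i=1..N. k (z i) x * cnj (c i)) * (- S / k x x)"
      unfolding sum_distrib_right by (intro sum.cong) (auto simp: z'_def c'_def)
    moreover have "(\<Sum>j=1..N. k (z' (Suc N)) (z' j) * c' j * cnj (c' (Suc N))) = S * cnj (- S / k x x)"
      unfolding S_def[THEN arg_cong[of _ _ "\<lambda>s. s * cnj (- S / k x x)"]] sum_distrib_right 
      by (intro sum.cong) (auto simp: z'_def c'_def)
    ultimately show ?thesis unfolding split by (simp add: z'_def c'_def)
  qed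
  also have "\<dots> = (\<Sum>i=1..N. \<Sum>j=1..N. k (z i) (z j) * c j * cnj (c i)) - cnj S * S / k x x"
    unfolding S' using nz by (simp add: kxx field_simps)
  also have "cnj S * S / k x x = (\<Sum>i=1..N. \<Sum>j=1..N. (k (z i) x * k x (z j) / k x x) * c j * cnj (c i))"
    unfolding S'[symmetric] unfolding S_def
    unfolding sum_product sum_divide_distrib by (intro sum.cong) (auto simp: mult_ac)
  finally have eq: "(\<Sum>i=1..Suc N. \<Sum>j=1..Suc N. k (z' i) (z' j) * c' j * cnj (c' i)) =
     (\<Sum>i=1..N. \<Sum>j=1..N. (k (z i) (z j) - k (z i) x * k x (z j) / k x x) * c j * cnj (c i))"
    by (simp only: sum_subtractf left_diff_distrib)
  show "(\<Sum>i=1..N. \<Sum>j=1..N. (k (z i) (z j) - k (z i) x * k x (z j) / k x x) * c j * cnj (c i)) \<in> \<real>\<^sub>\<ge>\<^sub>0"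
    unfolding eq[symmetric] by (rule psd_onD[OF psd z'])
qed

text \<open>Cholesky factorisation by induction on \<open>F\<close>: the new point contributes
  \<open>k z x / sqrt (k x x)\<close>, and the Schur complement, which vanishes in the row and
  column of \<open>x\<close>, is factored on the old set. The support condition on \<open>e\<close>
  is what lets the defect vectors of the dilation live on the finite index set.\<close>

lemma psd_on_imp_gram:
  assumes "finite F" "psd_on F k"
  obtains e :: "'a \<Rightarrow> 'a \<Rightarrow> complex"
  where "\<And>z w. z \<in> F \<Longrightarrow> w \<in> F \<Longrightarrow> k z w = (\<Sum>m\<in>F. e m z * cnj (e m w))"
    "\<And>m z. m \<notin> F \<Longrightarrow> e m z = 0"
proof -
  have "\<exists>e. (\<forall>z\<in>F. \<forall>w\<in>F. k z w = (\<Sum>m\<in>F. e m z * cnj (e m w))) \<and> (\<forall>m z. m \<notin> F \<longrightarrow> e m z = 0)"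
    using assms
  proof (induction F arbitrary: k rule: finite_induct)
    case empty then show ?case by auto
  next
    case (insert x F)
    note psd = insert.prems
    define r where "r = Re (k x x)"
    have r: "k x x = of_real r" "r \<ge> 0"
      using psd_on_diag[OF psd, of x] by (auto simp: r_def complex_nonneg_Reals_iff complex_eq_iff)
    define k' where "k' = (\<lambda>z w. k z w - k z x * k x w / k x x)"
    have "psd_on (insert x F) k'"
    proof (cases "k x x = 0")
      case True then show ?thesis using psd by (simp add: k'_def)
    next
      case False then show ?thesis unfolding k'_def by (intro psd_on_schur_complement psd) auto
    qed
    then obtain e where e: "\<forall>z\<in>F. \<forall>w\<in>F. k' z w = (\<Sum>m\<in>F. e m z * cnj (e m w))"
      "\<forall>m z. m \<notin> F \<longrightarrow> e m z = 0"
      using insert.IH[of k'] psd_on_subset[of "insert x F" k' F] by blast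
    define f where "f = (\<lambda>m z. if m = x then k z x / of_real (sqrt r) else if z = x then 0 else e m z)"
    \<comment> \<open>If \<open>k x x = 0\<close>, the quotient is \<open>0\<close> by the
      convention for division, and the row and column of \<open>x\<close> vanish too.\<close>
    have zero: "k z x * k x w / k x x = k z w" if "z = x \<or> w = x" "z \<in> insert x F" "w \<in> insert x F" for z w
      using that psd_on_zero_diag[OF psd, of x w] psd_on_zero_diag[OF psd, of x z]
        psd_on_hermitian[OF psd, of x z] by (cases "k x x = 0") auto
    have sq: "complex_of_real (sqrt r) * complex_of_real (sqrt r) = of_real r"
      using r by (simp flip: of_real_mult)
    have "k z w = (\<Sum>m\<in>insert x F. f m z * cnj (f m w))" if zw: "z \<in> insert x F" "w \<in> insert x F" for z w
    proof -
      have "f x z * cnj (f x w) = k z x * k x w / k x x"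
        using zw psd_on_hermitian[OF psd, of w x] by (simp add: f_def r sq)
      moreover have "(\<Sum>m\<in>F. f m z * cnj (f m w)) = k' z w"
      proof (cases "z = x \<or> w = x")
        case True
        have "(\<Sum>m\<in>F. f m z * cnj (f m w)) = 0"
          using True insert.hyps by (intro sum.neutral) (auto simp: f_def)
        then show ?thesis using zero[OF True zw] by (simp add: k'_def)
      next
        case False
        then have "(\<Sum>m\<in>F. f m z * cnj (f m w)) = (\<Sum>m\<in>F. e m z * cnj (e m w))"
          using insert.hyps by (intro sum.cong) (auto simp: f_def)
        then show ?thesis using e(1) zw False by auto
      qed
      ultimately show ?thesis using insert.hyps by (simp add: k'_def)
    qed
    moreover have "f m z = 0" if "m \<notin> insert x F" for m z using that e(2) by (simp add: f_def)
    ultimately show ?case by blast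
  qed
  then show ?thesis using that by blast
qed

lemma psd_on_finiteI:
  assumes "\<And>F. finite F \<Longrightarrow> F \<subseteq> X \<Longrightarrow> psd_on F k"
  shows "psd_on X k"
proof (rule psd_onI)
  fix N :: nat and z :: "nat \<Rightarrow> _" and c :: "nat \<Rightarrow> complex" assume z: "\<And>i. i \<in> {1..N} \<Longrightarrow> z i \<in> X"
  have "psd_on (z ` {1..N}) k" using z by (intro assms) auto
  then show "(\<Sum>i=1..N. \<Sum>j=1..N. k (z i) (z j) * c j * cnj (c i)) \<in> \<real>\<^sub>\<ge>\<^sub>0"
    by (rule psd_onD) auto
qed

text \<open>A Gram factorisation of \<open>k\<close> on a finite set turns the product into a sum of
  the kernels \<open>e m z * cnj (e m w) * k' z w\<close>.\<close>

lemma psd_on_schur: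
  assumes "psd_on X k" "psd_on X k'"
  shows "psd_on X (\<lambda>z w. k z w * k' z w)"
proof (rule psd_on_finiteI)
  fix F assume F: "finite F" "F \<subseteq> X"
  obtain e where e: "\<And>z w. z \<in> F \<Longrightarrow> w \<in> F \<Longrightarrow> k z w = (\<Sum>m\<in>F. e m z * cnj (e m w))"
    using psd_on_imp_gram[OF F(1) psd_on_subset[OF assms(1) F(2)]] by metis
  have "psd_on F (\<lambda>z w. \<Sum>m\<in>F. e m z * cnj (e m w) * k' z w)"
    by (intro psd_on_sum psd_on_conj_mult psd_on_subset[OF assms(2) F(2)])
  then show "psd_on F (\<lambda>z w. k z w * k' z w)"
    by (subst psd_on_cong) (auto simp: e sum_distrib_right)
qed

lemma psd_on_delta:
  assumes "\<And>z. z \<in> X \<Longrightarrow> d z \<ge> 0"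
  shows "psd_on X (\<lambda>z w. if z = w then complex_of_real (d z) else 0)"
proof (rule psd_on_finiteI)
  fix F assume F: "finite F" "F \<subseteq> X"
  show "psd_on F (\<lambda>z w. if z = w then complex_of_real (d z) else 0)"
  proof (rule psd_on_gram[where M = F and e = "\<lambda>m z. if m = z then of_real (sqrt (d z)) else 0"])
    fix z w assume zw: "z \<in> F" "w \<in> F"
    have "(\<Sum>m\<in>F. (if m = z then complex_of_real (sqrt (d z)) else 0) * cnj (if m
        = w then of_real (sqrt (d w)) else 0))
      = (\<Sum>m\<in>F. if m = z then of_real (sqrt (d z)) * (if z = w then of_real (sqrt (d w)) else 0) else 0)"
      by (intro sum.cong) auto
    also have "\<dots> = (if z = w then complex_of_real (d z) else 0)"
      using F zw assms[of z] by (auto simp flip: of_real_mult)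
    finally show "(if z = w then complex_of_real (d z) else 0) = 
      (\<Sum>m\<in>F. (if m = z then complex_of_real (sqrt (d z)) else 0) * cnj (if m
          = w then of_real (sqrt (d w)) else 0))" ..
  qed
qed

text \<open>Division by \<open>1 - g(z) g(w)\<^sup>*\<close> is multiplication by a geometric series of positive kernels.\<close>

lemma psd_on_szego_divide:
  assumes psd: "psd_on X (\<lambda>z w. (1 - g z * cnj (g w)) * k z w)"
    and g: "\<And>z. z \<in> X \<Longrightarrow> cmod (g z) < 1"
  shows "psd_on X k"
proof (rule psd_on_tendsto)
  fix n :: nat
  have "psd_on X (\<lambda>z w. \<Sum>m<n. g z ^ m * cnj (g w ^ m) * ((1 - g z * cnj (g w)) * k z w))"
    by (intro psd_on_sum psd_on_conj_mult psd)
  moreover have "(\<Sum>m<n. g z ^ m * cnj (g w ^ m) * ((1 - g z * cnj (g w)) * k z w)) = 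
     (1 - (g z * cnj (g w)) ^ n) * k z w" for z w
    unfolding one_diff_power_eq[of "g z * cnj (g w)" n] sum_distrib_left sum_distrib_right
    by (intro sum.cong) (auto simp: power_mult_distrib)
  ultimately show "psd_on X (\<lambda>z w. (1 - (g z * cnj (g w)) ^ n) * k z w)" by simp
next
  fix z w assume "z \<in> X" "w \<in> X"
  then have "cmod (g z) * cmod (g w) < 1 * 1" using g by (intro mult_strict_mono') auto
  then have "cmod (g z * cnj (g w)) < 1" by (simp add: norm_mult)
  then have "(\<lambda>n. (g z * cnj (g w)) ^ n) \<longlonglongrightarrow> 0" by (rule LIMSEQ_power_zero)
  then have "(\<lambda>n. (1 - (g z * cnj (g w)) ^ n) * k z w) \<longlonglongrightarrow> (1 - 0) * k z w"
    by (intro tendsto_mult tendsto_diff tendsto_const)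
  then show "(\<lambda>n. (1 - (g z * cnj (g w)) ^ n) * k z w) \<longlonglongrightarrow> k z w" by simp
qed

text \<open>Repeated sample points are merged by adding their coefficients; \<open>C\<close> is the
  merged coefficient.\<close>

lemma psd_on_setI:
  assumes fin: "finite F" and sum: "\<And>c. (\<Sum>z\<in>F. \<Sum>w\<in>F. k z w * c w * cnj (c z)) \<in> \<real>\<^sub>\<ge>\<^sub>0"
  shows "psd_on F k"
proof (rule psd_onI)
  fix N :: nat and z :: "nat \<Rightarrow> 'a" and c :: "nat \<Rightarrow> complex"
  assume z: "\<And>i. i \<in> {1..N} \<Longrightarrow> z i \<in> F"
  define C where "C = (\<lambda>x. \<Sum>i | i \<in> {1..N} \<and> z i = x. c i)"
  have im: "z ` {1..N} \<subseteq> F" using z by auto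
  have "(\<Sum>x\<in>F. \<Sum>y\<in>F. k x y * C y * cnj (C x)) =
    (\<Sum>x\<in>F. \<Sum>i | i \<in> {1..N} \<and> z i = x. \<Sum>y\<in>F. \<Sum>j | j \<in> {1..N} \<and> z j = y. k (z i) (z j) * c j * cnj (c i))"
  proof (intro sum.cong refl)
    fix x
    have "(\<Sum>y\<in>F. k x y * C y * cnj (C x)) = (\<Sum>y\<in>F. \<Sum>i | i \<in> {1..N} \<and> z i = x. \<Sum>j | j \<in> {1..N} \<and> z j
        = y. k (z i) (z j) * c j * cnj (c i))"
    proof (intro sum.cong refl)
      fix y
      have "k x y * C y * cnj (C x) = (\<Sum>i | i \<in> {1..N} \<and> z i = x. \<Sum>j | j \<in> {1..N} \<and> z j
          = y. k x y * c j * cnj (c i))"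
        unfolding C_def cnj_sum sum_distrib_left sum_distrib_right ..
      also have "\<dots> = (\<Sum>i | i \<in> {1..N} \<and> z i = x. \<Sum>j | j \<in> {1..N} \<and> z j
          = y. k (z i) (z j) * c j * cnj (c i))"
        by (intro sum.cong refl) auto
      finally show "k x y * C y * cnj (C x) = \<dots>" .
    qed
    also have "\<dots> = (\<Sum>i | i \<in> {1..N} \<and> z i = x. \<Sum>y\<in>F. \<Sum>j | j \<in> {1..N} \<and> z j
        = y. k (z i) (z j) * c j * cnj (c i))"
      by (rule sum.swap)
    finally show "(\<Sum>y\<in>F. k x y * C y * cnj (C x)) = \<dots>" .
  qed
  also have "\<dots> = (\<Sum>i=1..N. \<Sum>y\<in>F. \<Sum>j | j \<in> {1..N} \<and> z j = y. k (z i) (z j) * c j * cnj (c i))"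
    by (rule sum.group) (use fin im in auto)
  also have "\<dots> = (\<Sum>i=1..N. \<Sum>j=1..N. k (z i) (z j) * c j * cnj (c i))"
    by (intro sum.cong refl, rule sum.group) (use fin im in auto)
  finally show "(\<Sum>i=1..N. \<Sum>j=1..N. k (z i) (z j) * c j * cnj (c i)) \<in> \<real>\<^sub>\<ge>\<^sub>0"
    using sum[of C] by simp
qed

lemma psd_on_extend_zero:
  assumes "psd_on F k"
  shows "psd_on X (\<lambda>z w. if z \<in> F \<and> w \<in> F then k z w else 0)"
proof (cases "F = {}")
  case True then show ?thesis by (simp add: psd_on_zero)
next
  case False
  then obtain f where f: "f \<in> F" by auto
  \<comment> \<open>A retraction onto \<open>F\<close>; the indicator factors erase what it does
    elsewhere.\<close>
  define p where "p = (\<lambda>z. if z \<in> F then z else f)"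
  have "psd_on X (\<lambda>z w. of_bool (z \<in> F) * cnj (of_bool (w \<in> F)) * k (p z) (p w))"
    by (intro psd_on_conj_mult psd_on_pullback[OF assms]) (use f in \<open>auto simp: p_def\<close>)
  moreover have "of_bool (z \<in> F) * cnj (of_bool (w \<in> F)) * k (p z) (p w)
      = (if z \<in> F \<and> w \<in> F then k z w else 0)" for z w
    by (auto simp: p_def)
  ultimately show ?thesis by simp
qed

section \<open>Ando's inequality\<close>

definition inner_on :: "'i set \<Rightarrow> ('i \<Rightarrow> complex) \<Rightarrow> ('i \<Rightarrow> complex) \<Rightarrow> complex" where
  "inner_on I x y = (\<Sum>i\<in>I. x i * cnj (y i))"

definition sqnorm :: "'i set \<Rightarrow> ('i \<Rightarrow> complex) \<Rightarrow> real" where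
  "sqnorm I x = (\<Sum>i\<in>I. (cmod (x i))\<^sup>2)"

definition complex_linear :: "(('i \<Rightarrow> complex) \<Rightarrow> 'j \<Rightarrow> complex) \<Rightarrow> bool" where
  "complex_linear G \<longleftrightarrow> (\<forall>x y. G (\<lambda>i. x i + y i) = (\<lambda>j. G x j + G y j))
      \<and> (\<forall>k x. G (\<lambda>i. k * x i) = (\<lambda>j. k * G x j))"

lemma inner_on_self: "inner_on I x x = of_real (sqnorm I x)"
  unfolding inner_on_def sqnorm_def complex_norm_square[symmetric] by simp

lemma inner_on_add_left: "inner_on I (\<lambda>i. x i + y i) z = inner_on I x z + inner_on I y z"
  by (simp add: inner_on_def algebra_simps sum.distrib)

lemma inner_on_diff_left: "inner_on I (\<lambda>i. x i - y i) z = inner_on I x z - inner_on I y z"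
  by (simp add: inner_on_def algebra_simps sum_subtractf)

lemma inner_on_scale_left: "inner_on I (\<lambda>i. k * x i) z = k * inner_on I x z"
  by (simp add: inner_on_def algebra_simps sum_distrib_left)

lemma inner_on_cnj: "cnj (inner_on I x y) = inner_on I y x"
  by (simp add: inner_on_def mult.commute)

lemma inner_on_diff_right: "inner_on I z (\<lambda>i. x i - y i) = inner_on I z x - inner_on I z y"
  by (simp add: inner_on_def algebra_simps sum_subtractf)

lemma inner_on_scale_right: "inner_on I z (\<lambda>i. k * x i) = cnj k * inner_on I z x"
  by (simp add: inner_on_def algebra_simps sum_distrib_left)

lemma sqnorm_nonneg: "sqnorm I x \<ge> 0"
  by (simp add: sqnorm_def sum_nonneg)

lemma sqnorm_eq_0: "finite I \<Longrightarrow> sqnorm I x = 0 \<longleftrightarrow> (\<forall>i\<in>I. x i = 0)"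
  by (simp add: sqnorm_def sum_nonneg_eq_0_iff)

lemma norm_inner_on_le: "(cmod (inner_on I x y))\<^sup>2 \<le> sqnorm I x * sqnorm I y"
proof -
  have "cmod (inner_on I x y) \<le> (\<Sum>i\<in>I. \<bar>cmod (x i)\<bar> * \<bar>cmod (y i)\<bar>)"
    unfolding inner_on_def by (rule order.trans[OF norm_sum]) (simp add: norm_mult)
  also have "\<dots> \<le> L2_set (\<lambda>i. cmod (x i)) I * L2_set (\<lambda>i. cmod (y i)) I"
    by (rule L2_set_mult_ineq)
  finally have "(cmod (inner_on I x y))\<^sup>2 \<le> (L2_set (\<lambda>i. cmod (x i)) I * L2_set (\<lambda>i. cmod (y i)) I)\<^sup>2"
    by (intro power_mono) auto
  also have "\<dots> = sqnorm I x * sqnorm I y"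
    by (simp add: power_mult_distrib L2_set_def sqnorm_def sum_nonneg)
  finally show ?thesis .
qed

lemma complex_linear_add: "complex_linear G \<Longrightarrow> G (\<lambda>i. x i + y i) = (\<lambda>j. G x j + G y j)"
  by (simp add: complex_linear_def)

lemma complex_linear_scale: "complex_linear G \<Longrightarrow> G (\<lambda>i. k * x i) = (\<lambda>j. k * G x j)"
  by (simp add: complex_linear_def)

lemma complex_linear_zero:
  assumes "complex_linear G" shows "G (\<lambda>i. 0) = (\<lambda>j. 0)"
  using complex_linear_scale[OF assms, of 0 "\<lambda>i. 0"] by simp

lemma complex_linear_sum:
  assumes "complex_linear G"
  shows "G (\<lambda>i. \<Sum>s\<in>S. u s * x s i) = (\<lambda>j. \<Sum>s\<in>S. u s * G (x s) j)"
  by (induction S rule: infinite_finite_induct)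
     (simp_all add: complex_linear_zero[OF assms] complex_linear_add[OF assms] complex_linear_scale[OF
         assms])

lemma complex_linear_comp: "complex_linear G \<Longrightarrow> complex_linear H \<Longrightarrow> complex_linear (\<lambda>x. G (H x))"
  by (simp add: complex_linear_def)

lemma polarization: 
  assumes "complex_linear G" "\<And>x. sqnorm I (G x) = sqnorm J x"
  shows "inner_on I (G x) (G y) = inner_on J x y"
proof -
  have *: "inner_on K (\<lambda>i. x i + y i) (\<lambda>i. x i + y i) = of_real (sqnorm K x) + of_real (sqnorm K y)
      + of_real (2 * Re (inner_on K x y))" 
    for K :: "'k set" and x y
  proof -
    have "inner_on K (\<lambda>i. x i + y i) (\<lambda>i. x i + y i) = inner_on K x x + inner_on K y y
        + (inner_on K x y + cnj (inner_on K x y))"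
      unfolding inner_on_cnj by (simp add: inner_on_def algebra_simps sum.distrib)
    then show ?thesis by (simp add: inner_on_self complex_add_cnj)
  qed
  have re: "Re (inner_on I (G x) (G y)) = Re (inner_on J x y)" for x y
    using arg_cong[OF *[of I "G x" "G y"], of Re] arg_cong[OF *[of J x y], of Re] assms(2)[of "\<lambda>i. x i
        + y i"] assms(2)[of x] assms(2)[of y]
    by (simp add: inner_on_self complex_linear_add[OF assms(1)])
  have "Im (inner_on I (G x) (G y)) = Im (inner_on J x y)"
    using re[of "\<lambda>i. \<i> * x i" y] by (simp add: complex_linear_scale[OF assms(1)] inner_on_scale_left)
  with re[of x y] show ?thesis by (simp add: complex_eq_iff)
qed

section \<open>Extension of partial isometries to unitaries\<close>

definition unitary_on :: "'i set \<Rightarrow> (('i \<Rightarrow> complex) \<Rightarrow> 'i \<Rightarrow> complex) \<Rightarrow> (('i \<Rightarrow> complex) \<Rightarrow> 'i \<Rightarrow> complex) \<Rightarrow>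
    bool" where
  "unitary_on I G G' \<longleftrightarrow> complex_linear G \<and> complex_linear G' \<and> (\<forall>x. G (G' x) = x) \<and> (\<forall>x. G' (G x) = x) \<and>
     (\<forall>x. sqnorm I (G x) = sqnorm I x)"

lemma unitary_onD:
  assumes "unitary_on I G G'"
  shows "complex_linear G" "complex_linear G'" "G (G' x) = x" "G' (G x) = x" "sqnorm I (G x)
      = sqnorm I x" "sqnorm I (G' x) = sqnorm I x"
proof -
  show "complex_linear G" "complex_linear G'" "G (G' x) = x" "G' (G x) = x" "sqnorm I (G x) = sqnorm I x"
    using assms by (auto simp: unitary_on_def)
  show "sqnorm I (G' x) = sqnorm I x"
    using assms unfolding unitary_on_def by metis
qed

lemma unitary_on_id: "unitary_on I (\<lambda>x. x) (\<lambda>x. x)"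
  by (simp add: unitary_on_def complex_linear_def)

lemma unitary_on_comp:
  assumes "unitary_on I G G'" "unitary_on I R R'"
  shows "unitary_on I (\<lambda>x. R (G x)) (\<lambda>x. G' (R' x))"
  unfolding unitary_on_def
  using unitary_onD[OF assms(1)] unitary_onD[OF assms(2)] by (simp add: complex_linear_comp)

text \<open>The map \<open>x \<mapsto> x - (\<langle>x,v\<rangle> / \<langle>a,v\<rangle>) v\<close> with \<open>v = a - b\<close> is unitary because
  \<open>2 Re \<langle>a,v\<rangle> = \<parallel>v\<parallel>\<^sup>2\<close>; it takes \<open>a\<close> to \<open>b\<close> and fixes the orthogonal complement of \<open>v\<close>.\<close>

lemma unitary_reflection:
  fixes a b :: "'i \<Rightarrow> complex"
  assumes fin: "finite I" and eq: "sqnorm I a = sqnorm I b"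
    and supp: "\<And>i. i \<notin> I \<Longrightarrow> a i = 0" "\<And>i. i \<notin> I \<Longrightarrow> b i = 0"
  shows "\<exists>R R'. unitary_on I R R' \<and> R a = b \<and> (\<forall>x. inner_on I x a = inner_on I x b \<longrightarrow> R x = x) \<and>
    (\<forall>x i. i \<notin> I \<longrightarrow> R x i = x i)"
proof (cases "sqnorm I (\<lambda>i. a i - b i) = 0")
  case True
  then have "a = b" using supp fin by (auto simp: sqnorm_eq_0 fun_eq_iff)
  then show ?thesis using unitary_on_id by blast
next
  case False
  define v where "v = (\<lambda>i. a i - b i)"
  define s where "s = inner_on I a v"
  define n where "n = complex_of_real (sqnorm I v)"
  have n0: "n \<noteq> 0" using False by (simp add: n_def v_def)
  have "s + cnj s = n"
    unfolding s_def n_def inner_on_cnj inner_on_self[symmetric] unfolding v_def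
    using arg_cong[OF eq, of complex_of_real] unfolding inner_on_self[symmetric]
    by (simp add: inner_on_diff_left inner_on_diff_right)
  then have s0: "s \<noteq> 0" using n0 by auto
  note sn = \<open>s + cnj s = n\<close>
  define R where "R = (\<lambda>x i. x i - inner_on I x v / s * v i)"
  define R' where "R' = (\<lambda>x i. x i - inner_on I x v / cnj s * v i)"
  have vv: "inner_on I v v = n" by (simp add: n_def inner_on_self)
  have R1: "inner_on I (R x) v = inner_on I x v * (1 - n / s)" for x
    unfolding R_def inner_on_diff_left inner_on_scale_left vv by (simp add: right_diff_distrib)
  have R'1: "inner_on I (R' x) v = inner_on I x v * (1 - n / cnj s)" for x
    unfolding R'_def inner_on_diff_left inner_on_scale_left vv by (simp add: right_diff_distrib)
  have lin: "complex_linear R" "complex_linear R'"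
    unfolding complex_linear_def R_def R'_def by (auto simp: inner_on_add_left inner_on_scale_left
        add_divide_distrib algebra_simps)
  have c0: "1 / s + (1 - n / s) / cnj s = 0" "1 / cnj s + (1 - n / cnj s) / s = 0"
    using s0 by (auto simp: sn[symmetric] field_simps)
  have "R' (R x) i = x i - inner_on I x v * (1 / s + (1 - n / s) / cnj s) * v i" for x i
    unfolding R'_def[THEN fun_cong, of "R x"] R1 unfolding R_def using s0 by (simp add: algebra_simps)
  then have inv1: "R' (R x) = x" for x unfolding c0 by auto
  have "R (R' x) i = x i - inner_on I x v * (1 / cnj s + (1 - n / cnj s) / s) * v i" for x i
    unfolding R_def[THEN fun_cong, of "R' x"] R'1 unfolding R'_def using s0 by (simp add: algebra_simps)
  then have inv2: "R (R' x) = x" for x unfolding c0 by auto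
  have "inner_on I (R x) (R x) = inner_on I x x" for x
  proof -
    define q where "q = inner_on I x v"
    have "inner_on I (R x) (R x) = inner_on I x x - cnj (q/s) * inner_on I x v - q / s * inner_on I v x
        + q / s * cnj (q / s) * inner_on I v v"
      unfolding R_def inner_on_diff_left inner_on_diff_right inner_on_scale_left inner_on_scale_right
          by (simp add: q_def algebra_simps)
    also have "\<dots> = inner_on I x x - q * cnj q * (1 / cnj s + 1 / s - n / (s * cnj s))"
      unfolding vv inner_on_cnj[of I x v, symmetric] q_def[symmetric] by (simp add: field_simps)
    also have "1 / cnj s + 1 / s - n / (s * cnj s) = 0" using s0 by (auto simp: sn[symmetric] field_simps)
    finally show ?thesis by simp
  qed
  then have iso: "sqnorm I (R x) = sqnorm I x" for x unfolding inner_on_self of_real_eq_iff .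
  have "R a = b" using s0 unfolding R_def s_def[symmetric] by (simp add: v_def)
  moreover have "R x = x" if "inner_on I x a = inner_on I x b" for x
    using that unfolding R_def v_def by (simp add: inner_on_diff_right)
  moreover have "R x i = x i" if "i \<notin> I" for x i
    using that supp by (simp add: R_def v_def)
  moreover have "unitary_on I R R'" using lin inv1 inv2 iso by (simp add: unitary_on_def)
  ultimately show ?thesis by blast
qed

text \<open>One vector at a time: once \<open>G\<close> takes each \<open>a g\<close> to
  \<open>b g\<close>, it is followed by the reflection taking \<open>G (a f)\<close> to
  \<open>b f\<close>. Equality of the Gram matrices says that \<open>b g\<close> has the same inner
  product with these two vectors, so the reflection fixes it.\<close>

lemma unitary_extension:
  fixes a b :: "'f \<Rightarrow> 'i \<Rightarrow> complex"
  assumes "finite S" and fin: "finite I"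
    and supp: "\<And>f i. i \<notin> I \<Longrightarrow> a f i = 0" "\<And>f i. i \<notin> I \<Longrightarrow> b f i = 0"
    and eq: "\<And>f g. f \<in> S \<Longrightarrow> g \<in> S \<Longrightarrow> inner_on I (a f) (a g) = inner_on I (b f) (b g)"
  shows "\<exists>G G'. unitary_on I G G' \<and> (\<forall>f\<in>S. G (a f) = b f)"
proof -
  \<comment> \<open>The added clause, that \<open>G\<close> is the identity outside
    \<open>I\<close>, keeps \<open>G (a f)\<close> supported in \<open>I\<close>, as the reflection
    requires.\<close>
  have "\<exists>G G'. unitary_on I G G' \<and> (\<forall>f\<in>S. G (a f) = b f) \<and> (\<forall>x i. i \<notin> I \<longrightarrow> G x i = x i)"
    using assms(1) eq
  proof (induction S rule: finite_induct)
    case empty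
    show ?case using unitary_on_id by blast
  next
    case (insert f S)
    then obtain G G' where G: "unitary_on I G G'" "\<And>f. f \<in> S \<Longrightarrow> G (a f) = b f" 
      "\<And>x i. i \<notin> I \<Longrightarrow> G x i = x i" by (metis insertCI)
    note U = unitary_onD[OF G(1)]
    have "complex_of_real (sqnorm I (G (a f))) = of_real (sqnorm I (b f))"
      unfolding U(5) unfolding inner_on_self[symmetric] using insert.prems by simp
    then have n: "sqnorm I (G (a f)) = sqnorm I (b f)" by (simp only: of_real_eq_iff)
    have sG: "G (a f) i = 0" if "i \<notin> I" for i using G(3) supp that by simp
    obtain R R' where R: "unitary_on I R R'" "R (G (a f)) = b f" 
      "\<And>x. inner_on I x (G (a f)) = inner_on I x (b f) \<Longrightarrow> R x = x" "\<And>x i. i \<notin> I \<Longrightarrow> R x i = x i"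
      using unitary_reflection[OF fin n sG supp(2)] by metis
    have "R (b g) = b g" if "g \<in> S" for g
    proof (rule R(3))
      show "inner_on I (b g) (G (a f)) = inner_on I (b g) (b f)"
        using polarization[OF U(1,5), of "a g" "a f"] insert.prems that G(2)[OF that] by simp
    qed
    then have "R (G (a g)) = b g" if "g \<in> insert f S" for g using that R(2) G(2) by auto
    then show ?case using unitary_on_comp[OF G(1) R(1)] G(3) R(4)
      by (intro exI[of _ "\<lambda>x. R (G x)"] exI[of _ "\<lambda>x. G' (R' x)"] conjI) auto
  qed
  then show ?thesis by blast
qed

section \<open>Ando's commuting isometric dilation\<close>

text \<open>Schaeffer's isometric dilation of \<open>diag b\<close> with defect factor
  \<open>E\<close>: the defect of the head enters the first slot and the tail moves on by one slot.
  Two slots form a block, so the product of two half shifts moves by a whole block, on which one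
  unitary can act.\<close>

definition half_shift :: "'f set \<Rightarrow> ('f \<Rightarrow> 'f \<Rightarrow> complex) \<Rightarrow> ('f \<Rightarrow> complex) \<Rightarrow>
    ('f + nat \<times> ('f + 'f) \<Rightarrow> complex) \<Rightarrow> 'f + nat \<times> ('f + 'f) \<Rightarrow> complex" where
  "half_shift S E b x c = (case c of Inl i \<Rightarrow> b i * x (Inl i)
     | Inr (k, Inl i) \<Rightarrow> (case k of 0 \<Rightarrow> \<Sum>j\<in>S. E i j * x (Inl j) | Suc k' \<Rightarrow> x (Inr (k', Inr i)))
     | Inr (k, Inr i) \<Rightarrow> x (Inr (k, Inl i)))"

definition blockwise :: "(('g \<Rightarrow> complex) \<Rightarrow> 'g \<Rightarrow> complex) \<Rightarrow> ('f + nat \<times> 'g \<Rightarrow> complex) \<Rightarrow> 'f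
    + nat \<times> 'g \<Rightarrow> complex" where
  "blockwise G x c = (case c of Inl i \<Rightarrow> x (Inl i) | Inr (k, i) \<Rightarrow> G (\<lambda>i. x (Inr (k, i))) i)"

text \<open>The head is measured in the seminorm of the kernel with Gram factor \<open>E\<close>.
  For vectors whose blocks from \<open>L\<close> on vanish this is the full squared norm.\<close>

definition dil_norm :: "'f set \<Rightarrow> ('f \<Rightarrow> 'f \<Rightarrow> complex) \<Rightarrow> nat \<Rightarrow> ('f + nat \<times> ('f + 'f) \<Rightarrow> complex) \<Rightarrow> real" where
  "dil_norm S E L x = sqnorm S (\<lambda>k. \<Sum>j\<in>S. E k j * x (Inl j))
      + (\<Sum>k<L. sqnorm (S <+> S) (\<lambda>c. x (Inr (k, c))))"

lemma half_shift_simps [simp]: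
  "half_shift S E b x (Inl i) = b i * x (Inl i)"
  "half_shift S E b x (Inr (0, Inl i)) = (\<Sum>j\<in>S. E i j * x (Inl j))"
  "half_shift S E b x (Inr (Suc k, Inl i)) = x (Inr (k, Inr i))"
  "half_shift S E b x (Inr (k, Inr i)) = x (Inr (k, Inl i))"
  by (simp_all add: half_shift_def)

lemma blockwise_simps [simp]:
  "blockwise G x (Inl i) = x (Inl i)"
  "blockwise G x (Inr (k, c)) = G (\<lambda>i. x (Inr (k, i))) c"
  by (simp_all add: blockwise_def)

lemma complex_linear_half_shift: "complex_linear (half_shift S E b)"
  unfolding complex_linear_def
  by (auto simp: half_shift_def fun_eq_iff algebra_simps sum.distrib sum_distrib_left split: sum.splits
      nat.splits)

lemma complex_linear_blockwise:
  assumes "complex_linear G" shows "complex_linear (blockwise G)"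
  unfolding complex_linear_def
  by (auto simp: blockwise_def fun_eq_iff complex_linear_add[OF assms] complex_linear_scale[OF assms]
      split: sum.splits)

lemma sqnorm_Plus:
  "finite S \<Longrightarrow> finite T \<Longrightarrow> sqnorm (S <+> T) x = sqnorm S (\<lambda>i. x (Inl i)) + sqnorm T (\<lambda>i. x (Inr i))"
  by (simp add: sqnorm_def sum.Plus)

lemma inner_on_Plus:
  "finite S \<Longrightarrow> finite T \<Longrightarrow> inner_on (S <+> T) x y = inner_on S (\<lambda>i. x (Inl i)) (\<lambda>i. y (Inl i))
      + inner_on T (\<lambda>i. x (Inr i)) (\<lambda>i. y (Inr i))"
  by (simp add: inner_on_def sum.Plus)

lemma sqnorm_gram:
  "of_real (sqnorm S (\<lambda>k. \<Sum>j\<in>T. E k j * x j)) = (\<Sum>f\<in>T. \<Sum>g\<in>T. x f * cnj (x g)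
      * inner_on S (\<lambda>k. E k f) (\<lambda>k. E k g))"
proof -
  have "of_real (sqnorm S (\<lambda>k. \<Sum>j\<in>T. E k j * x j))
      = (\<Sum>k\<in>S. \<Sum>f\<in>T. \<Sum>g\<in>T. x f * cnj (x g) * (E k f * cnj (E k g)))"
    unfolding inner_on_self[symmetric] inner_on_def cnj_sum sum_product
        by (intro sum.cong) (auto simp: mult_ac)
  also have "\<dots> = (\<Sum>f\<in>T. \<Sum>g\<in>T. \<Sum>k\<in>S. x f * cnj (x g) * (E k f * cnj (E k g)))"
    by (subst sum.swap) (intro sum.cong refl, rule sum.swap)
  finally show ?thesis unfolding inner_on_def sum_distrib_left .
qed

text \<open>\<open>gram\<close> makes \<open>E\<close> a defect factor:
  \<open>|b h|^2 + |E h|^2 = |h|^2\<close> for a head \<open>h\<close>, with \<open>|b h|\<close>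
  and \<open>|h|\<close> in the \<open>E0\<close> seminorm. The tail is only moved; its last slot
  may spill into block \<open>L\<close>, whence \<open>Suc L\<close>.\<close>

lemma half_shift_isometry:
  assumes fin: "finite S"
    and gram: "\<And>f g. f \<in> S \<Longrightarrow> g \<in> S \<Longrightarrow>
      inner_on S (\<lambda>k. E k f) (\<lambda>k. E k g) = (1 - b f * cnj (b g)) * inner_on S (\<lambda>k. E0 k f) (\<lambda>k. E0 k g)"
    and supp: "\<And>k c. k \<ge> L \<Longrightarrow> x (Inr (k, c)) = 0"
  shows "dil_norm S E0 (Suc L) (half_shift S E b x) = dil_norm S E0 L x"
    "k \<ge> Suc L \<Longrightarrow> half_shift S E b x (Inr (k, c)) = 0"
proof -
  have "complex_of_real (sqnorm S (\<lambda>k. \<Sum>j\<in>S. E0 k j * (b j * x (Inl j)))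
      + sqnorm S (\<lambda>k. \<Sum>j\<in>S. E k j * x (Inl j)))
     = of_real (sqnorm S (\<lambda>k. \<Sum>j\<in>S. E0 k j * x (Inl j)))"
    unfolding of_real_add sqnorm_gram sum.distrib[symmetric]
    by (intro sum.cong refl) (simp add: gram algebra_simps)
  then have head: "sqnorm S (\<lambda>k. \<Sum>j\<in>S. E0 k j * (b j * x (Inl j)))
      + sqnorm S (\<lambda>k. \<Sum>j\<in>S. E k j * x (Inl j)) =
     sqnorm S (\<lambda>k. \<Sum>j\<in>S. E0 k j * x (Inl j))"
    by (simp only: of_real_eq_iff)
  have z: "sqnorm S (\<lambda>i. x (Inr (L, Inl i))) = 0" using supp[of L] by (simp add: sqnorm_def)
  have "(\<Sum>k<Suc L. sqnorm (S <+> S) (\<lambda>c. half_shift S E b x (Inr (k, c)))) =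
    (\<Sum>k<Suc L. sqnorm S (\<lambda>i. half_shift S E b x (Inr (k, Inl i))))
        + (\<Sum>k<Suc L. sqnorm S (\<lambda>i. x (Inr (k, Inl i))))"
    using fin by (simp only: sqnorm_Plus sum.distrib half_shift_simps)
  also have "\<dots> = sqnorm S (\<lambda>k. \<Sum>j\<in>S. E k j * x (Inl j)) + (\<Sum>k<L. sqnorm S (\<lambda>i. x (Inr (k, Inr i))))
      + (\<Sum>k<L. sqnorm S (\<lambda>i. x (Inr (k, Inl i))))"
    unfolding sum.lessThan_Suc_shift[of "\<lambda>k. sqnorm S (\<lambda>i. half_shift S E b x (Inr (k, Inl i)))"]
        half_shift_simps
    using z by simp
  also have "\<dots> = sqnorm S (\<lambda>k. \<Sum>j\<in>S. E k j * x (Inl j)) + (\<Sum>k<L. sqnorm (S <+> S) (\<lambda>c. x (Inr (k, c))))"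
    using fin by (simp add: sqnorm_Plus sum.distrib)
  finally show "dil_norm S E0 (Suc L) (half_shift S E b x) = dil_norm S E0 L x"
    unfolding dil_norm_def using head by simp
  show "half_shift S E b x (Inr (k, c)) = 0" if "k \<ge> Suc L"
    using that supp by (cases k; cases c) auto
qed

lemma blockwise_isometry:
  assumes "unitary_on (S <+> S) G G'"
  shows "dil_norm S E0 L (blockwise G x) = dil_norm S E0 L x"
    "(\<And>c. x (Inr (k, c)) = 0) \<Longrightarrow> blockwise G x (Inr (k, c)) = 0"
  using unitary_onD[OF assms] complex_linear_zero[of G] by (simp_all add: dil_norm_def)

lemma unitary_on_sym: "unitary_on I G G' \<Longrightarrow> unitary_on I G' G"
  using unitary_onD[of I G G'] unfolding unitary_on_def[of I G' G] by blast

definition dil_isometry where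
  "dil_isometry S E0 W \<longleftrightarrow> complex_linear W \<and> (\<forall>L x. (\<forall>k\<ge>L. \<forall>c. x (Inr (k, c)) = 0) \<longrightarrow>
     (\<forall>k\<ge>Suc L. \<forall>c. W x (Inr (k, c)) = 0) \<and> dil_norm S E0 (Suc L) (W x) = dil_norm S E0 L x)"

text \<open>Ando's construction: the half shifts \<open>V\<^sub>1, V\<^sub>2\<close> dilate \<open>diag b, diag d\<close> but need not commute; \<open>V\<^sub>1 V\<^sub>2\<close>
  and \<open>V\<^sub>2 V\<^sub>1\<close> differ only in block \<open>0\<close>, by a partial isometry, which extends to the unitary \<open>G\<close>.\<close>

lemma ando_dilation:
  fixes b d :: "'f \<Rightarrow> complex"
  assumes fin: "finite S"
    and gram1: "\<And>f g. f \<in> S \<Longrightarrow> g \<in> S \<Longrightarrow>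
      inner_on S (\<lambda>k. E1 k f) (\<lambda>k. E1 k g) = (1 - b f * cnj (b g)) * inner_on S (\<lambda>k. E0 k f) (\<lambda>k. E0 k g)"
    and gram2: "\<And>f g. f \<in> S \<Longrightarrow> g \<in> S \<Longrightarrow>
      inner_on S (\<lambda>k. E2 k f) (\<lambda>k. E2 k g) = (1 - d f * cnj (d g)) * inner_on S (\<lambda>k. E0 k f) (\<lambda>k. E0 k g)"
    and zero: "\<And>k f. k \<notin> S \<Longrightarrow> E1 k f = 0" "\<And>k f. k \<notin> S \<Longrightarrow> E2 k f = 0"
  shows "\<exists>W1 W2. dil_isometry S E0 W1 \<and> dil_isometry S E0 W2 \<and> (\<forall>x. W1 (W2 x) = W2 (W1 x)) \<and>
    (\<forall>x i. W1 x (Inl i) = b i * x (Inl i)) \<and> (\<forall>x i. W2 x (Inl i) = d i * x (Inl i))"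
proof -
  \<comment> \<open>\<open>\<alpha> f\<close> and \<open>\<beta> f\<close> are block 0 of
    \<open>V1 V2\<close> and of \<open>V2 V1\<close> at the unit vector \<open>f\<close> of the
    head, \<open>V1\<close> and \<open>V2\<close> being the two half shifts.\<close>
  define \<alpha> where "\<alpha> = (\<lambda>f c. case c of Inl i \<Rightarrow> d f * E1 i f | Inr i \<Rightarrow> E2 i f)"
  define \<beta> where "\<beta> = (\<lambda>f c. case c of Inl i \<Rightarrow> b f * E2 i f | Inr i \<Rightarrow> E1 i f)"
  have "inner_on (S <+> S) (\<alpha> f) (\<alpha> g) = inner_on (S <+> S) (\<beta> f) (\<beta> g)" if "f \<in> S" "g \<in> S" for f g
    using fin by (simp add: inner_on_Plus \<alpha>_def \<beta>_def inner_on_scale_left inner_on_scale_right gram1[OF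
        that] gram2[OF that] algebra_simps)
  moreover have "\<alpha> f c = 0" "\<beta> f c = 0" if "c \<notin> S <+> S" for f c
    using that zero by (cases c; force simp: \<alpha>_def \<beta>_def)+
  ultimately obtain G G' where G: "unitary_on (S <+> S) G G'" "\<And>f. f \<in> S \<Longrightarrow> G (\<alpha> f) = \<beta> f"
    using unitary_extension[OF fin finite_Plus[OF fin fin], of \<alpha> \<beta>] by metis
  note U = unitary_onD[OF G(1)]
  note iso = blockwise_isometry[OF G(1)] blockwise_isometry[OF unitary_on_sym[OF G(1)]]
  \<comment> \<open>Thus \<open>W1 W2 = G V1 V2 G'\<close>, while in \<open>W2 W1 = V2 V1\<close>
    the inner factors cancel. Block 0 of \<open>V1 V2\<close> depends on the head alone and is
    corrected by \<open>G\<close>; in later blocks \<open>G\<close> undoes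
    \<open>G'\<close>.\<close>
  define W1 where "W1 = (\<lambda>x. blockwise G (half_shift S E1 b x))"
  define W2 where "W2 = (\<lambda>x. half_shift S E2 d (blockwise G' x))"
  have "dil_isometry S E0 W1" unfolding dil_isometry_def
  proof (intro conjI allI impI)
    show "complex_linear W1" unfolding W1_def by (rule complex_linear_comp[OF
        complex_linear_blockwise[OF U(1)] complex_linear_half_shift])
    fix L :: nat and x :: "'f + nat \<times> ('f + 'f) \<Rightarrow> complex" assume x: "\<forall>k\<ge>L. \<forall>c. x (Inr (k, c)) = 0"
    note h = half_shift_isometry[where E = E1 and b = b and ?E0.0 = E0, OF fin gram1, where L = L and x = x]
    show "dil_norm S E0 (Suc L) (W1 x) = dil_norm S E0 L x"
      unfolding W1_def iso using x by (intro h) auto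
    show "W1 x (Inr (k, c)) = 0" if "k \<ge> Suc L" for k c
      unfolding W1_def using x that by (intro iso h(2)) auto
  qed
  moreover have "dil_isometry S E0 W2" unfolding dil_isometry_def
  proof (intro conjI allI impI)
    show "complex_linear W2" unfolding W2_def by (rule complex_linear_comp[OF complex_linear_half_shift
        complex_linear_blockwise[OF U(2)]])
    fix L :: nat and x :: "'f + nat \<times> ('f + 'f) \<Rightarrow> complex" assume x: "\<forall>k\<ge>L. \<forall>c. x (Inr (k, c)) = 0"
    have x': "blockwise G' x (Inr (k, c)) = 0" if "k \<ge> L" for k c
      using x that by (intro iso) auto
    note h = half_shift_isometry[where E = E2 and b = d and ?E0.0 = E0, OF fin gram2, where L = L and x
        = "blockwise G' x"]
    show "dil_norm S E0 (Suc L) (W2 x) = dil_norm S E0 L x"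
      unfolding W2_def iso(3)[of E0 L x, symmetric] using x' by (intro h) auto
    show "W2 x (Inr (k, c)) = 0" if "k \<ge> Suc L" for k c
      unfolding W2_def using x' that by (intro h(2)) auto
  qed
  moreover have "W1 (W2 x) = W2 (W1 x)" for x
  proof
    fix c :: "'f + nat \<times> ('f + 'f)"
    consider i where "c = Inl i" | i where "c = Inr (0, i)" | k i where "c = Inr (Suc k, i)"
      by (metis sum.exhaust prod.exhaust nat.exhaust)
    then show "W1 (W2 x) c = W2 (W1 x) c"
    proof cases
      case 1 then show ?thesis by (simp add: W1_def W2_def)
    next
      case 2
      have "(\<lambda>i. half_shift S E1 b (W2 x) (Inr (0, i))) = (\<lambda>i. \<Sum>f\<in>S. x (Inl f) * \<alpha> f i)"
      proof
        fix i show "half_shift S E1 b (W2 x) (Inr (0, i)) = (\<Sum>f\<in>S. x (Inl f) * \<alpha> f i)"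
          by (cases i) (auto simp: W2_def \<alpha>_def mult_ac)
      qed
      then have "W1 (W2 x) c = (\<Sum>f\<in>S. x (Inl f) * \<beta> f i)"
        using 2 by (simp add: W1_def complex_linear_sum[OF U(1)] G(2))
      also have "\<dots> = W2 (W1 x) c"
        using 2 by (cases i) (auto simp: W1_def W2_def \<beta>_def mult_ac U)
      finally show ?thesis .
    next
      case 3
      have "(\<lambda>i. half_shift S E1 b (W2 x) (Inr (Suc k, i))) = G' (\<lambda>i. x (Inr (k, i)))"
      proof
        fix i show "half_shift S E1 b (W2 x) (Inr (Suc k, i)) = G' (\<lambda>i. x (Inr (k, i))) i"
          by (cases i) (auto simp: W2_def)
      qed
      then have "W1 (W2 x) c = x (Inr (k, i))"
        using 3 by (simp add: W1_def U)
      also have "\<dots> = W2 (W1 x) c"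
        using 3 by (cases i) (auto simp: W1_def W2_def U)
      finally show ?thesis .
    qed
  qed
  ultimately show ?thesis
    by (intro exI[of _ W1] exI[of _ W2]) (auto simp: W1_def W2_def)
qed

section \<open>Discrete Fourier transform and the Toeplitz estimate\<close>

lemma roots_of_unity_orthogonal:
  assumes "p < R" "q < R"
  defines "\<omega> \<equiv> cis (2 * pi / real R)"
  shows "(\<Sum>a<R. \<omega> ^ (a * p) * cnj (\<omega> ^ (a * q))) = (if p = q then of_nat R else 0)"
proof -
  have R: "R > 0" using assms by simp
  define \<rho> where "\<rho> = \<omega> ^ p * cnj (\<omega> ^ q)"
  have unit: "\<omega> ^ k * cnj (\<omega> ^ k) = 1" for k
    unfolding complex_norm_square[symmetric] by (simp add: \<omega>_def norm_power)
  have wR: "\<omega> ^ R = 1" unfolding \<omega>_def Complex.DeMoivre using R by simp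
  have eq: "(\<Sum>a<R. \<omega> ^ (a * p) * cnj (\<omega> ^ (a * q))) = (\<Sum>a<R. \<rho> ^ a)"
    by (intro sum.cong refl) (simp add: \<rho>_def power_mult_distrib mult.commute flip: power_mult)
  show ?thesis
  proof (cases "p = q")
    case True
    then show ?thesis unfolding eq using unit[of p] by (simp add: \<rho>_def)
  next
    case False
    have "\<rho> \<noteq> 1"
    proof
      assume "\<rho> = 1"
      then have "\<rho> * \<omega> ^ q = \<omega> ^ q" by simp
      moreover have "\<rho> * \<omega> ^ q = \<omega> ^ p" unfolding \<rho>_def using unit[of q] by (simp add: mult_ac)
      ultimately have "cis (2 * pi * real p / real R) = cis (2 * pi * real q / real R)"
        by (simp add: \<omega>_def Complex.DeMoivre mult_ac)
      then show False
        using Complex.bij_betw_roots_unity[OF R] assms False unfolding bij_betw_def inj_on_def by auto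
    qed
    moreover have "\<rho> ^ R = 1"
      using wR by (simp add: \<rho>_def power_mult_distrib flip: power_mult) 
         (metis mult.commute power_mult power_one complex_cnj_power complex_cnj_one mult_1)
    ultimately show ?thesis unfolding eq using False by (simp add: geometric_sum)
  qed
qed

lemma parseval:
  fixes f :: "nat \<Rightarrow> complex" and R :: nat
  defines "\<omega> \<equiv> cis (2 * pi / real R)"
  shows "(\<Sum>a<R. (cmod (\<Sum>p<R. f p * cnj (\<omega> ^ (a * p))))\<^sup>2) = R * (\<Sum>p<R. (cmod (f p))\<^sup>2)"
proof -
  have "complex_of_real (\<Sum>a<R. (cmod (\<Sum>p<R. f p * cnj (\<omega> ^ (a * p))))\<^sup>2) =
     (\<Sum>a<R. (\<Sum>p<R. f p * cnj (\<omega> ^ (a * p))) * cnj (\<Sum>p<R. f p * cnj (\<omega> ^ (a * p))))"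
    unfolding complex_norm_square[symmetric] by simp
  also have "\<dots> = (\<Sum>a<R. \<Sum>p<R. \<Sum>q<R. f p * cnj (f q) * (\<omega> ^ (a * q) * cnj (\<omega> ^ (a * p))))"
    unfolding cnj_sum sum_product by (intro sum.cong refl) simp
  also have "\<dots> = (\<Sum>p<R. \<Sum>a<R. \<Sum>q<R. f p * cnj (f q) * (\<omega> ^ (a * q) * cnj (\<omega> ^ (a * p))))"
    by (rule sum.swap)
  also have "\<dots> = (\<Sum>p<R. \<Sum>q<R. f p * cnj (f q) * (\<Sum>a<R. \<omega> ^ (a * q) * cnj (\<omega> ^ (a * p))))"
    unfolding sum_distrib_left by (rule sum.cong[OF refl], rule sum.swap)
  also have "\<dots> = (\<Sum>p<R. \<Sum>q<R. if q = p then f p * cnj (f p) * of_nat R else 0)"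
    unfolding \<omega>_def by (intro sum.cong refl, subst roots_of_unity_orthogonal) auto
  also have "\<dots> = complex_of_real (R * (\<Sum>p<R. (cmod (f p))\<^sup>2))"
    by (simp add: complex_norm_square[symmetric] sum_distrib_left mult.commute)
  finally show ?thesis by (simp only: of_real_eq_iff)
qed

lemma parseval2:
  fixes F :: "nat \<Rightarrow> nat \<Rightarrow> complex" and R :: nat
  defines "\<omega> \<equiv> cis (2 * pi / real R)"
  shows "(\<Sum>a<R. \<Sum>b<R. (cmod (\<Sum>p<R. \<Sum>q<R. F p q * cnj (\<omega> ^ (a * p)) * cnj (\<omega> ^ (b * q))))\<^sup>2) =
    (real R)\<^sup>2 * (\<Sum>p<R. \<Sum>q<R. (cmod (F p q))\<^sup>2)"
proof -
  have "(\<Sum>b<R. (cmod (\<Sum>p<R. \<Sum>q<R. F p q * cnj (\<omega> ^ (a * p)) * cnj (\<omega> ^ (b * q))))\<^sup>2) =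
      R * (\<Sum>q<R. (cmod (\<Sum>p<R. F p q * cnj (\<omega> ^ (a * p))))\<^sup>2)" for a
    unfolding sum.swap[of _ "{..<R}" "{..<R}"] sum_distrib_right[symmetric] unfolding \<omega>_def
        by (rule parseval)
  then have "(\<Sum>a<R. \<Sum>b<R. (cmod (\<Sum>p<R. \<Sum>q<R. F p q * cnj (\<omega> ^ (a * p)) * cnj (\<omega> ^ (b * q))))\<^sup>2) =
      R * (\<Sum>a<R. \<Sum>q<R. (cmod (\<Sum>p<R. F p q * cnj (\<omega> ^ (a * p))))\<^sup>2)"
    by (simp add: sum_distrib_left)
  also have "(\<Sum>a<R. \<Sum>q<R. (cmod (\<Sum>p<R. F p q * cnj (\<omega> ^ (a * p))))\<^sup>2) = (\<Sum>q<R. R * (\<Sum>p<R. (cmod (F p q))\<^sup>2))"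
    unfolding \<omega>_def by (subst sum.swap) (intro sum.cong refl parseval)
  also have "\<dots> = R * (\<Sum>p<R. \<Sum>q<R. (cmod (F p q))\<^sup>2)"
    unfolding sum_distrib_left by (rule sum.swap)
  finally show ?thesis by (simp add: power2_eq_square)
qed

lemma cyclic_shift_transform:
  fixes f :: "nat \<Rightarrow> complex" and R :: nat
  assumes "R > 0"
  defines "\<omega> \<equiv> cis (2 * pi / real R)"
  shows "(\<Sum>s<R. f ((s + m) mod R) * cnj (\<omega> ^ (a * s))) = \<omega> ^ (a * m) * (\<Sum>p<R. f p * cnj (\<omega> ^ (a * p)))"
proof -
  have wR: "\<omega> ^ R = 1" unfolding \<omega>_def Complex.DeMoivre using assms(1) by simp
  have per: "\<omega> ^ (a * (k mod R)) = \<omega> ^ (a * k)" for k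
  proof -
    have "\<omega> ^ (a * k) = \<omega> ^ (a * (R * (k div R) + k mod R))" by simp
    also have "\<dots> = (\<omega> ^ R) ^ (a * (k div R)) * \<omega> ^ (a * (k mod R))"
      unfolding distrib_left power_add by (simp add: mult_ac flip: power_mult)
    finally show ?thesis by (simp add: wR)
  qed
  have unit: "\<omega> ^ k * cnj (\<omega> ^ k) = 1" for k
    unfolding complex_norm_square[symmetric] by (simp add: \<omega>_def norm_power)
  have bij: "bij_betw (\<lambda>s. (s + m) mod R) {..<R} {..<R}"
  proof (rule bij_betw_imageI)
    show inj: "inj_on (\<lambda>s. (s + m) mod R) {..<R}"
    proof (rule inj_onI)
      fix x y assume "x \<in> {..<R}" "y \<in> {..<R}" "(x + m) mod R = (y + m) mod R"
      then show "x = y"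
      proof (induction x y rule: linorder_wlog)
        case (le x y)
        then have "R dvd y - x" using mod_eq_dvd_iff_nat[of "x + m" "y + m" R] by simp
        then show ?case using le by (metis diff_is_0_eq dvd_imp_le lessThan_iff less_imp_diff_less
            linorder_not_less not_gr_zero order_antisym)
      qed simp
    qed
    show "(\<lambda>s. (s + m) mod R) ` {..<R} = {..<R}"
      using assms by (intro endo_inj_surj inj) auto
  qed
  have "\<omega> ^ (a * m) * (\<Sum>p<R. f p * cnj (\<omega> ^ (a * p))) =
     (\<Sum>s<R. \<omega> ^ (a * m) * (f ((s + m) mod R) * cnj (\<omega> ^ (a * ((s + m) mod R)))))"
    unfolding sum.reindex_bij_betw[OF bij, of "\<lambda>p. f p * cnj (\<omega> ^ (a * p))", symmetric] sum_distrib_left ..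
  also have "\<dots> = (\<Sum>s<R. f ((s + m) mod R) * cnj (\<omega> ^ (a * s)))"
  proof (intro sum.cong refl)
    fix s
    have "\<omega> ^ (a * m) * cnj (\<omega> ^ (a * (s + m))) = (\<omega> ^ (a * m) * cnj (\<omega> ^ (a * m))) * cnj (\<omega> ^ (a * s))"
      by (simp add: distrib_left power_add)
    also have "\<dots> = cnj (\<omega> ^ (a * s))" unfolding unit by simp
    finally show "\<omega> ^ (a * m) * (f ((s + m) mod R) * cnj (\<omega> ^ (a * ((s + m) mod R))))
        = f ((s + m) mod R) * cnj (\<omega> ^ (a * s))"
      unfolding per by (simp add: mult_ac)
  qed
  finally show ?thesis ..
qed

text \<open>On \<open>(\<int>/R)\<^sup>2\<close> the discrete Fourier transform turns the cyclic correlation of \<open>u\<close> with \<open>X\<close> into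
  multiplication by the polynomial. Correlations that do not wrap around are shifts of a single
  vector; they are all but \<open>O(dR)\<close> of the \<open>R\<^sup>2\<close> many.\<close>

lemma toeplitz_bound:
  fixes X :: "nat \<Rightarrow> nat \<Rightarrow> 'l \<Rightarrow> 'c \<Rightarrow> complex" and u :: "'l \<Rightarrow> nat \<Rightarrow> nat \<Rightarrow> complex"
  assumes fin: "finite C" and dR: "d \<le> R" "R > 0"
    and Y: "\<And>s t. s < R - d \<Longrightarrow> t < R - d \<Longrightarrow>
       sqnorm C (\<lambda>c. \<Sum>l\<in>\<Lambda>. \<Sum>m<d. \<Sum>n<d. u l m n * X (s + m) (t + n) l c) = Y"
    and Q: "\<And>s t l. s < R \<Longrightarrow> t < R \<Longrightarrow> l \<in> \<Lambda> \<Longrightarrow> sqnorm C (X s t l) = Q l"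
    and B: "\<And>x y. cmod x = 1 \<Longrightarrow> cmod y = 1 \<Longrightarrow> sqnorm \<Lambda> (\<lambda>l. \<Sum>m<d. \<Sum>n<d. u l m n * x ^ m * y ^ n) \<le> B"
  shows "(real (R - d))\<^sup>2 * Y \<le> (real R)\<^sup>2 * B * (\<Sum>l\<in>\<Lambda>. Q l)"
proof -
  define \<omega> where "\<omega> = cis (2 * pi / real R)"
  define P where "P = (\<lambda>a b l. \<Sum>m<d. \<Sum>n<d. u l m n * (\<omega> ^ a) ^ m * (\<omega> ^ b) ^ n)"
  define G where "G = (\<lambda>a b c l. \<Sum>p<R. \<Sum>q<R. X p q l c * cnj (\<omega> ^ (a * p)) * cnj (\<omega> ^ (b * q)))"
  \<comment> \<open>For \<open>s, t < R - d\<close> the indices do not wrap around, and this is the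
    combination whose norm is \<open>Y\<close>.\<close>
  define z where "z = (\<lambda>c s t. \<Sum>l\<in>\<Lambda>. \<Sum>m<d. \<Sum>n<d. u l m n * X ((s + m) mod R) ((t + n) mod R) l c)"
  define Z where "Z = (\<lambda>a b c. \<Sum>s<R. \<Sum>t<R. z c s t * cnj (\<omega> ^ (a * s)) * cnj (\<omega> ^ (b * t)))"
  have shift2: "(\<Sum>s<R. \<Sum>t<R. X ((s + m) mod R) ((t + n) mod R) l c * cnj (\<omega> ^ (a * s)) * cnj (\<omega> ^ (b * t)))
     = (\<omega> ^ a) ^ m * (\<omega> ^ b) ^ n * G a b c l" for m n l c a b
  proof -
    define S where "S = (\<lambda>p. \<Sum>q<R. X p q l c * cnj (\<omega> ^ (b * q)))"
    have inner: "(\<Sum>t<R. X p ((t + n) mod R) l c * cnj (\<omega> ^ (b * t))) =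
      \<omega> ^ (b * n) * S p" for p
      unfolding \<omega>_def S_def by (rule cyclic_shift_transform[OF dR(2), of "\<lambda>q. X p q l c"])
    have "(\<Sum>s<R. \<Sum>t<R. X ((s + m) mod R) ((t + n) mod R) l c * cnj (\<omega> ^ (a * s)) * cnj (\<omega> ^ (b * t)))
      = (\<Sum>s<R. (\<Sum>t<R. X ((s + m) mod R) ((t + n) mod R) l c * cnj (\<omega> ^ (b * t))) * cnj (\<omega> ^ (a * s)))"
      unfolding sum_distrib_right by (intro sum.cong refl) (simp add: mult_ac)
    also have "\<dots> = \<omega> ^ (b * n) * (\<Sum>s<R. S ((s + m) mod R) * cnj (\<omega> ^ (a * s)))"
      unfolding inner sum_distrib_left by (simp only: mult.assoc)
    also have "\<dots> = \<omega> ^ (b * n) * (\<omega> ^ (a * m) * (\<Sum>p<R. S p * cnj (\<omega> ^ (a * p))))"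
      unfolding \<omega>_def cyclic_shift_transform[OF dR(2), of S] ..
    also have "\<dots> = (\<omega> ^ a) ^ m * (\<omega> ^ b) ^ n * G a b c l"
      unfolding G_def S_def sum_distrib_right sum_distrib_left
          by (intro sum.cong refl) (simp add: mult_ac power_mult)
    finally show ?thesis .
  qed
  have ZP: "Z a b c = (\<Sum>l\<in>\<Lambda>. P a b l * G a b c l)" for a b c
  proof -
    have "Z a b c = (\<Sum>s<R. \<Sum>t<R. \<Sum>l\<in>\<Lambda>. \<Sum>m<d. \<Sum>n<d. u l m n * (X ((s + m) mod R) ((t
        + n) mod R) l c * cnj (\<omega> ^ (a * s)) * cnj (\<omega> ^ (b * t))))"
      unfolding Z_def z_def sum_distrib_right by (intro sum.cong refl) (simp add: mult_ac)
    also have "\<dots> = (\<Sum>l\<in>\<Lambda>. \<Sum>m<d. \<Sum>n<d. u l m n * (\<Sum>s<R. \<Sum>t<R. X ((s + m) mod R) ((t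
        + n) mod R) l c * cnj (\<omega> ^ (a * s)) * cnj (\<omega> ^ (b * t))))"
      unfolding sum_distrib_left sum.swap[of _ \<Lambda> "{..<R}"] sum.swap[of _ "{..<d}" "{..<R}"] ..
    also have "\<dots> = (\<Sum>l\<in>\<Lambda>. P a b l * G a b c l)"
      unfolding shift2 P_def sum_distrib_right by (intro sum.cong refl) (simp add: mult_ac)
    finally show ?thesis .
  qed
  \<comment> \<open>Cauchy-Schwarz over \<open>l\<close> at a single frequency: \<open>P a b\<close>
    is the polynomial row at the point \<open>(\<omega> ^ a, \<omega> ^ b)\<close> of the
    torus.\<close>
  have bd: "(cmod (Z a b c))\<^sup>2 \<le> B * (\<Sum>l\<in>\<Lambda>. (cmod (G a b c l))\<^sup>2)" for a b c
  proof -
    have "(cmod (Z a b c))\<^sup>2 = (cmod (inner_on \<Lambda> (P a b) (\<lambda>l. cnj (G a b c l))))\<^sup>2"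
        by (simp add: ZP inner_on_def)
    also have "\<dots> \<le> sqnorm \<Lambda> (P a b) * sqnorm \<Lambda> (\<lambda>l. cnj (G a b c l))" by (rule norm_inner_on_le)
    also have "\<dots> \<le> B * sqnorm \<Lambda> (\<lambda>l. cnj (G a b c l))"
      unfolding P_def by (intro mult_right_mono B sqnorm_nonneg) (simp_all add: \<omega>_def norm_power)
    finally show ?thesis by (simp add: sqnorm_def)
  qed
  \<comment> \<open>The extra factor is the constant of Parseval's identity on the grid; it cancels
    at the end.\<close>
  have "(real R)\<^sup>2 * ((real (R - d))\<^sup>2 * Y) = (real R)\<^sup>2 * (\<Sum>s<R-d. \<Sum>t<R-d. \<Sum>c\<in>C. (cmod (z c s t))\<^sup>2)"
    using Y dR unfolding z_def sqnorm_def by (simp add: power2_eq_square of_nat_diff)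
  also have "\<dots> \<le> (real R)\<^sup>2 * (\<Sum>s<R. \<Sum>t<R. \<Sum>c\<in>C. (cmod (z c s t))\<^sup>2)"
  proof (intro mult_left_mono)
    have "(\<Sum>s<R-d. \<Sum>t<R-d. \<Sum>c\<in>C. (cmod (z c s t))\<^sup>2) \<le> (\<Sum>s<R-d. \<Sum>t<R. \<Sum>c\<in>C. (cmod (z c s t))\<^sup>2)"
      by (intro sum_mono sum_mono2) (auto intro!: sum_nonneg)
    also have "\<dots> \<le> (\<Sum>s<R. \<Sum>t<R. \<Sum>c\<in>C. (cmod (z c s t))\<^sup>2)"
      by (intro sum_mono2) (auto intro!: sum_nonneg)
    finally show "(\<Sum>s<R-d. \<Sum>t<R-d. \<Sum>c\<in>C. (cmod (z c s t))\<^sup>2) \<le> \<dots>" .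
  qed auto
  also have "\<dots> = (\<Sum>c\<in>C. (real R)\<^sup>2 * (\<Sum>s<R. \<Sum>t<R. (cmod (z c s t))\<^sup>2))"
    unfolding sum_distrib_left[symmetric] sum.swap[of _ C "{..<R}"] ..
  also have "\<dots> = (\<Sum>c\<in>C. \<Sum>a<R. \<Sum>b<R. (cmod (Z a b c))\<^sup>2)"
    unfolding Z_def \<omega>_def parseval2 ..
  also have "\<dots> \<le> (\<Sum>c\<in>C. \<Sum>a<R. \<Sum>b<R. B * (\<Sum>l\<in>\<Lambda>. (cmod (G a b c l))\<^sup>2))"
    by (intro sum_mono bd)
  also have "\<dots> = B * (\<Sum>l\<in>\<Lambda>. \<Sum>c\<in>C. \<Sum>a<R. \<Sum>b<R. (cmod (G a b c l))\<^sup>2)"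
    unfolding sum_distrib_left sum.swap[of _ \<Lambda> C] sum.swap[of _ \<Lambda> "{..<R}"] ..
  also have "\<dots> = B * (\<Sum>l\<in>\<Lambda>. \<Sum>c\<in>C. (real R)\<^sup>2 * (\<Sum>p<R. \<Sum>q<R. (cmod (X p q l c))\<^sup>2))"
    unfolding G_def \<omega>_def parseval2 ..
  also have "\<dots> = B * (\<Sum>l\<in>\<Lambda>. (real R)\<^sup>2 * (\<Sum>p<R. \<Sum>q<R. sqnorm C (X p q l)))"
    unfolding sqnorm_def sum_distrib_left sum.swap[of _ C "{..<R}"] ..
  also have "\<dots> = (real R)\<^sup>2 * ((real R)\<^sup>2 * B * (\<Sum>l\<in>\<Lambda>. Q l))"
    using Q by (simp add: power2_eq_square sum_distrib_left mult_ac)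
  finally show ?thesis using dR by simp
qed

text \<open>The isometries of the dilation act as shifts on the vectors \<open>W\<^sub>1\<^sup>m W\<^sub>2\<^sup>n h\<^sub>l\<close>, which therefore
  form a Toeplitz array.\<close>

lemma ando_polynomial_bound:
  fixes K :: "'f \<Rightarrow> 'f \<Rightarrow> complex" and u :: "'l \<Rightarrow> nat \<Rightarrow> nat \<Rightarrow> complex" and h :: "'l \<Rightarrow> 'f \<Rightarrow> complex"
  assumes fin: "finite S" "finite \<Lambda>"
    and psd: "psd_on S K"
    and psd1: "psd_on S (\<lambda>f g. (1 - b f * cnj (b g)) * K f g)"
    and psd2: "psd_on S (\<lambda>f g. (1 - d f * cnj (d g)) * K f g)"
    and B: "\<And>x y. cmod x = 1 \<Longrightarrow> cmod y = 1 \<Longrightarrow> sqnorm \<Lambda> (\<lambda>l. \<Sum>m<D. \<Sum>n<D. u l m n * x ^ m * y ^ n) \<le> B"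
  defines "q \<equiv> \<lambda>x. (\<Sum>f\<in>S. \<Sum>g\<in>S. K f g * x f * cnj (x g))"
  defines "y \<equiv> \<lambda>f. \<Sum>l\<in>\<Lambda>. \<Sum>m<D. \<Sum>n<D. u l m n * (b f ^ m * d f ^ n * h l f)"
  shows "Re (q y) \<le> B * (\<Sum>l\<in>\<Lambda>. Re (q (h l)))"
proof -
  obtain e0 where e0: "\<And>z w. z \<in> S \<Longrightarrow> w \<in> S \<Longrightarrow> K z w = (\<Sum>m\<in>S. e0 m z * cnj (e0 m w))"
    using psd_on_imp_gram[OF fin(1) psd] by metis
  obtain e1 where e1: "\<And>z w. z \<in> S \<Longrightarrow> w \<in> S \<Longrightarrow> (1 - b z * cnj (b w)) * K z w = (\<Sum>m\<in>S. e1 m z * cnj (e1 m w))"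
    "\<And>m z. m \<notin> S \<Longrightarrow> e1 m z = 0"
    using psd_on_imp_gram[OF fin(1) psd1] by metis
  obtain e2 where e2: "\<And>z w. z \<in> S \<Longrightarrow> w \<in> S \<Longrightarrow> (1 - d z * cnj (d w)) * K z w = (\<Sum>m\<in>S. e2 m z * cnj (e2 m w))"
    "\<And>m z. m \<notin> S \<Longrightarrow> e2 m z = 0"
    using psd_on_imp_gram[OF fin(1) psd2] by metis
  have K: "K f g = inner_on S (\<lambda>k. e0 k f) (\<lambda>k. e0 k g)" if "f \<in> S" "g \<in> S" for f g
    using e0[OF that] by (simp add: inner_on_def)
  have "\<exists>W1 W2. dil_isometry S e0 W1 \<and> dil_isometry S e0 W2 \<and> (\<forall>x. W1 (W2 x) = W2 (W1 x)) \<and>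
    (\<forall>x i. W1 x (Inl i) = b i * x (Inl i)) \<and> (\<forall>x i. W2 x (Inl i) = d i * x (Inl i))"
  proof (rule ando_dilation[OF fin(1), of e1 b e0 e2 d])
    fix f g assume fg: "f \<in> S" "g \<in> S"
    show "inner_on S (\<lambda>k. e1 k f) (\<lambda>k. e1 k g) = (1 - b f * cnj (b g))
        * inner_on S (\<lambda>k. e0 k f) (\<lambda>k. e0 k g)"
      using e1(1)[OF fg] K[OF fg] by (simp add: inner_on_def)
    show "inner_on S (\<lambda>k. e2 k f) (\<lambda>k. e2 k g) = (1 - d f * cnj (d g))
        * inner_on S (\<lambda>k. e0 k f) (\<lambda>k. e0 k g)"
      using e2(1)[OF fg] K[OF fg] by (simp add: inner_on_def)
  qed (use e1 e2 in auto)
  then obtain W1 W2 where W: "dil_isometry S e0 W1" "dil_isometry S e0 W2" "\<And>x. W1 (W2 x) = W2 (W1 x)"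
    and W_head: "\<And>x i. W1 x (Inl i) = b i * x (Inl i)" "\<And>x i. W2 x (Inl i) = d i * x (Inl i)"
    by blast
  have lin: "complex_linear W1" "complex_linear W2" using W unfolding dil_isometry_def by auto
  define supp where "supp = (\<lambda>L (x :: 'f + nat \<times> ('f + 'f) \<Rightarrow> complex). \<forall>k\<ge>(L::nat). \<forall>c. x (Inr (k, c)) = 0)"
  have W1': "supp (Suc L) (W1 x)" "dil_norm S e0 (Suc L) (W1 x) = dil_norm S e0 L x" if "supp L x" for L x
    using W(1) that unfolding dil_isometry_def supp_def by auto
  have W2': "supp (Suc L) (W2 x)" "dil_norm S e0 (Suc L) (W2 x) = dil_norm S e0 L x" if "supp L x" for L x
    using W(2) that unfolding dil_isometry_def supp_def by auto
  define A where "A = (\<lambda>s t x. (W1 ^^ s) ((W2 ^^ t) x))"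
  have A1: "supp (L + t) ((W2 ^^ t) x) \<and> dil_norm S e0 (L + t) ((W2 ^^ t) x) = dil_norm S e0 L x"
      if "supp L x" for L t x
    using that by (induction t) (auto simp: W2')
  have A2: "supp (L + s) ((W1 ^^ s) x) \<and> dil_norm S e0 (L + s) ((W1 ^^ s) x) = dil_norm S e0 L x"
      if "supp L x" for L s x
    using that by (induction s) (auto simp: W1')
  have A: "supp (L + t + s) (A s t x)" "dil_norm S e0 (L + t + s) (A s t x) = dil_norm S e0 L x"
      if "supp L x" for L s t x
    using A1[OF that, of t] A2[of "L + t" "(W2 ^^ t) x" s] by (auto simp: A_def)
  have comm1: "(W1 ^^ s) (W2 x) = W2 ((W1 ^^ s) x)" for s x
    by (induction s) (auto simp: W(3))
  have comm: "(W1 ^^ s) ((W2 ^^ t) x) = (W2 ^^ t) ((W1 ^^ s) x)" for s t x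
    by (induction t) (auto simp: comm1)
  have AA: "A s t (A m n x) = A (s + m) (t + n) x" for s t m n x
    unfolding A_def comm[of m "t" "(W2 ^^ n) x", symmetric] funpow_add o_apply ..
  have linW1: "complex_linear (W1 ^^ s)" for s
    by (induction s) (use lin(1) in \<open>auto simp: complex_linear_def\<close>)
  have linW2: "complex_linear (W2 ^^ s)" for s
    by (induction s) (use lin(2) in \<open>auto simp: complex_linear_def\<close>)
  have linA: "complex_linear (A s t)" for s t unfolding A_def by (rule complex_linear_comp[OF linW1 linW2])
  have headW2: "(W2 ^^ t) x (Inl i) = d i ^ t * x (Inl i)" for t x i
    by (induction t) (auto simp: W_head)
  have headW1: "(W1 ^^ s) x (Inl i) = b i ^ s * x (Inl i)" for s x i
    by (induction s) (auto simp: W_head)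
  have headA: "A s t x (Inl i) = b i ^ s * (d i ^ t * x (Inl i))" for s t x i
    unfolding A_def headW1 headW2 ..
  have norm_mono: "dil_norm S e0 L' x = dil_norm S e0 L x" if "supp L x" "L \<le> L'" for L L' x
  proof -
    have "(\<Sum>k<L'. sqnorm (S <+> S) (\<lambda>c. x (Inr (k, c)))) = (\<Sum>k<L. sqnorm (S <+> S) (\<lambda>c. x (Inr (k, c))))"
      using that by (intro sum.mono_neutral_right) (auto simp: supp_def sqnorm_def)
    then show ?thesis by (simp add: dil_norm_def)
  qed
  define \<iota> where "\<iota> = (\<lambda>(x :: 'f \<Rightarrow> complex) (c :: 'f + nat \<times> ('f + 'f)). case c of Inl i \<Rightarrow> x i | Inr _ \<Rightarrow> 0)"
  have supp0: "supp 0 (\<iota> x)" for x by (simp add: supp_def \<iota>_def)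
  define N0 where "N0 = (\<lambda>x. sqnorm S (\<lambda>k. \<Sum>j\<in>S. e0 k j * x j))"
  have qN: "Re (q x) = N0 x" for x
  proof -
    have "q x = complex_of_real (N0 x)"
      unfolding q_def N0_def sqnorm_gram by (intro sum.cong refl) (simp add: K)
    then show ?thesis by simp
  qed
  have N0_le: "N0 (\<lambda>i. x (Inl i)) \<le> dil_norm S e0 L x" for x L
    unfolding N0_def dil_norm_def by (simp add: sum_nonneg sqnorm_nonneg)
  have norm0: "dil_norm S e0 0 (\<iota> x) = N0 x" for x by (simp add: dil_norm_def N0_def \<iota>_def)
  \<comment> \<open>Powers below \<open>D\<close> of both isometries fill only blocks below
    \<open>2 * D\<close>. The head of \<open>Yv\<close> is \<open>y\<close>, so passing back to
    \<open>y\<close> only drops nonnegative terms of the norm.\<close>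
  define Yv where "Yv = (\<lambda>c. \<Sum>l\<in>\<Lambda>. \<Sum>m<D. \<Sum>n<D. u l m n * A m n (\<iota> (h l)) c)"
  have suppYv: "supp (2 * D) Yv"
  proof -
    have "A m n (\<iota> (h l)) (Inr (k, c)) = 0" if "m < D" "n < D" "k \<ge> 2 * D" for m n l k c
      using A(1)[OF supp0, of n m "h l"] that by (auto simp: supp_def)
    then show ?thesis by (auto simp: supp_def Yv_def intro!: sum.neutral)
  qed
  have headYv: "(\<lambda>i. Yv (Inl i)) = y"
    by (auto simp: Yv_def y_def headA \<iota>_def mult.assoc)
  have A_Yv: "A s t Yv = (\<lambda>c. \<Sum>l\<in>\<Lambda>. \<Sum>m<D. \<Sum>n<D. u l m n * A (s + m) (t + n) (\<iota> (h l)) c)" for s t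
  proof -
    define T where "T = \<Lambda> \<times> {..<D} \<times> {..<D}"
    have Yv: "Yv = (\<lambda>c. \<Sum>p\<in>T. u (fst p) (fst (snd p)) (snd (snd p))
        * A (fst (snd p)) (snd (snd p)) (\<iota> (h (fst p))) c)"
      unfolding Yv_def T_def by (simp add: sum.cartesian_product case_prod_unfold)
    show ?thesis unfolding Yv complex_linear_sum[OF linA] AA unfolding T_def
        by (simp add: sum.cartesian_product case_prod_unfold)
  qed
  \<comment> \<open>With the finite index set \<open>cc L\<close> and the coordinates
    \<open>co\<close>, the head being read through its Gram factor, \<open>dil_norm\<close> becomes
    an ordinary \<open>sqnorm\<close>.\<close>
  define cc where "cc = (\<lambda>L. S <+> ({..<L::nat} \<times> (S <+> S)))"
  define co where "co = (\<lambda>(x :: 'f + nat \<times> ('f + 'f) \<Rightarrow> complex) c. case c of Inl k \<Rightarrow> \<Sum>j\<in>S. e0 k j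
      * x (Inl j) | Inr p \<Rightarrow> x (Inr p))"
  have fincc: "finite (cc L)" for L unfolding cc_def using fin by auto
  have sqnorm_co: "sqnorm (cc L) (co x) = dil_norm S e0 L x" for L x
  proof -
    have "finite ({..<L} \<times> (S <+> S))" using fin by simp
    moreover have "sqnorm ({..<L} \<times> (S <+> S)) (\<lambda>p. x (Inr p))
        = (\<Sum>k<L. sqnorm (S <+> S) (\<lambda>c. x (Inr (k, c))))"
      unfolding sqnorm_def sum.cartesian_product case_prod_unfold by simp
    ultimately show ?thesis
      unfolding cc_def dil_norm_def by (subst sqnorm_Plus) (use fin in \<open>auto simp: co_def\<close>)
  qed
  have lin_co: "co (\<lambda>c. \<Sum>l\<in>\<Lambda>. \<Sum>m<D. \<Sum>n<D. u l m n * F l m n c)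
      = (\<lambda>c. \<Sum>l\<in>\<Lambda>. \<Sum>m<D. \<Sum>n<D. u l m n * co (F l m n) c)" for F
  proof
    have "complex_linear co" by (auto simp: complex_linear_def co_def fun_eq_iff algebra_simps
        sum.distrib sum_distrib_left split: sum.splits)
    fix c show "co (\<lambda>c. \<Sum>l\<in>\<Lambda>. \<Sum>m<D. \<Sum>n<D. u l m n * F l m n c) c
        = (\<Sum>l\<in>\<Lambda>. \<Sum>m<D. \<Sum>n<D. u l m n * co (F l m n) c)"
      using complex_linear_sum[OF \<open>complex_linear co\<close>, of "\<lambda>p. u (fst p) (fst (snd p)) (snd (snd p))"
          "\<lambda>p. F (fst p) (fst (snd p)) (snd (snd p))" "\<Lambda> \<times> {..<D} \<times> {..<D}"]
      by (simp add: sum.cartesian_product case_prod_unfold)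
  qed
  \<comment> \<open>\<open>2 * R\<close> blocks hold all vectors involved:
    \<open>t + s < 2 * R\<close> for \<open>s, t < R\<close>, and
    \<open>2 * D + t + s < 2 * R\<close> for \<open>s, t < R - D\<close>.\<close>
  have key: "(real (R - D))\<^sup>2 * dil_norm S e0 (2 * D) Yv \<le> (real R)\<^sup>2 * B * (\<Sum>l\<in>\<Lambda>. N0 (h l))"
      if R: "R > D" for R
  proof (rule toeplitz_bound[OF fincc[of "2 * R"], where X = "\<lambda>s t l. co (A s t (\<iota> (h l)))" and u = u])
    show "D \<le> R" "0 < R" using R by auto
    show "sqnorm (cc (2 * R)) (\<lambda>c. \<Sum>l\<in>\<Lambda>. \<Sum>m<D. \<Sum>n<D. u l m n * co (A (s + m) (t + n) (\<iota> (h l))) c)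
        = dil_norm S e0 (2 * D) Yv"
      if "s < R - D" "t < R - D" for s t
    proof -
      have "sqnorm (cc (2 * R)) (\<lambda>c. \<Sum>l\<in>\<Lambda>. \<Sum>m<D. \<Sum>n<D. u l m n * co (A (s + m) (t + n) (\<iota> (h l))) c)
          = dil_norm S e0 (2 * R) (A s t Yv)"
        unfolding lin_co[symmetric] A_Yv[symmetric] sqnorm_co ..
      also have "\<dots> = dil_norm S e0 (2 * D + t + s) (A s t Yv)"
        using that by (intro norm_mono A suppYv) auto
      also have "\<dots> = dil_norm S e0 (2 * D) Yv" by (intro A suppYv)
      finally show ?thesis .
    qed
    show "sqnorm (cc (2 * R)) (co (A s t (\<iota> (h l)))) = N0 (h l)" if "s < R" "t < R" for s t l
    proof -
      have "sqnorm (cc (2 * R)) (co (A s t (\<iota> (h l)))) = dil_norm S e0 (0 + t + s) (A s t (\<iota> (h l)))"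
        unfolding sqnorm_co using that by (intro norm_mono A supp0) auto
      then show ?thesis using A(2)[OF supp0] norm0 by simp
    qed
  qed (use B in auto)
  \<comment> \<open>After division by \<open>R^2\<close> the boundary loss is the factor
    \<open>(1 - D / R)^2\<close>, which tends to 1.\<close>
  have "(\<lambda>R. (1 - real D / real R)\<^sup>2 * dil_norm S e0 (2 * D) Yv) \<longlonglongrightarrow> (1 - 0)\<^sup>2 * dil_norm S e0 (2 * D) Yv"
    by (intro tendsto_intros lim_const_over_n)
  moreover have "\<forall>\<^sub>F R in sequentially. (1 - real D / real R)\<^sup>2 * dil_norm S e0 (2 * D) Yv
      \<le> B * (\<Sum>l\<in>\<Lambda>. N0 (h l))"
    using eventually_gt_at_top[of D]
  proof eventually_elim
    case (elim R)
    then have "real (R - D) = real R * (1 - real D / real R)" by (simp add: of_nat_diff field_simps)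
    with key[OF elim] elim show ?case by (simp add: power_mult_distrib mult.assoc)
  qed
  ultimately have "(1 - 0)\<^sup>2 * dil_norm S e0 (2 * D) Yv \<le> B * (\<Sum>l\<in>\<Lambda>. N0 (h l))"
    by (intro tendsto_upperbound) auto
  moreover have "N0 y \<le> dil_norm S e0 (2 * D) Yv" unfolding headYv[symmetric] by (rule N0_le)
  ultimately show ?thesis by (simp add: qN)
qed

section \<open>Interpolation of bounded holomorphic functions\<close>

text \<open>Lagrange interpolation at the \<open>R\<close> points \<open>r \<omega>\<^sup>s\<close>, \<open>\<omega> = exp (2 \<pi> i / R)\<close>. The error is geometric in \<open>R\<close>
  while the operator norm is at most \<open>R\<close>, so the interpolation can be iterated in two variables; and
  the error bound involves finitely many values of \<open>g\<close>, so it survives pointwise limits.\<close>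

definition interp_coeff :: "real \<Rightarrow> nat \<Rightarrow> (complex \<Rightarrow> complex) \<Rightarrow> nat \<Rightarrow> complex" where
  "interp_coeff r R g m = (\<Sum>s<R. g (of_real r * cis (2 * pi / real R) ^ s)
      * cnj (cis (2 * pi / real R) ^ (s * m))) / (of_nat R * of_real r ^ m)"

definition interp :: "real \<Rightarrow> nat \<Rightarrow> (complex \<Rightarrow> complex) \<Rightarrow> complex \<Rightarrow> complex" where
  "interp r R g z = (\<Sum>m<R. interp_coeff r R g m * z ^ m)"

text \<open>Cauchy's inequality on a circle of radius \<open>r < 1\<close>, followed by
  \<open>r\<close> tending to 1, since nothing is known on the unit circle itself.\<close>

lemma holomorphic_coeff_bound:
  assumes hol: "g holomorphic_on ball 0 1" and M: "\<And>z. z \<in> ball 0 1 \<Longrightarrow> cmod (g z) \<le> M"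
  shows "cmod ((deriv ^^ n) g 0 / fact n) \<le> M"
proof -
  have "cmod ((deriv ^^ n) g 0) * r ^ n \<le> fact n * M" if r: "0 < r" "r < 1" for r
  proof -
    have "cmod ((deriv ^^ n) g 0) \<le> fact n * M / r ^ n"
      using r by (intro Cauchy_inequality holomorphic_on_imp_continuous_on holomorphic_on_subset[OF hol]
          M) auto
    then show ?thesis using r by (simp add: field_simps)
  qed
  then have "\<forall>\<^sub>F r in at_left 1. cmod ((deriv ^^ n) g 0) * r ^ n \<le> fact n * M"
    by (intro eventually_at_leftI[of 0]) auto
  moreover have "((\<lambda>r::real. cmod ((deriv ^^ n) g 0) * r ^ n) \<longlongrightarrow> cmod ((deriv ^^ n) g 0)
      * 1 ^ n) (at_left 1)"
    by (intro tendsto_intros)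
  ultimately have "cmod ((deriv ^^ n) g 0) * 1 ^ n \<le> fact n * M"
    by (intro tendsto_upperbound) auto
  then show ?thesis by (simp add: norm_divide field_simps)
qed

text \<open>Aliasing: \<open>z^k\<close> interpolates to \<open>r^(k - k mod R) z^(k mod R)\<close>,
  so powers below \<open>R\<close> are reproduced. For \<open>k >= R\<close> both monomials are at
  most \<open>r^k\<close> on \<open>|z| <= r\<close>, and Taylor coefficients are at most
  \<open>M\<close>; the bound is the geometric tail of \<open>2 M r^k\<close>.\<close>

lemma interp_error:
  assumes hol: "g holomorphic_on ball 0 1" and M: "\<And>z. z \<in> ball 0 1 \<Longrightarrow> cmod (g z) \<le> M"
    and r: "0 < r" "r < 1" and R: "R > 0" and z: "cmod z \<le> r"
  shows "cmod (g z - interp r R g z) \<le> 2 * M * r ^ R / (1 - r)"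
proof -
  define c where "c = (\<lambda>n. (deriv ^^ n) g 0 / fact n)"
  define \<omega> where "\<omega> = cis (2 * pi / real R)"
  have M0: "M \<ge> 0" using M[of 0] norm_ge_zero[of "g 0"] by (simp del: norm_ge_zero)
  have c: "cmod (c n) \<le> M" for n unfolding c_def by (rule holomorphic_coeff_bound[OF hol M])
  have sums: "(\<lambda>n. c n * w ^ n) sums g w" if "w \<in> ball 0 1" for w
    using holomorphic_power_series[OF hol that] by (simp add: c_def)
  have wR: "\<omega> ^ R = 1" unfolding \<omega>_def Complex.DeMoivre using R by simp
  have nw: "cmod \<omega> = 1" by (simp add: \<omega>_def)
  have per: "\<omega> ^ (s * k) = \<omega> ^ (s * (k mod R))" for s k
  proof -
    have "\<omega> ^ (s * k) = \<omega> ^ (s * (R * (k div R) + k mod R))" by simp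
    also have "\<dots> = (\<omega> ^ R) ^ (s * (k div R)) * \<omega> ^ (s * (k mod R))"
      unfolding distrib_left power_add by (simp add: mult_ac flip: power_mult)
    finally show ?thesis by (simp add: wR)
  qed
  have mono: "interp r R (\<lambda>w. w ^ k) z = of_real r ^ (k - k mod R) * z ^ (k mod R)" for k
  proof -
    have "interp_coeff r R (\<lambda>w. w ^ k) m = (if m = k mod R then of_real r ^ (k - k mod R) else 0)"
        if m: "m < R" for m
    proof -
      have "(\<Sum>s<R. (of_real r * \<omega> ^ s) ^ k * cnj (\<omega> ^ (s * m)))
          = of_real r ^ k * (\<Sum>s<R. \<omega> ^ (s * (k mod R)) * cnj (\<omega> ^ (s * m)))"
        unfolding sum_distrib_left by (intro sum.cong refl) (simp add: power_mult_distrib mult.assoc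
            flip: power_mult, simp add: per[of _ k])
      also have "\<dots> = of_real r ^ k * (if k mod R = m then of_nat R else 0)"
        unfolding \<omega>_def by (subst roots_of_unity_orthogonal) (use m R in auto)
      finally show ?thesis
        unfolding interp_coeff_def \<omega>_def[symmetric] using r R by (auto simp: power_diff)
    qed
    then have "interp r R (\<lambda>w. w ^ k) z = (\<Sum>m<R. if m
        = k mod R then of_real r ^ (k - k mod R) * z ^ m else 0)"
      unfolding interp_def by (intro sum.cong) auto
    then show ?thesis using R by simp
  qed
  have in_ball: "of_real r * \<omega> ^ s \<in> ball 0 1" for s using r nw by (simp add: norm_mult norm_power)
  have "(\<lambda>k. c k * interp r R (\<lambda>w. w ^ k) z) sums interp r R g z"
    unfolding interp_def interp_coeff_def \<omega>_def[symmetric] sum_distrib_left sum_divide_distrib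
        sum_distrib_right
  proof (intro sums_sum)
    fix m s
    have "(\<lambda>k. c k * (of_real r * \<omega> ^ s) ^ k * (cnj (\<omega> ^ (s * m)) / (of_nat R * of_real r ^ m)
        * z ^ m)) sums
      (g (of_real r * \<omega> ^ s) * (cnj (\<omega> ^ (s * m)) / (of_nat R * of_real r ^ m) * z ^ m))"
      by (intro sums_mult2 sums in_ball)
    then show "(\<lambda>k. c k * ((of_real r * \<omega> ^ s) ^ k * cnj (\<omega> ^ (s * m)) / (of_nat R * of_real r ^ m)
        * z ^ m)) sums
      (g (of_real r * \<omega> ^ s) * cnj (\<omega> ^ (s * m)) / (of_nat R * of_real r ^ m) * z ^ m)"
      by (simp add: mult.assoc)
  qed
  then have "(\<lambda>k. c k * z ^ k - c k * interp r R (\<lambda>w. w ^ k) z) sums (g z - interp r R g z)"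
    using z r by (intro sums_diff sums) auto
  then have S: "(\<lambda>k. c k * (z ^ k - of_real r ^ (k - k mod R) * z ^ (k mod R))) sums (g z - interp r R g z)"
    unfolding mono by (simp add: right_diff_distrib)
  have "(\<lambda>k. c k * (z ^ k - of_real r ^ (k - k mod R) * z ^ (k mod R))) sums (g z - interp r R g z) \<longleftrightarrow>
    (\<lambda>k. c (k + R) * (z ^ (k + R) - of_real r ^ (k + R - (k + R) mod R) * z ^ ((k
        + R) mod R))) sums (g z - interp r R g z)"
    by (rule sums_zero_iff_shift[symmetric]) auto
  with S have S': "(\<lambda>k. c (k + R) * (z ^ (k + R) - of_real r ^ (k + R - (k + R) mod R) * z ^ ((k
      + R) mod R))) sums (g z - interp r R g z)"
    by blast
  have bd: "cmod (c (k + R) * (z ^ (k + R) - of_real r ^ (k + R - (k + R) mod R) * z ^ ((k + R) mod R)))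
      \<le> 2 * M * r ^ R * r ^ k" for k
  proof -
    have 1: "cmod (z ^ (k + R)) \<le> r ^ (k + R)" using z by (simp add: norm_power power_mono del: power_add)
    have "cmod (of_real r ^ (k + R - (k + R) mod R) * z ^ ((k + R) mod R))
        \<le> r ^ (k + R - (k + R) mod R) * r ^ ((k + R) mod R)"
      unfolding norm_mult norm_power using z r by (intro mult_mono power_mono) auto
    also have "\<dots> = r ^ (k + R)" unfolding power_add[symmetric] by (simp del: mod_add_self2)
    finally have "cmod (z ^ (k + R) - of_real r ^ (k + R - (k + R) mod R) * z ^ ((k + R) mod R))
        \<le> 2 * r ^ (k + R)"
      using 1 norm_triangle_ineq4[of "z ^ (k + R)" "of_real r ^ (k + R - (k + R) mod R) * z ^ ((k
          + R) mod R)"] by linarith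
    then have "cmod (c (k + R)) * cmod (z ^ (k + R) - of_real r ^ (k + R - (k + R) mod R) * z ^ ((k
        + R) mod R)) \<le> M * (2 * r ^ (k + R))"
      using c M0 by (intro mult_mono) auto
    then show ?thesis unfolding norm_mult by (simp add: power_add mult_ac)
  qed
  have geo: "(\<lambda>k. 2 * M * r ^ R * r ^ k) sums (2 * M * r ^ R * (1 / (1 - r)))"
    using r by (intro sums_mult geometric_sums) auto
  have "cmod (suminf (\<lambda>k. c (k + R) * (z ^ (k + R) - of_real r ^ (k + R - (k + R) mod R) * z ^ ((k
      + R) mod R)))) \<le> suminf (\<lambda>k. 2 * M * r ^ R * r ^ k)"
    by (rule norm_suminf_le[OF bd sums_summable[OF geo]])
  then show ?thesis unfolding sums_unique[OF S', symmetric] sums_unique[OF geo, symmetric] by simp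
qed

lemma interp_bound:
  assumes g: "\<And>w. cmod w = r \<Longrightarrow> cmod (g w) \<le> M" and r: "0 < r" and R: "R > 0" and z: "cmod z \<le> r"
  shows "cmod (interp r R g z) \<le> real R * M"
proof -
  have "cmod (interp_coeff r R g m * z ^ m) \<le> M" for m
  proof -
    have "cmod (\<Sum>s<R. g (of_real r * cis (2 * pi / real R) ^ s) * cnj (cis (2 * pi / real R) ^ (s * m)))
        \<le> (\<Sum>s<R. M)"
      using r by (intro sum_norm_le) (auto simp: norm_mult norm_power intro!: g)
    then have 1: "cmod (interp_coeff r R g m) \<le> M / r ^ m"
      unfolding interp_coeff_def using r R by (simp add: norm_divide norm_mult norm_power field_simps)
    have "cmod (interp_coeff r R g m * z ^ m) \<le> M / r ^ m * r ^ m"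
      unfolding norm_mult norm_power using z r 1 by (intro mult_mono power_mono)
          (auto intro: order_trans[OF norm_ge_zero 1])
    then show ?thesis using r by simp
  qed
  then have "cmod (interp r R g z) \<le> (\<Sum>m<R. M)" unfolding interp_def by (intro sum_norm_le) auto
  then show ?thesis by simp
qed

lemma interp_diff: "interp r R (\<lambda>w. f w - g w) z = interp r R f z - interp r R g z"
  by (simp add: interp_def interp_coeff_def left_diff_distrib sum_subtractf diff_divide_distrib)

lemma Hinf_slices:
  assumes f: "f \<in> Hinf bidisc"
  shows "y \<in> ball 0 1 \<Longrightarrow> (\<lambda>x. f (x, y)) holomorphic_on ball 0 1"
    "x \<in> ball 0 1 \<Longrightarrow> (\<lambda>y. f (x, y)) holomorphic_on ball 0 1"
proof -
  have d: "\<exists>a b. (f has_derivative (\<lambda>h. a * fst h + b * snd h)) (at (x, y))"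
    if "x \<in> ball 0 1" "y \<in> ball 0 1" for x y
    using f that by (auto simp: Hinf_def holomorphic2_on_def bidisc_def)
  show "(\<lambda>x. f (x, y)) holomorphic_on ball 0 1" if y: "y \<in> ball 0 1"
  proof (rule holomorphic_onI)
    fix x :: complex assume x: "x \<in> ball 0 1"
    obtain a b where ab: "(f has_derivative (\<lambda>h. a * fst h + b * snd h)) (at (x, y))" using d[OF x y]
        by blast
    have "((\<lambda>x. f (x, y)) has_derivative (\<lambda>h. a * fst (h, 0::complex) + b * snd (h, 0::complex))) (at x)"
      by (rule has_derivative_compose[where f = "\<lambda>x. (x, y)" and g = f,
          OF _ ab]) (auto intro!: derivative_eq_intros)
    then have "((\<lambda>x. f (x, y)) has_field_derivative a) (at x)"
      by (simp add: has_field_derivative_def)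
    then show "(\<lambda>x. f (x, y)) field_differentiable at x within ball 0 1"
      using field_differentiable_at_within field_differentiable_def by blast
  qed
  show "(\<lambda>y. f (x, y)) holomorphic_on ball 0 1" if x: "x \<in> ball 0 1"
  proof (rule holomorphic_onI)
    fix y :: complex assume y: "y \<in> ball 0 1"
    obtain a b where ab: "(f has_derivative (\<lambda>h. a * fst h + b * snd h)) (at (x, y))" using d[OF x y]
        by blast
    have "((\<lambda>y. f (x, y)) has_derivative (\<lambda>h. a * fst (0::complex, h) + b * snd (0::complex, h))) (at y)"
      by (rule has_derivative_compose[where f = "\<lambda>y. (x, y)" and g = f,
          OF _ ab]) (auto intro!: derivative_eq_intros)
    then have "((\<lambda>y. f (x, y)) has_field_derivative b) (at y)"
      by (simp add: has_field_derivative_def)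
    then show "(\<lambda>y. f (x, y)) field_differentiable at y within ball 0 1"
      using field_differentiable_at_within field_differentiable_def by blast
  qed
qed

lemma Hinf_isCont:
  assumes f: "f \<in> Hinf bidisc" and z: "z \<in> bidisc"
  shows "isCont f z"
proof -
  obtain a b where "(f has_derivative (\<lambda>h. a * fst h + b * snd h)) (at z)"
    using f z unfolding Hinf_def holomorphic2_on_def by blast
  then show ?thesis by (rule has_derivative_continuous)
qed

definition interp2_coeff :: "real \<Rightarrow> nat \<Rightarrow> (complex \<times> complex \<Rightarrow> complex) \<Rightarrow> nat \<Rightarrow> nat \<Rightarrow> complex" where
  "interp2_coeff r R f m n = interp_coeff r R (\<lambda>x. interp_coeff r R (\<lambda>y. f (x, y)) n) m"

lemma interp2_sum:
  "(\<Sum>m<R. \<Sum>n<R. interp2_coeff r R f m n * x ^ m * y ^ n) = interp r R (\<lambda>x. interp r R (\<lambda>y. f (x, y)) y) x"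
proof -
  have lin: "interp_coeff r R (\<lambda>x. \<Sum>n<R. g n x * c n) m = (\<Sum>n<R. interp_coeff r R (g n) m * c n)"
      for g :: "nat \<Rightarrow> complex \<Rightarrow> complex" and c m
  proof -
    define S where "S = (\<lambda>n. \<Sum>s<R. g n (of_real r * cis (2 * pi / real R) ^ s)
        * cnj (cis (2 * pi / real R) ^ (s * m)))"
    have "(\<Sum>s<R. (\<Sum>n<R. g n (of_real r * cis (2 * pi / real R) ^ s) * c n)
        * cnj (cis (2 * pi / real R) ^ (s * m)))
      = (\<Sum>n<R. S n * c n)"
      unfolding sum_distrib_right S_def by (subst sum.swap) (simp add: mult_ac)
    moreover have "interp_coeff r R (g n) m = S n / (of_nat R * of_real r ^ m)" for n
      unfolding interp_coeff_def S_def ..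
    ultimately show ?thesis unfolding interp_coeff_def[of r R "\<lambda>x. \<Sum>n<R. g n x * c n"]
        by (simp add: sum_divide_distrib)
  qed
  show ?thesis
    unfolding interp_def lin interp2_coeff_def sum_distrib_right
        by (intro sum.cong refl) (simp add: mult_ac)
qed

text \<open>With \<open>I_x\<close> and \<open>I_y\<close> for interpolation in one variable,
  \<open>f - I_x I_y f = (f - I_x f) + I_x (f - I_y f)\<close>; the second term costs the factor
  \<open>R\<close>.\<close>

lemma interp2_error:
  assumes sl1: "\<And>y. y \<in> ball 0 1 \<Longrightarrow> (\<lambda>x. f (x, y)) holomorphic_on ball 0 1"
    and sl2: "\<And>x. x \<in> ball 0 1 \<Longrightarrow> (\<lambda>y. f (x, y)) holomorphic_on ball 0 1"
    and M: "\<And>x y. x \<in> ball 0 1 \<Longrightarrow> y \<in> ball 0 1 \<Longrightarrow> cmod (f (x, y)) \<le> M"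
    and r: "0 < r" "r < 1" and R: "R > 0" and xy: "cmod x \<le> r" "cmod y \<le> r"
  shows "cmod (f (x, y) - (\<Sum>m<R. \<Sum>n<R. interp2_coeff r R f m n * x ^ m * y ^ n))
      \<le> (real R + 1) * (2 * M * r ^ R / (1 - r))"
proof -
  define e where "e = 2 * M * r ^ R / (1 - r)"
  have y: "y \<in> ball 0 1" and x: "x \<in> ball 0 1" using xy r by auto
  have 1: "cmod (f (x, y) - interp r R (\<lambda>x. f (x, y)) x) \<le> e"
    unfolding e_def by (rule interp_error[OF sl1[OF y]]) (use M y r R xy in auto)
  have 2: "cmod (f (w, y) - interp r R (\<lambda>y. f (w, y)) y) \<le> e" if "cmod w = r" for w
  proof -
    have w: "w \<in> ball 0 1" using that r by auto
    show ?thesis unfolding e_def by (rule interp_error[OF sl2[OF w]]) (use M w r R xy in auto)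
  qed
  have "cmod (interp r R (\<lambda>x. f (x, y) - interp r R (\<lambda>y. f (x, y)) y) x) \<le> real R * e"
    by (rule interp_bound[OF 2]) (use r R xy in auto)
  with 1 show ?thesis
    unfolding interp2_sum interp_diff e_def[symmetric]
    using norm_triangle_ineq[of "f (x, y) - interp r R (\<lambda>x. f (x, y)) x" "interp r R (\<lambda>x. f (x, y)) x
        - interp r R (\<lambda>x. interp r R (\<lambda>y. f (x, y)) y) x"]
    by (simp add: algebra_simps)
qed

lemma interp2_error_tendsto:
  assumes "0 < r" "r < 1"
  shows "(\<lambda>R::nat. (real R + 1) * (2 * M * r ^ R / (1 - r))) \<longlonglongrightarrow> 0"
proof -
  have "(\<lambda>R::nat. real R * r ^ R) \<longlonglongrightarrow> 0"
    using powser_times_n_limit_0[of r] assms by simp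
  moreover have "(\<lambda>R::nat. r ^ R) \<longlonglongrightarrow> 0" using assms by (intro LIMSEQ_realpow_zero) auto
  ultimately have "(\<lambda>R::nat. (real R * r ^ R + r ^ R) * (2 * M / (1 - r))) \<longlonglongrightarrow> (0 + 0) * (2 * M / (1 - r))"
    by (intro tendsto_mult tendsto_add tendsto_const)
  then have lim: "(\<lambda>R::nat. (real R * r ^ R + r ^ R) * (2 * M / (1 - r))) \<longlonglongrightarrow> 0"
      by (simp only: add_0 mult_zero_left)
  have "(\<lambda>R::nat. (real R + 1) * (2 * M * r ^ R / (1 - r)))
      = (\<lambda>R. (real R * r ^ R + r ^ R) * (2 * M / (1 - r)))"
    using assms by (intro ext) (simp add: field_simps)
  with lim show ?thesis by (simp only:)
qed

section \<open>Ando's inequality for rows of bounded holomorphic functions\<close>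

text \<open>The row of the \<open>F l\<close>, evaluated at the commuting diagonal operators
  \<open>b\<close> and \<open>d\<close>, has squared norm at most \<open>B\<close> in the
  \<open>K\<close> seminorm. The polynomial case is applied to interpolants of
  \<open>F l (r x, r y)\<close>, which converge uniformly on the closed bidisc; then
  \<open>r\<close> tends to 1.\<close>

lemma ando_Hinf_bound:
  fixes K :: "'f \<Rightarrow> 'f \<Rightarrow> complex" and F :: "'l \<Rightarrow> complex \<times> complex \<Rightarrow> complex" and h :: "'l \<Rightarrow> 'f \<Rightarrow> complex"
  assumes fin: "finite S" "finite \<Lambda>"
    and psd: "psd_on S K"
    and psd1: "psd_on S (\<lambda>f g. (1 - b f * cnj (b g)) * K f g)"
    and psd2: "psd_on S (\<lambda>f g. (1 - d f * cnj (d g)) * K f g)"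
    and bd: "\<And>f. f \<in> S \<Longrightarrow> (b f, d f) \<in> bidisc"
    and F: "\<And>l. l \<in> \<Lambda> \<Longrightarrow> F l \<in> Hinf bidisc"
    and B: "\<And>z. z \<in> bidisc \<Longrightarrow> sqnorm \<Lambda> (\<lambda>l. F l z) \<le> B"
  defines "q \<equiv> \<lambda>x. (\<Sum>f\<in>S. \<Sum>g\<in>S. K f g * x f * cnj (x g))"
  shows "Re (q (\<lambda>f. \<Sum>l\<in>\<Lambda>. F l (b f, d f) * h l f)) \<le> B * (\<Sum>l\<in>\<Lambda>. Re (q (h l)))"
proof -
  define M where "M = sqrt B"
  have B0: "B \<ge> 0" using B[of "(0,0)"] sqnorm_nonneg[of \<Lambda> "\<lambda>l. F l (0,0)"] by (simp add: bidisc_def)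
  have M: "cmod (F l z) \<le> M" if "l \<in> \<Lambda>" "z \<in> bidisc" for l z
  proof -
    have "(cmod (F l z))\<^sup>2 \<le> sqnorm \<Lambda> (\<lambda>l. F l z)"
      unfolding sqnorm_def using that fin by (intro member_le_sum) auto
    then show ?thesis unfolding M_def using B[OF that(2)] by (intro real_le_rsqrt) linarith
  qed
  have M0: "M \<ge> 0" using B0 by (simp add: M_def)
  have q_cont: "((\<lambda>t. Re (q (x t))) \<longlongrightarrow> Re (q x0)) \<FF>" if "\<And>f. f \<in> S \<Longrightarrow> ((\<lambda>t. x t f) \<longlongrightarrow> x0 f) \<FF>"
    for x :: "'t \<Rightarrow> 'f \<Rightarrow> complex" and x0 and \<FF> :: "'t filter"
    unfolding q_def using that by (intro tendsto_intros) auto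
  have key: "Re (q (\<lambda>f. \<Sum>l\<in>\<Lambda>. F l (of_real r * b f, of_real r * d f) * h l f))
      \<le> B * (\<Sum>l\<in>\<Lambda>. Re (q (h l)))" if r: "0 < r" "r < 1" for r
  proof -
    define \<delta> where "\<delta> = (\<lambda>R::nat. (real R + 1) * (2 * M * r ^ R / (1 - r)))"
    \<comment> \<open>Coefficients after the substitution of \<open>(r x, r y)\<close>: the
      interpolant is controlled only for arguments of modulus at most \<open>r\<close>, and the
      torus has to be mapped there.\<close>
    define u where "u = (\<lambda>R l m n. interp2_coeff r R (F l) m n * of_real r ^ m * of_real r ^ n)"
    have \<delta>: "\<delta> \<longlonglongrightarrow> 0" unfolding \<delta>_def by (rule interp2_error_tendsto[OF r])
    have err: "cmod (F l (of_real r * x, of_real r * y) - (\<Sum>m<R. \<Sum>n<R. u R l m n * x ^ m * y ^ n)) \<le> \<delta> R"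
      if "l \<in> \<Lambda>" "R > 0" "cmod x \<le> 1" "cmod y \<le> 1" for l R x y
    proof -
      have "(\<Sum>m<R. \<Sum>n<R. u R l m n * x ^ m * y ^ n) = 
         (\<Sum>m<R. \<Sum>n<R. interp2_coeff r R (F l) m n * (of_real r * x) ^ m * (of_real r * y) ^ n)"
        unfolding u_def by (intro sum.cong refl) (simp add: power_mult_distrib mult_ac)
      moreover have "cmod (F l (of_real r * x, of_real r * y) - \<dots>) \<le> \<delta> R"
        unfolding \<delta>_def
        by (rule interp2_error[OF Hinf_slices[OF F[OF that(1)]]])
           (use that r M in \<open>auto simp: bidisc_def norm_mult mult_left_le\<close>)
      ultimately show ?thesis by simp
    qed
    \<comment> \<open>Replacing \<open>F l\<close> by its interpolant raises each of the
      \<open>card \<Lambda>\<close> squares by at most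
      \<open>2 M \<delta> + \<delta>^2\<close>.\<close>
    define B' where "B' = (\<lambda>R. B + real (card \<Lambda>) * (2 * M * \<delta> R + (\<delta> R)\<^sup>2))"
    have main: "Re (q (\<lambda>f. \<Sum>l\<in>\<Lambda>. \<Sum>m<R. \<Sum>n<R. u R l m n * (b f ^ m * d f ^ n * h l f)))
        \<le> B' R * (\<Sum>l\<in>\<Lambda>. Re (q (h l)))"
      if R: "R > 0" for R
      unfolding q_def
    proof (rule ando_polynomial_bound[OF fin psd psd1 psd2])
      fix x y :: complex assume xy: "cmod x = 1" "cmod y = 1"
      have in_b: "(of_real r * x, of_real r * y) \<in> bidisc" using xy r by (simp add: bidisc_def norm_mult)
      have "(cmod (\<Sum>m<R. \<Sum>n<R. u R l m n * x ^ m * y ^ n))\<^sup>2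
          \<le> (cmod (F l (of_real r * x, of_real r * y)))\<^sup>2 + (2 * M * \<delta> R + (\<delta> R)\<^sup>2)"
        if l: "l \<in> \<Lambda>" for l
      proof -
        have e: "cmod (F l (of_real r * x, of_real r * y) - (\<Sum>m<R. \<Sum>n<R. u R l m n * x ^ m * y ^ n)) \<le> \<delta> R"
          using err[OF l R] xy by simp
        then have "cmod (\<Sum>m<R. \<Sum>n<R. u R l m n * x ^ m * y ^ n)
            \<le> cmod (F l (of_real r * x, of_real r * y)) + \<delta> R"
          by (smt (verit) norm_minus_commute norm_triangle_sub)
        then have "(cmod (\<Sum>m<R. \<Sum>n<R. u R l m n * x ^ m * y ^ n))\<^sup>2
            \<le> (cmod (F l (of_real r * x, of_real r * y)) + \<delta> R)\<^sup>2"
          by (intro power_mono) auto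
        also have "\<dots> = (cmod (F l (of_real r * x, of_real r * y)))\<^sup>2
            + 2 * cmod (F l (of_real r * x, of_real r * y)) * \<delta> R + (\<delta> R)\<^sup>2"
          by (simp add: power2_sum)
        also have "\<dots> \<le> (cmod (F l (of_real r * x, of_real r * y)))\<^sup>2 + (2 * M * \<delta> R + (\<delta> R)\<^sup>2)"
          using M[OF l in_b] order_trans[OF norm_ge_zero e] by (simp add: mult_right_mono)
        finally show ?thesis .
      qed
      then have "sqnorm \<Lambda> (\<lambda>l. \<Sum>m<R. \<Sum>n<R. u R l m n * x ^ m * y ^ n)
          \<le> (\<Sum>l\<in>\<Lambda>. (cmod (F l (of_real r * x, of_real r * y)))\<^sup>2 + (2 * M * \<delta> R + (\<delta> R)\<^sup>2))"
        unfolding sqnorm_def by (rule sum_mono)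
      also have "\<dots> \<le> B' R" using B[OF in_b] by (simp add: sum.distrib B'_def sqnorm_def)
      finally show "sqnorm \<Lambda> (\<lambda>l. \<Sum>m<R. \<Sum>n<R. u R l m n * x ^ m * y ^ n) \<le> B' R" .
    qed
    show ?thesis
    proof (rule tendsto_le[OF sequentially_bot])
      show "(\<lambda>R. B' R * (\<Sum>l\<in>\<Lambda>. Re (q (h l)))) \<longlonglongrightarrow> B * (\<Sum>l\<in>\<Lambda>. Re (q (h l)))"
      proof -
        have "B' \<longlonglongrightarrow> B + real (card \<Lambda>) * (2 * M * 0 + 0\<^sup>2)" unfolding B'_def by (intro tendsto_intros \<delta>)
        then show ?thesis by (auto intro: tendsto_mult_right)
      qed
      show "(\<lambda>R. Re (q (\<lambda>f. \<Sum>l\<in>\<Lambda>. \<Sum>m<R. \<Sum>n<R. u R l m n * (b f ^ m * d f ^ n * h l f)))) \<longlonglongrightarrow>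
        Re (q (\<lambda>f. \<Sum>l\<in>\<Lambda>. F l (of_real r * b f, of_real r * d f) * h l f))"
      proof (rule q_cont, rule tendsto_sum)
        fix f l assume f: "f \<in> S" and l: "l \<in> \<Lambda>"
        have "(\<lambda>R. F l (of_real r * b f, of_real r * d f) - (\<Sum>m<R. \<Sum>n<R. u R l m n * b f ^ m * d f ^ n))
            \<longlonglongrightarrow> 0"
        proof (rule Lim_null_comparison[OF _ \<delta>])
          show "\<forall>\<^sub>F R in sequentially. norm (F l (of_real r * b f, of_real r * d f)
              - (\<Sum>m<R. \<Sum>n<R. u R l m n * b f ^ m * d f ^ n)) \<le> \<delta> R"
            using eventually_gt_at_top[of 0] by eventually_elim (rule err[OF l], use bd[OF f] in \<open>auto
                simp: bidisc_def\<close>)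
        qed
        then have "(\<lambda>R. F l (of_real r * b f, of_real r * d f) - (F l (of_real r * b f, of_real r * d f)
            - (\<Sum>m<R. \<Sum>n<R. u R l m n * b f ^ m * d f ^ n))) \<longlonglongrightarrow> F l (of_real r * b f, of_real r * d f) - 0"
          by (intro tendsto_diff tendsto_const)
        then have "(\<lambda>R. (\<Sum>m<R. \<Sum>n<R. u R l m n * b f ^ m * d f ^ n) * h l f)
            \<longlonglongrightarrow> F l (of_real r * b f, of_real r * d f) * h l f"
          by (intro tendsto_mult tendsto_const) simp
        then show "(\<lambda>R. \<Sum>m<R. \<Sum>n<R. u R l m n * (b f ^ m * d f ^ n * h l f))
            \<longlonglongrightarrow> F l (of_real r * b f, of_real r * d f) * h l f"
          by (simp add: sum_distrib_right mult.assoc)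
      qed
      show "\<forall>\<^sub>F R in sequentially. Re (q (\<lambda>f. \<Sum>l\<in>\<Lambda>. \<Sum>m<R. \<Sum>n<R. u R l m n * (b f ^ m * d f ^ n * h l f)))
          \<le> B' R * (\<Sum>l\<in>\<Lambda>. Re (q (h l)))"
        using eventually_gt_at_top[of 0] by eventually_elim (rule main)
    qed
  qed
  have "((\<lambda>r. Re (q (\<lambda>f. \<Sum>l\<in>\<Lambda>. F l (of_real r * b f, of_real r * d f) * h l f))) \<longlongrightarrow>
      Re (q (\<lambda>f. \<Sum>l\<in>\<Lambda>. F l (b f, d f) * h l f))) (at_left 1)"
  proof (rule q_cont, intro tendsto_sum tendsto_mult tendsto_const)
    fix f l assume f: "f \<in> S" and l: "l \<in> \<Lambda>"
    have "((\<lambda>r. (of_real r * b f, of_real r * d f)) \<longlongrightarrow> (of_real 1 * b f, of_real 1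
        * d f)) (at_left (1::real))"
      by (intro tendsto_intros)
    then show "((\<lambda>r. F l (of_real r * b f, of_real r * d f)) \<longlongrightarrow> F l (b f, d f)) (at_left (1::real))"
      using isCont_tendsto_compose[OF Hinf_isCont[OF F[OF l] bd[OF f]]] by simp
  qed
  moreover have "\<forall>\<^sub>F r in at_left (1::real). Re (q (\<lambda>f. \<Sum>l\<in>\<Lambda>. F l (of_real r * b f, of_real r * d f)
      * h l f)) \<le> B * (\<Sum>l\<in>\<Lambda>. Re (q (h l)))"
    by (rule eventually_at_leftI[of 0]) (auto intro: key)
  ultimately show ?thesis by (intro tendsto_upperbound) auto
qed

section \<open>The pentablock\<close>

lemma norm_vec2: "(norm (v :: complex^2))\<^sup>2 = (cmod (v $ 1))\<^sup>2 + (cmod (v $ 2))\<^sup>2"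
  by (simp add: norm_vec_def L2_set_def sum_2)

definition strict_contraction2 :: "complex \<Rightarrow> complex \<Rightarrow> complex \<Rightarrow> complex \<Rightarrow> bool" where
  "strict_contraction2 a b c d \<longleftrightarrow> (\<forall>x y. (x, y) \<noteq> (0, 0) \<longrightarrow>
     (cmod (a * x + b * y))\<^sup>2 + (cmod (c * x + d * y))\<^sup>2 < (cmod x)\<^sup>2 + (cmod y)\<^sup>2)"

lemma pentablock_entries:
  assumes "z \<in> pentablock"
  obtains a b c d where "strict_contraction2 a b c d" "c1 z = c" "c2 z = a + d" "c3 z = a * d - b * c"
proof -
  obtain A :: "complex^2^2" where A: "z = (A $ 2 $ 1, trace A, det A)" "onorm (\<lambda>x. A *v x) < 1"
    using assms by (auto simp: pentablock_def)
  have "strict_contraction2 (A $ 1 $ 1) (A $ 1 $ 2) (A $ 2 $ 1) (A $ 2 $ 2)"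
    unfolding strict_contraction2_def
  proof (intro allI impI)
    fix x y :: complex assume xy: "(x, y) \<noteq> (0, 0)"
    define v :: "complex^2" where "v = (\<chi> i. if i = 1 then x else y)"
    have v: "v $ 1 = x" "v $ 2 = y" by (auto simp: v_def)
    then have "v \<noteq> 0" using xy by auto
    have "norm (A *v v) \<le> onorm (\<lambda>x. A *v x) * norm v" by (rule onorm[OF matrix_vector_mul_bounded_linear])
    also have "\<dots> < 1 * norm v" using A \<open>v \<noteq> 0\<close> by (intro mult_strict_right_mono) auto
    finally have "(norm (A *v v))\<^sup>2 < (norm v)\<^sup>2" by (intro power_strict_mono) auto
    then show "(cmod (A $ 1 $ 1 * x + A $ 1 $ 2 * y))\<^sup>2
        + (cmod (A $ 2 $ 1 * x + A $ 2 $ 2 * y))\<^sup>2 < (cmod x)\<^sup>2 + (cmod y)\<^sup>2"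
      by (simp add: norm_vec2 v matrix_vector_mult_def sum_2)
  qed
  then show ?thesis using that A by (auto simp: trace_def sum_2 det_2)
qed

text \<open>\<open>onorm\<close> is a supremum, so its strict bound is drawn from a uniform factor
  \<open>k < 1\<close>.\<close>

lemma in_pentablock:
  assumes bd: "\<And>x y. (cmod (a * x + b * y))\<^sup>2 + (cmod (c * x + d * y))\<^sup>2 \<le> k\<^sup>2 * ((cmod x)\<^sup>2 + (cmod y)\<^sup>2)"
    and k: "0 \<le> k" "k < 1"
  shows "(c, a + d, a * d - b * c) \<in> pentablock"
proof -
  define A :: "complex^2^2" where "A = (\<chi> i j. if i = 1 then (if j = 1 then a else b) else (if j
      = 1 then c else d))"
  have A: "A $ 1 $ 1 = a" "A $ 1 $ 2 = b" "A $ 2 $ 1 = c" "A $ 2 $ 2 = d" by (auto simp: A_def)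
  have "onorm (\<lambda>x. A *v x) \<le> k"
  proof (rule onorm_bound[OF k(1)])
    fix v
    have "(norm (A *v v))\<^sup>2 \<le> (k * norm v)\<^sup>2"
      using bd[of "v $ 1" "v $ 2"] by (simp add: norm_vec2 power_mult_distrib matrix_vector_mult_def
          sum_2 A)
    then show "norm (A *v v) \<le> k * norm v" by (rule power2_le_imp_le) (use k in auto)
  qed
  then have "onorm (\<lambda>x. A *v x) < 1" using k by simp
  moreover have "(c, a + d, a * d - b * c) = (A $ 2 $ 1, trace A, det A)"
    by (simp add: trace_def sum_2 det_2 A)
  ultimately show ?thesis unfolding pentablock_def by blast
qed

text \<open>The vector \<open>(1 - \<alpha>d, \<alpha>c)\<close> is the first column of the adjugate of \<open>1 - \<alpha>A\<close>; its images under
  \<open>1 - \<alpha>A\<close> and \<open>A - cnj \<alpha>\<close> have the entries \<open>det (1 - \<alpha>A)\<close> and \<open>(1 - |\<alpha>|\<^sup>2) c\<close>, and \<open>\<psi>\<^sub>\<alpha>\<close> is their quotient.\<close>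

lemma pentablock_psi_aux:
  assumes A: "strict_contraction2 a b c d" and \<alpha>: "cmod \<alpha> \<le> 1"
  shows "1 - \<alpha> * (a + d) + \<alpha>\<^sup>2 * (a * d - b * c) \<noteq> 0"
    "cmod ((1 - (of_real (cmod \<alpha>))\<^sup>2) * c) < cmod (1 - \<alpha> * (a + d) + \<alpha>\<^sup>2 * (a * d - b * c))"
proof -
  define x where "x = 1 - \<alpha> * d"
  define y where "y = \<alpha> * c"
  define D where "D = 1 - \<alpha> * (a + d) + \<alpha>\<^sup>2 * (a * d - b * c)"
  define u where "u = a * x + b * y"
  define v where "v = c * x + d * y"
  have "(cmod d)\<^sup>2 < 1"
    using A[unfolded strict_contraction2_def, rule_format, of 0 1] by simp (smt (verit) zero_le_power2)
  then have "cmod d < 1" using power2_less_imp_less[of "cmod d" 1] by simp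
  then have "cmod (\<alpha> * d) < 1" using \<alpha> by (metis less_le_trans mult_le_cancel_right2 norm_ge_zero
      norm_mult not_le order_le_less_trans)
  then have x0: "x \<noteq> 0" unfolding x_def by auto
  then have uv: "(cmod u)\<^sup>2 + (cmod v)\<^sup>2 < (cmod x)\<^sup>2 + (cmod y)\<^sup>2"
    using A unfolding strict_contraction2_def u_def v_def by auto
  have e1: "x - \<alpha> * u = D" "y - \<alpha> * v = 0"
    by (simp_all add: x_def y_def u_def v_def D_def algebra_simps power2_eq_square)
  have e2: "v - cnj \<alpha> * y = (1 - (of_real (cmod \<alpha>))\<^sup>2) * c"
    unfolding of_real_power[symmetric] complex_norm_square by (simp add: x_def y_def v_def algebra_simps)
  \<comment> \<open>Homogeneous form of \<open>|1 - \<alpha> w|^2 - |w - cnj \<alpha>|^2 = (1 -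
    |\<alpha>|^2) (1 - |w|^2)\<close>; it is applied to \<open>(x, u)\<close> and
    \<open>(y, v)\<close> and the results are added.\<close>
  have id: "(cmod (x - \<alpha> * u))\<^sup>2 - (cmod (u - cnj \<alpha> * x))\<^sup>2 = (1 - (cmod \<alpha>)\<^sup>2) * ((cmod x)\<^sup>2 - (cmod u)\<^sup>2)"
      for x u
    unfolding cmod_power2 by (simp add: algebra_simps power2_eq_square)
  have \<alpha>2: "(cmod \<alpha>)\<^sup>2 \<le> 1" using \<alpha> by (simp add: power_le_one)
  have D0: "D \<noteq> 0"
  proof
    assume "D = 0"
    then have "x = \<alpha> * u" "y = \<alpha> * v" using e1 by auto
    then have "(cmod x)\<^sup>2 + (cmod y)\<^sup>2 = (cmod \<alpha>)\<^sup>2 * ((cmod u)\<^sup>2 + (cmod v)\<^sup>2)"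
      by (simp add: norm_mult power_mult_distrib algebra_simps)
    also have "\<dots> \<le> 1 * ((cmod u)\<^sup>2 + (cmod v)\<^sup>2)" by (intro mult_right_mono \<alpha>2) auto
    finally show False using uv by simp
  qed
  then show "1 - \<alpha> * (a + d) + \<alpha>\<^sup>2 * (a * d - b * c) \<noteq> 0" by (simp add: D_def)
  show "cmod ((1 - (of_real (cmod \<alpha>))\<^sup>2) * c) < cmod (1 - \<alpha> * (a + d) + \<alpha>\<^sup>2 * (a * d - b * c))"
    unfolding D_def[symmetric]
  proof (cases "cmod \<alpha> = 1")
    case True then show "cmod ((1 - (of_real (cmod \<alpha>))\<^sup>2) * c) < cmod D" using D0 by simp
  next
    case False
    then have "0 < 1 - (cmod \<alpha>)\<^sup>2" using \<alpha> by (simp add: abs_square_less_1)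
    then have "0 < (1 - (cmod \<alpha>)\<^sup>2) * ((cmod x)\<^sup>2 - (cmod u)\<^sup>2 + ((cmod y)\<^sup>2 - (cmod v)\<^sup>2))"
      using uv by (intro mult_pos_pos) auto
    also have "\<dots> = (cmod (x - \<alpha> * u))\<^sup>2 - (cmod (u - cnj \<alpha> * x))\<^sup>2
        + ((cmod (y - \<alpha> * v))\<^sup>2 - (cmod (v - cnj \<alpha> * y))\<^sup>2)"
      unfolding id by (simp add: algebra_simps)
    finally have "(cmod (v - cnj \<alpha> * y))\<^sup>2 + (cmod (u - cnj \<alpha> * x))\<^sup>2 < (cmod D)\<^sup>2" unfolding e1 by simp
    then have "(cmod (v - cnj \<alpha> * y))\<^sup>2 < (cmod D)\<^sup>2" by (smt (verit) zero_le_power2)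
    then show "cmod ((1 - (of_real (cmod \<alpha>))\<^sup>2) * c) < cmod D" unfolding e2
        by (rule power2_less_imp_less) simp
  qed
qed

lemma pentablock_denominator:
  "z \<in> pentablock \<Longrightarrow> cmod \<alpha> \<le> 1 \<Longrightarrow> 1 - \<alpha> * c2 z + \<alpha>\<^sup>2 * c3 z \<noteq> 0"
  by (metis pentablock_entries pentablock_psi_aux(1))

lemma pentablock_psi_less:
  "z \<in> pentablock \<Longrightarrow> cmod \<alpha> \<le> 1 \<Longrightarrow> cmod (psi \<alpha> z) < 1"
proof -
  assume z: "z \<in> pentablock" and \<alpha>: "cmod \<alpha> \<le> 1"
  obtain a b c d where "strict_contraction2 a b c d" "c1 z = c" "c2 z = a + d" "c3 z = a * d - b * c"
    using pentablock_entries[OF z] by metis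
  then show ?thesis
    using pentablock_psi_aux[of a b c d \<alpha>] \<alpha> by (simp add: psi_def norm_divide)
qed

text \<open>\<open>\<kappa>\<close> and \<open>\<mu>\<close> are the eigenvalues of a representing
  matrix. An eigenvalue \<open>x\<close> of modulus at least 1 would make
  \<open>\<alpha> = 1 / x\<close> a zero of the denominator of \<open>psi\<close> in the closed
  disc.\<close>

lemma pentablock_roots:
  assumes z: "z \<in> pentablock"
  obtains \<kappa> \<mu> where "cmod \<kappa> < 1" "cmod \<mu> < 1" "c2 z = \<kappa> + \<mu>" "c3 z = \<kappa> * \<mu>"
proof -
  define \<Delta> where "\<Delta> = csqrt ((c2 z)\<^sup>2 - 4 * c3 z)"
  define \<kappa> where "\<kappa> = (c2 z + \<Delta>) / 2"
  define \<mu> where "\<mu> = (c2 z - \<Delta>) / 2"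
  have "\<Delta>\<^sup>2 = (c2 z)\<^sup>2 - 4 * c3 z" by (simp add: \<Delta>_def)
  then have e: "c2 z = \<kappa> + \<mu>" "c3 z = \<kappa> * \<mu>"
    by (auto simp: \<kappa>_def \<mu>_def field_simps power2_eq_square)
  have fac: "1 - \<alpha> * c2 z + \<alpha>\<^sup>2 * c3 z = (1 - \<alpha> * \<kappa>) * (1 - \<alpha> * \<mu>)" for \<alpha>
    by (simp add: e power2_eq_square algebra_simps)
  have *: "cmod x < 1" if "x = \<kappa> \<or> x = \<mu>" for x
  proof (rule ccontr)
    assume n: "\<not> cmod x < 1"
    then have "x \<noteq> 0" "cmod (1 / x) \<le> 1" by (auto simp: norm_divide divide_le_eq)
    then show False using pentablock_denominator[OF z, of "1 / x"] fac[of "1 / x"] that by auto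
  qed
  have "cmod \<kappa> < 1" "cmod \<mu> < 1" using * by auto
  moreover note e
  ultimately show ?thesis using that e by blast
qed

lemma pentablock_c2_less: "z \<in> pentablock \<Longrightarrow> cmod (c2 z / 2) < 1"
proof -
  assume "z \<in> pentablock"
  then obtain \<kappa> \<mu> where "cmod \<kappa> < 1" "cmod \<mu> < 1" "c2 z = \<kappa> + \<mu>" "c3 z = \<kappa> * \<mu>" by (rule pentablock_roots)
  then show ?thesis using norm_triangle_ineq[of \<kappa> \<mu>] by (simp add: norm_divide)
qed

lemma pentablock_bidisc: "z \<in> pentablock \<Longrightarrow> (c1 z, c3 z) \<in> bidisc"
proof -
  assume z: "z \<in> pentablock"
  then obtain \<kappa> \<mu> where l: "cmod \<kappa> < 1" "cmod \<mu> < 1" "c2 z = \<kappa> + \<mu>" "c3 z = \<kappa> * \<mu>"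
      by (rule pentablock_roots)
  have "cmod \<kappa> * cmod \<mu> < 1 * 1" using l by (intro mult_strict_mono') auto
  moreover have "cmod (c1 z) < 1" using pentablock_psi_less[OF z, of 0] by (simp add: psi_def)
  ultimately show ?thesis by (simp add: bidisc_def l norm_mult)
qed

text \<open>With \<open>X\<close> and \<open>Y\<close> as below, \<open>Phi\<close> is
  \<open>- (\<kappa> X + \<mu> Y) / (X + Y)\<close>. For \<open>|\<alpha>| < 1\<close> the gap of
  squared moduli, times \<open>1 - |\<alpha>|^2\<close>, is \<open>4 |X Y|^2 - |p + q|^2\<close>,
  where \<open>p / (X Y)\<close> and \<open>q / (X Y)\<close> are Moebius images of
  \<open>\<kappa>\<close> and \<open>\<mu>\<close>. For \<open>|\<alpha>| = 1\<close> this identity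
  degenerates, but the gap is then a positive combination of \<open>1 - |\<kappa>|^2\<close> and
  \<open>1 - |\<mu>|^2\<close>.\<close>

lemma Phi_less_aux:
  assumes l: "cmod \<kappa> < 1" and m: "cmod \<mu> < 1" and \<alpha>: "cmod \<alpha> \<le> 1"
  shows "cmod (2 * \<alpha> * (\<kappa> * \<mu>) - (\<kappa> + \<mu>)) < cmod (2 - \<alpha> * (\<kappa> + \<mu>))"
proof -
  define X where "X = 1 - \<alpha> * \<mu>"
  define Y where "Y = 1 - \<alpha> * \<kappa>"
  have lt: "cmod (\<alpha> * \<kappa>) < 1" "cmod (\<alpha> * \<mu>) < 1"
    using assms by (smt (verit) mult_left_le_one_le norm_ge_zero norm_mult)+
  then have XY0: "X \<noteq> 0" "Y \<noteq> 0" by (auto simp: X_def Y_def)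
  have sums: "2 - \<alpha> * (\<kappa> + \<mu>) = X + Y" "2 * \<alpha> * (\<kappa> * \<mu>) - (\<kappa> + \<mu>) = - (\<kappa> * X + \<mu> * Y)"
    by (simp_all add: X_def Y_def algebra_simps)
  have l2: "(cmod \<kappa>)\<^sup>2 < 1" "(cmod \<mu>)\<^sup>2 < 1" using l m by (auto simp: abs_square_less_1)
  have "(cmod (\<kappa> * X + \<mu> * Y))\<^sup>2 < (cmod (X + Y))\<^sup>2"
  proof (cases "cmod \<alpha> = 1")
    case True
    then have a: "\<alpha> * cnj \<alpha> = 1" using complex_norm_square[of \<alpha>] by simp
    have "(X + Y) * cnj (X + Y) - (\<kappa> * X + \<mu> * Y) * cnj (\<kappa> * X + \<mu> * Y) =
      2 * ((1 - \<kappa> * cnj \<kappa>) * (X * cnj X) + (1 - \<mu> * cnj \<mu>) * (Y * cnj Y))"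
      using a unfolding X_def Y_def complex_cnj_diff complex_cnj_add complex_cnj_mult complex_cnj_one
          by algebra
    then have "complex_of_real ((cmod (X + Y))\<^sup>2 - (cmod (\<kappa> * X + \<mu> * Y))\<^sup>2) =
      of_real (2 * ((1 - (cmod \<kappa>)\<^sup>2) * (cmod X)\<^sup>2 + (1 - (cmod \<mu>)\<^sup>2) * (cmod Y)\<^sup>2))"
      unfolding complex_norm_square[symmetric] by simp
    then have "(cmod (X + Y))\<^sup>2 - (cmod (\<kappa> * X + \<mu> * Y))\<^sup>2 =
      2 * ((1 - (cmod \<kappa>)\<^sup>2) * (cmod X)\<^sup>2 + (1 - (cmod \<mu>)\<^sup>2) * (cmod Y)\<^sup>2)"
      by (simp only: of_real_eq_iff)
    moreover have "\<dots> > 0" using l2 XY0 by (intro mult_pos_pos add_pos_pos) auto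
    ultimately show ?thesis by linarith
  next
    case False
    then have a1: "(cmod \<alpha>)\<^sup>2 < 1" using \<alpha> by (simp add: abs_square_less_1)
    define p where "p = (\<kappa> - cnj \<alpha>) * X"
    define q where "q = (\<mu> - cnj \<alpha>) * Y"
    have "(1 - \<alpha> * cnj \<alpha>) * ((X + Y) * cnj (X + Y) - (\<kappa> * X + \<mu> * Y) * cnj (\<kappa> * X + \<mu> * Y)) =
      4 * ((X * cnj X) * (Y * cnj Y)) - (p + q) * cnj (p + q)"
      unfolding p_def q_def X_def Y_def complex_cnj_diff complex_cnj_add complex_cnj_mult
          complex_cnj_one complex_cnj_cnj by algebra
    then have "complex_of_real ((1 - (cmod \<alpha>)\<^sup>2) * ((cmod (X + Y))\<^sup>2 - (cmod (\<kappa> * X + \<mu> * Y))\<^sup>2)) =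
      of_real (4 * ((cmod X)\<^sup>2 * (cmod Y)\<^sup>2) - (cmod (p + q))\<^sup>2)"
      unfolding complex_norm_square[symmetric] by simp
    then have id: "(1 - (cmod \<alpha>)\<^sup>2) * ((cmod (X + Y))\<^sup>2 - (cmod (\<kappa> * X + \<mu> * Y))\<^sup>2) =
      4 * ((cmod X)\<^sup>2 * (cmod Y)\<^sup>2) - (cmod (p + q))\<^sup>2" by (simp only: of_real_eq_iff)
    have mob: "cmod (x - cnj \<alpha>) < cmod (1 - \<alpha> * x)" if x: "cmod x < 1" for x
    proof -
      have "(cmod (1 - \<alpha> * x))\<^sup>2 - (cmod (x - cnj \<alpha>))\<^sup>2 = (1 - (cmod \<alpha>)\<^sup>2) * (1 - (cmod x)\<^sup>2)"
        unfolding cmod_power2 by (simp add: algebra_simps power2_eq_square)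
      moreover have "\<dots> > 0" using a1 x by (intro mult_pos_pos) (auto simp: abs_square_less_1)
      ultimately have "(cmod (x - cnj \<alpha>))\<^sup>2 < (cmod (1 - \<alpha> * x))\<^sup>2" by linarith
      then show ?thesis by (rule power2_less_imp_less) simp
    qed
    have "cmod p < cmod Y * cmod X" unfolding p_def norm_mult using mob[OF l] XY0 by (simp add: Y_def)
    moreover have "cmod q < cmod X * cmod Y" unfolding q_def norm_mult using mob[OF m] XY0
        by (simp add: X_def)
    ultimately have "cmod (p + q) < 2 * (cmod X * cmod Y)" using norm_triangle_ineq[of p q]
        by (simp add: mult.commute)
    then have "(cmod (p + q))\<^sup>2 < (2 * (cmod X * cmod Y))\<^sup>2" by (intro power_strict_mono) auto
    then have "0 < (1 - (cmod \<alpha>)\<^sup>2) * ((cmod (X + Y))\<^sup>2 - (cmod (\<kappa> * X + \<mu> * Y))\<^sup>2)"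
      unfolding id by (simp add: power_mult_distrib)
    then show ?thesis using a1 by (simp add: zero_less_mult_iff)
  qed
  then have "cmod (\<kappa> * X + \<mu> * Y) < cmod (X + Y)" by (rule power2_less_imp_less) simp
  then show ?thesis unfolding sums by (simp only: norm_minus_cancel)
qed

lemma pentablock_Phi_less:
  assumes z: "z \<in> pentablock" and \<alpha>: "cmod \<alpha> \<le> 1"
  shows "cmod (Phi \<alpha> (c2 z) (c3 z)) < 1" "2 - \<alpha> * c2 z \<noteq> 0"
proof -
  obtain \<kappa> \<mu> where l: "cmod \<kappa> < 1" "cmod \<mu> < 1" "c2 z = \<kappa> + \<mu>" "c3 z = \<kappa> * \<mu>"
      using pentablock_roots[OF z] by metis
  have lt: "cmod (2 * \<alpha> * c3 z - c2 z) < cmod (2 - \<alpha> * c2 z)" using Phi_less_aux[OF l(1,2) \<alpha>] l by simp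
  then show "2 - \<alpha> * c2 z \<noteq> 0" by auto
  with lt show "cmod (Phi \<alpha> (c2 z) (c3 z)) < 1" by (simp add: Phi_def norm_divide)
qed

lemma continuous_on_Jpsi: "z \<in> pentablock \<Longrightarrow> continuous_on (cball 0 1) (Jpsi z)"
  unfolding Jpsi_def psi_def by (intro continuous_intros) (auto dest: pentablock_denominator)

lemma continuous_on_jPhi: "z \<in> pentablock \<Longrightarrow> continuous_on (cball 0 1) (jPhi z)"
  unfolding jPhi_def Phi_def by (intro continuous_intros) (auto dest: pentablock_Phi_less(2))

lemma uniform_strict_bound:
  assumes "continuous_on (cball 0 1) f" "\<And>\<alpha>. cmod \<alpha> \<le> 1 \<Longrightarrow> cmod (f \<alpha>) < 1"
  shows "\<exists>\<rho><1. \<forall>\<alpha>. cmod \<alpha> \<le> 1 \<longrightarrow> cmod (f \<alpha>) \<le> \<rho>"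
proof -
  have "\<exists>x\<in>cball (0::complex) 1. \<forall>y\<in>cball 0 1. cmod (f y) \<le> cmod (f x)"
    using assms(1) by (intro continuous_attains_sup) (auto intro!: continuous_intros)
  then obtain x where "x \<in> cball (0::complex) 1" "\<And>y. y \<in> cball 0 1 \<Longrightarrow> cmod (f y) \<le> cmod (f x)" by blast
  then show ?thesis using assms(2)[of x] by (intro exI[of _ "cmod (f x)"]) auto
qed

text \<open>For \<open>|a|\<^sup>2 < |p|\<close> a multiple of a Hermitian unitary of trace zero represents \<open>(a, 0, p)\<close>;
  otherwise an antidiagonal matrix does.\<close>

lemma pentablock_slice:
  assumes "(a, p) \<in> bidisc"
  shows "(a, 0, p) \<in> pentablock"
proof -
  have a: "cmod a < 1" and p: "cmod p < 1" using assms by (auto simp: bidisc_def)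
  show ?thesis
  proof (cases "(cmod a)\<^sup>2 < cmod p")
    case True
    define r where "r = cmod p"
    have r: "r > 0" "r < 1" "(cmod a)\<^sup>2 < r" using True p by (auto simp: r_def)
    define w where "w = csqrt (- p)"
    have w2: "w\<^sup>2 = - p" by (simp add: w_def)
    have nw: "(cmod w)\<^sup>2 = r" unfolding r_def norm_power[symmetric] w2 by simp
    define t where "t = sqrt (1 - (cmod a)\<^sup>2 / r)"
    have t2: "t\<^sup>2 = 1 - (cmod a)\<^sup>2 / r" using r by (simp add: t_def)
    define x where "x = w * of_real t"
    define b where "b = w\<^sup>2 * cnj a / of_real r"
    have x2: "x\<^sup>2 = - p * (1 - a * cnj a / of_real r)"
      unfolding x_def power_mult_distrib w2 of_real_power[symmetric] t2 using complex_norm_square[of a]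
          by simp
    have nx: "(cmod x)\<^sup>2 + (cmod a)\<^sup>2 = r" unfolding x_def norm_mult power_mult_distrib nw using r t2
        by (simp add: field_simps)
    have wr: "w * cnj w = of_real r" using complex_norm_square[of w] nw by simp
    have nb: "(cmod b)\<^sup>2 = (cmod a)\<^sup>2"
      unfolding b_def norm_divide norm_mult norm_power power_divide power_mult_distrib nw using r nw
          by (simp add: power2_eq_square)
    \<comment> \<open>The columns \<open>(x, a)\<close> and \<open>(b, -x)\<close> are orthogonal
      and, by \<open>nx\<close> and \<open>nb\<close>, of squared length \<open>r\<close>: the
      matrix is \<open>sqrt r\<close> times a unitary.\<close>
    have orth: "x * cnj b = cnj x * a"
    proof -
      have "x * cnj b = of_real t * (w * cnj w) * cnj w * a / of_real r"
          by (simp add: x_def b_def power2_eq_square mult_ac)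
      then show ?thesis unfolding wr x_def using r by (simp add: mult_ac)
    qed
    have bd: "(cmod (x * u + b * v))\<^sup>2 + (cmod (a * u + (- x) * v))\<^sup>2
        \<le> (sqrt r)\<^sup>2 * ((cmod u)\<^sup>2 + (cmod v)\<^sup>2)" for u v
    proof -
      have "complex_of_real ((cmod (x * u + b * v))\<^sup>2 + (cmod (a * u + (- x) * v))\<^sup>2) =
        (x * u + b * v) * cnj (x * u + b * v) + (a * u + (- x) * v) * cnj (a * u + (- x) * v)"
        unfolding complex_norm_square[symmetric] by simp
      also have "\<dots> = (x * cnj x + a * cnj a) * (u * cnj u) + (b * cnj b + x * cnj x) * (v * cnj v) 
         + (x * cnj b - cnj x * a) * u * cnj v + cnj (x * cnj b - cnj x * a) * cnj u * v"
        by (simp add: algebra_simps)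
      also have "\<dots> = complex_of_real (r * ((cmod u)\<^sup>2 + (cmod v)\<^sup>2))"
        unfolding orth complex_norm_square[symmetric] using nx nb
            by (simp add: algebra_simps flip: of_real_add of_real_power of_real_mult)
      finally show ?thesis using r by (simp only: of_real_eq_iff) simp
    qed
    have "(a, x + (- x), x * (- x) - b * a) \<in> pentablock"
      by (rule in_pentablock[OF bd]) (use r in auto)
    moreover have "x * (- x) - b * a = p"
      using x2 w2 r by (simp add: b_def power2_eq_square field_simps)
    ultimately show ?thesis by simp
  next
    case False
    \<comment> \<open>Here \<open>|p| <= |a|^2\<close>, so \<open>|b| <= |a|\<close>; and
      \<open>a = 0\<close> forces \<open>p = 0\<close>, which the default value respects.\<close>
    define b where "b = (if a = 0 then 0 else - p / a)"
    have p0: "a = 0 \<Longrightarrow> p = 0" using False by auto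
    have nb: "cmod b \<le> cmod a" 
      using False by (auto simp: b_def norm_divide divide_le_eq power2_eq_square)
    have bd: "(cmod (0 * u + b * v))\<^sup>2 + (cmod (a * u + 0 * v))\<^sup>2 \<le> (cmod a)\<^sup>2 * ((cmod u)\<^sup>2 + (cmod v)\<^sup>2)"
        for u v
    proof -
      have "(cmod b)\<^sup>2 * (cmod v)\<^sup>2 \<le> (cmod a)\<^sup>2 * (cmod v)\<^sup>2" using nb
          by (intro mult_right_mono power_mono) auto
      then show ?thesis by (simp add: norm_mult power_mult_distrib algebra_simps)
    qed
    have "(a, 0 + 0, 0 * 0 - b * a) \<in> pentablock" by (rule in_pentablock[OF bd]) (use a in auto)
    moreover have "0 * 0 - b * a = p" using p0 by (auto simp: b_def)
    ultimately show ?thesis by simp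
  qed
qed

section \<open>Admissible kernels in the first and third coordinates\<close>

lemma AK_c1: "k \<in> AK \<Longrightarrow> psd_on pentablock (\<lambda>z w. (1 - c1 z * cnj (c1 w)) * k z w)"
  unfolding AK_def by (auto dest!: bspec[of _ _ 0] simp: psi_def)

text \<open>With \<open>s = c2\<close> and \<open>p = c3\<close>, clearing the denominators of
  \<open>Phi\<close> at \<open>\<alpha> = 1\<close> and \<open>\<alpha> = -1\<close> leaves
  \<open>|2 - s|^2 - |2 p - s|^2\<close> and \<open>|2 + s|^2 - |2 p + s|^2\<close> in polarised
  form. Their sum is \<open>8 (1 - |p|^2)\<close>, whence the factor \<open>1/8\<close>.\<close>

lemma AK_c3:
  assumes k: "k \<in> AK"
  shows "psd_on pentablock (\<lambda>z w. (1 - c3 z * cnj (c3 w)) * k z w)"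
proof -
  have *: "psd_on pentablock (\<lambda>z w. ((2 - \<alpha> * c2 z) * cnj (2 - \<alpha> * c2 w) - (2 * \<alpha> * c3 z - c2 z)
      * cnj (2 * \<alpha> * c3 w - c2 w)) * k z w)"
    if \<alpha>: "cmod \<alpha> \<le> 1" for \<alpha>
  proof -
    have "psd_on pentablock (\<lambda>z w. (2 - \<alpha> * c2 z) * cnj (2 - \<alpha> * c2 w)
        * ((1 - Phi \<alpha> (c2 z) (c3 z) * cnj (Phi \<alpha> (c2 w) (c3 w))) * k z w))"
      by (intro psd_on_conj_mult) (use k \<alpha> in \<open>auto simp: AK_def\<close>)
    moreover have "(2 - \<alpha> * c2 z) * cnj (2 - \<alpha> * c2 w)
        * ((1 - Phi \<alpha> (c2 z) (c3 z) * cnj (Phi \<alpha> (c2 w) (c3 w))) * k z w) =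
       ((2 - \<alpha> * c2 z) * cnj (2 - \<alpha> * c2 w) - (2 * \<alpha> * c3 z - c2 z) * cnj (2 * \<alpha> * c3 w - c2 w)) * k z w"
      if "z \<in> pentablock" "w \<in> pentablock" for z w
    proof -
      have P: "Phi \<alpha> (c2 x) (c3 x) * (2 - \<alpha> * c2 x) = 2 * \<alpha> * c3 x - c2 x" if "x \<in> pentablock" for x
        using pentablock_Phi_less(2)[OF that \<alpha>] by (simp add: Phi_def)
      show ?thesis unfolding P[OF that(1), symmetric] P[OF that(2), symmetric] by (simp add: algebra_simps)
    qed
    ultimately show ?thesis by (subst psd_on_cong[symmetric]) auto
  qed
  have "psd_on pentablock (\<lambda>z w. of_real (1/8) * (
      ((2 - 1 * c2 z) * cnj (2 - 1 * c2 w) - (2 * 1 * c3 z - c2 z) * cnj (2 * 1 * c3 w - c2 w)) * k z w +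
      ((2 - (-1) * c2 z) * cnj (2 - (-1) * c2 w) - (2 * (-1) * c3 z - c2 z)
          * cnj (2 * (-1) * c3 w - c2 w)) * k z w))"
    by (intro psd_on_scale psd_on_add *) auto
  moreover have "of_real (1/8) * (
      ((2 - 1 * c2 z) * cnj (2 - 1 * c2 w) - (2 * 1 * c3 z - c2 z) * cnj (2 * 1 * c3 w - c2 w)) * k z w +
      ((2 - (-1) * c2 z) * cnj (2 - (-1) * c2 w) - (2 * (-1) * c3 z - c2 z)
          * cnj (2 * (-1) * c3 w - c2 w)) * k z w)
    = (1 - c3 z * cnj (c3 w)) * k z w" for z w
    by (simp add: algebra_simps)
  ultimately show ?thesis by simp
qed

text \<open>Ando's inequality for the row \<open>f\<close> and the vectors
  \<open>h l i = \<phi> l (p i) * cnj (c i)\<close>. By the Bezout identity the row returns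
  \<open>cnj (c i)\<close>, so the inequality reads \<open>\<epsilon>^2 T <= \<Sum> Tl\<close>,
  which is positivity of the required form at \<open>c\<close>.\<close>

lemma corona_imp_psd:
  fixes \<phi> f :: "nat \<Rightarrow> complex \<times> complex \<Rightarrow> complex"
  assumes \<epsilon>: "\<epsilon> > 0" and f: "\<And>i. i \<in> {1..n} \<Longrightarrow> f i \<in> Hinf bidisc"
    and bd: "\<And>z. z \<in> bidisc \<Longrightarrow> (\<Sum>i=1..n. (cmod (f i z))\<^sup>2) \<le> 1 / \<epsilon>\<^sup>2"
    and bezout: "\<And>z. z \<in> bidisc \<Longrightarrow> (\<Sum>i=1..n. \<phi> i z * f i z) = 1"
    and k: "k \<in> AK"
  shows "psd_on pentablock (\<lambda>z w. ((\<Sum>j=1..n. \<phi> j (c1 z, c3 z) * cnj (\<phi> j (c1 w, c3 w))) - (of_real \<epsilon>)\<^sup>2)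
      * k z w)"
proof (rule psd_onI)
  fix N :: nat and z :: "nat \<Rightarrow> cpoint" and c :: "nat \<Rightarrow> complex"
  assume z: "\<And>i. i \<in> {1..N} \<Longrightarrow> z i \<in> pentablock"
  define p where "p = (\<lambda>i. (c1 (z i), c3 (z i)))"
  define T where "T = (\<Sum>i=1..N. \<Sum>j=1..N. k (z i) (z j) * c j * cnj (c i))"
  define Tl where "Tl = (\<lambda>l. \<Sum>i=1..N. \<Sum>j=1..N. k (z i) (z j) * (c j * cnj (\<phi> l (p j)))
      * cnj (c i * cnj (\<phi> l (p i))))"
  have psd: "psd_on pentablock k" using k by (simp add: AK_def kernel_on_def)
  have T: "T \<in> \<real>\<^sub>\<ge>\<^sub>0" unfolding T_def by (rule psd_onD[OF psd z])
  have Tl: "Tl l \<in> \<real>\<^sub>\<ge>\<^sub>0" for l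
    unfolding Tl_def by (rule psd_onD[OF psd z, where c = "\<lambda>j. c j * cnj (\<phi> l (p j))"])
  have pb: "p i \<in> bidisc" if "i \<in> {1..N}" for i using pentablock_bidisc[OF z[OF that]] by (simp add: p_def)
  have "Re (\<Sum>i=1..N. \<Sum>j=1..N. k (z i) (z j) * (\<Sum>l=1..n. f l (c1 (z i), c3 (z i))
      * (\<phi> l (p i) * cnj (c i))) *
       cnj (\<Sum>l=1..n. f l (c1 (z j), c3 (z j)) * (\<phi> l (p j) * cnj (c j))))
    \<le> 1 / \<epsilon>\<^sup>2 * (\<Sum>l=1..n. Re (\<Sum>i=1..N. \<Sum>j=1..N. k (z i) (z j) * (\<phi> l (p i) * cnj (c i))
        * cnj (\<phi> l (p j) * cnj (c j))))"
  proof (rule ando_Hinf_bound[where F = f and b = "\<lambda>i. c1 (z i)" and d = "\<lambda>i. c3 (z i)"])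
    show "psd_on {1..N} (\<lambda>i j. k (z i) (z j))" by (rule psd_on_pullback[OF psd z])
    show "psd_on {1..N} (\<lambda>i j. (1 - c1 (z i) * cnj (c1 (z j))) * k (z i) (z j))"
      by (rule psd_on_pullback[OF AK_c1[OF k] z])
    show "psd_on {1..N} (\<lambda>i j. (1 - c3 (z i) * cnj (c3 (z j))) * k (z i) (z j))"
      by (rule psd_on_pullback[OF AK_c3[OF k] z])
    show "(c1 (z i), c3 (z i)) \<in> bidisc" if "i \<in> {1..N}" for i using pb[OF that] by (simp add: p_def)
  qed (use f bd in \<open>auto simp: sqnorm_def\<close>)
  also have "(\<Sum>i=1..N. \<Sum>j=1..N. k (z i) (z j) * (\<Sum>l=1..n. f l (c1 (z i), c3 (z i))
      * (\<phi> l (p i) * cnj (c i))) *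
       cnj (\<Sum>l=1..n. f l (c1 (z j), c3 (z j)) * (\<phi> l (p j) * cnj (c j)))) = T"
  proof -
    have "(\<Sum>l=1..n. f l (c1 (z i), c3 (z i)) * (\<phi> l (p i) * cnj (c i))) = cnj (c i)" if "i \<in> {1..N}" for i
    proof -
      have "(\<Sum>l=1..n. f l (p i) * (\<phi> l (p i) * cnj (c i))) = (\<Sum>l=1..n. \<phi> l (p i) * f l (p i)) * cnj (c i)"
        unfolding sum_distrib_right by (intro sum.cong refl) simp
      then show ?thesis using bezout[OF pb[OF that]] by (simp add: p_def)
    qed
    then show ?thesis unfolding T_def by (intro sum.cong refl) simp
  qed
  also have "(\<Sum>l=1..n. Re (\<Sum>i=1..N. \<Sum>j=1..N. k (z i) (z j) * (\<phi> l (p i) * cnj (c i))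
      * cnj (\<phi> l (p j) * cnj (c j)))) = Re (\<Sum>l=1..n. Tl l)"
    unfolding Re_sum[symmetric] Tl_def by (intro arg_cong[of _ _ Re] sum.cong refl) simp
  finally have le: "\<epsilon>\<^sup>2 * Re T \<le> Re (\<Sum>l=1..n. Tl l)" using \<epsilon> by (simp add: field_simps)
  have sumTl: "(\<Sum>l=1..n. Tl l) \<in> \<real>\<^sub>\<ge>\<^sub>0"
    using Tl by (auto simp: complex_nonneg_Reals_iff intro!: sum_nonneg sum.neutral)
  have "(\<Sum>i=1..N. \<Sum>j=1..N. ((\<Sum>l=1..n. \<phi> l (p i) * cnj (\<phi> l (p j))) - (of_real \<epsilon>)\<^sup>2) * k (z i) (z j) * c j
      * cnj (c i))
    = (\<Sum>l=1..n. Tl l) - (of_real \<epsilon>)\<^sup>2 * T"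
  proof -
    have "(\<Sum>l=1..n. Tl l) = (\<Sum>i=1..N. \<Sum>j=1..N. \<Sum>l=1..n. \<phi> l (p i) * cnj (\<phi> l (p j)) * k (z i) (z j)
        * c j * cnj (c i))"
      unfolding Tl_def sum.swap[of _ "{1..N}" "{1..n}"] by (intro sum.cong refl) simp
    then show ?thesis
      unfolding T_def by (simp add: left_diff_distrib sum_distrib_left sum_distrib_right sum_subtractf
          mult.assoc)
  qed
  also have "\<dots> \<in> \<real>\<^sub>\<ge>\<^sub>0"
    using le T sumTl by (auto simp: complex_nonneg_Reals_iff simp flip: of_real_power)
  finally show "(\<Sum>i=1..N. \<Sum>j=1..N. ((\<Sum>l=1..n. \<phi> l (c1 (z i), c3 (z i)) * cnj (\<phi> l (c1 (z j), c3 (z j))))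
      - (of_real \<epsilon>)\<^sup>2) * k (z i) (z j) * c j * cnj (c i)) \<in> \<real>\<^sub>\<ge>\<^sub>0"
    by (simp add: p_def)
qed

section \<open>Duality for the cone of kernels\<close>

definition frobenius :: "'a set \<Rightarrow> ('a \<Rightarrow> 'a \<Rightarrow> complex) \<Rightarrow> ('a \<Rightarrow> 'a \<Rightarrow> complex) \<Rightarrow> real" where
  "frobenius F R S = (\<Sum>z\<in>F. \<Sum>w\<in>F. Re (R z w * cnj (S z w)))"

lemma frobenius_commute: "frobenius F R S = frobenius F S R"
  by (simp add: frobenius_def mult.commute)

lemma frobenius_add_scale: "frobenius F (\<lambda>z w. R z w + of_real t * S z w) (\<lambda>z w. R z w
    + of_real t * S z w) =
   frobenius F R R + 2 * t * frobenius F R S + t\<^sup>2 * frobenius F S S"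
  by (simp add: frobenius_def sum_distrib_left algebra_simps power2_eq_square flip: sum.distrib)

lemma frobenius_scale: "frobenius F R (\<lambda>z w. of_real t * S z w) = t * frobenius F R S"
  by (simp add: frobenius_def sum_distrib_left algebra_simps)

lemma frobenius_self: "frobenius F R R = (\<Sum>z\<in>F. \<Sum>w\<in>F. (cmod (R z w))\<^sup>2)"
  unfolding frobenius_def complex_norm_square[symmetric] by simp

lemma frobenius_nonneg: "frobenius F R R \<ge> 0"
  unfolding frobenius_self by (intro sum_nonneg) auto

section \<open>Separation from the cone of kernels\<close>

text \<open>The length \<open>m\<close> is unrestricted, which makes this a convex cone. It is not
  claimed to be closed; membership is replaced by approximation on finite sets.\<close>

definition szego_cone :: "'j set \<Rightarrow> ('j \<Rightarrow> 'a \<Rightarrow> complex) \<Rightarrow> ('a \<Rightarrow> 'a \<Rightarrow> complex) set" where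
  "szego_cone J g = {\<lambda>z w. \<Sum>k<m. v k z * cnj (v k w)
      * (1 - g (j k) z * cnj (g (j k) w)) | (m::nat) v j. \<forall>k. j k \<in> J}"

lemma szego_cone_zero: "J \<noteq> {} \<Longrightarrow> (\<lambda>z w. 0) \<in> szego_cone J g"
  unfolding szego_cone_def by (auto intro!: exI[of _ 0])

lemma szego_cone_scale:
  assumes "c \<in> szego_cone J g" "t \<ge> 0"
  shows "(\<lambda>z w. of_real t * c z w) \<in> szego_cone J g"
proof -
  obtain m v j where c: "c = (\<lambda>z w. \<Sum>k<(m::nat). v k z * cnj (v k w)
      * (1 - g (j k) z * cnj (g (j k) w)))" "\<forall>k. j k \<in> J"
    using assms(1) unfolding szego_cone_def by auto
  have sq: "complex_of_real (sqrt t) * of_real (sqrt t) = of_real t" using assms(2)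
      by (simp flip: of_real_mult)
  have "(\<lambda>z w. of_real t * c z w) = (\<lambda>z w. \<Sum>k<m. (of_real (sqrt t) * v k z)
      * cnj (of_real (sqrt t) * v k w) * (1 - g (j k) z * cnj (g (j k) w)))"
    unfolding c sum_distrib_left by (intro ext sum.cong refl) (simp add: sq[symmetric] mult_ac)
  then show ?thesis unfolding szego_cone_def using c(2)
      by (auto intro!: exI[of _ m] exI[of _ "\<lambda>k z. of_real (sqrt t) * v k z"] exI[of _ j])
qed

lemma szego_cone_add:
  assumes "c \<in> szego_cone J g" "c' \<in> szego_cone J g"
  shows "(\<lambda>z w. c z w + c' z w) \<in> szego_cone J g"
proof -
  obtain m v j where c: "c = (\<lambda>z w. \<Sum>k<(m::nat). v k z * cnj (v k w)
      * (1 - g (j k) z * cnj (g (j k) w)))" "\<forall>k. j k \<in> J"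
    using assms(1) unfolding szego_cone_def by auto
  obtain m' v' j' where c': "c' = (\<lambda>z w. \<Sum>k<(m'::nat). v' k z * cnj (v' k w)
      * (1 - g (j' k) z * cnj (g (j' k) w)))" "\<forall>k. j' k \<in> J"
    using assms(2) unfolding szego_cone_def by auto
  define V where "V = (\<lambda>k. if k < m then v k else v' (k - m))"
  define I where "I = (\<lambda>k. if k < m then j k else j' (k - m))"
  have split: "(\<Sum>k<m + m'. f k) = (\<Sum>k<m. f k) + (\<Sum>k<m'. f (m + k))" for f :: "nat \<Rightarrow> complex"
    by (induction m') (auto simp: algebra_simps)
  have "(\<lambda>z w. c z w + c' z w) = (\<lambda>z w. \<Sum>k<m + m'. V k z * cnj (V k w) * (1 - g (I k) z * cnj (g (I k) w)))"
    unfolding c c' split by (simp add: V_def I_def)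
  moreover have "\<forall>k. I k \<in> J" using c c' by (simp add: I_def)
  ultimately show ?thesis unfolding szego_cone_def by blast
qed

lemma szego_cone_generator:
  assumes "j \<in> J"
  shows "(\<lambda>z w. v z * cnj (v w) * (1 - g j z * cnj (g j w))) \<in> szego_cone J g"
  unfolding szego_cone_def using assms by (auto intro!: exI[of _ "Suc 0"] exI[of _ "\<lambda>_. v"] exI[of _
      "\<lambda>_. j"])

lemma szego_cone_hermitian:
  assumes "c \<in> szego_cone J g" shows "c w z = cnj (c z w)"
  using assms unfolding szego_cone_def by (auto simp: mult_ac)

lemma generator_norm_bound:
  assumes fin: "finite F" and g: "\<And>z. z \<in> F \<Longrightarrow> cmod (g z) \<le> 1"
  shows "frobenius F (\<lambda>z w. v z * cnj (v w) * (1 - g z * cnj (g w))) (\<lambda>z w. v z * cnj (v w)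
      * (1 - g z * cnj (g w)))
    \<le> 4 * (\<Sum>z\<in>F. (cmod (v z))\<^sup>2)\<^sup>2"
proof -
  have "frobenius F (\<lambda>z w. v z * cnj (v w) * (1 - g z * cnj (g w))) (\<lambda>z w. v z * cnj (v w)
      * (1 - g z * cnj (g w)))
    \<le> (\<Sum>z\<in>F. \<Sum>w\<in>F. 4 * ((cmod (v z))\<^sup>2 * (cmod (v w))\<^sup>2))"
    unfolding frobenius_self
  proof (intro sum_mono)
    fix z w assume "z \<in> F" "w \<in> F"
    then have "cmod (g z) * cmod (g w) \<le> 1 * 1" by (intro mult_mono g) auto
    then have "cmod (1 - g z * cnj (g w)) \<le> 2"
      using norm_triangle_ineq4[of 1 "g z * cnj (g w)"] by (simp add: norm_mult)
    then have "(cmod (1 - g z * cnj (g w)))\<^sup>2 \<le> 2\<^sup>2" by (intro power_mono) auto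
    then have "(cmod (v z))\<^sup>2 * (cmod (v w))\<^sup>2 * (cmod (1 - g z * cnj (g w)))\<^sup>2
        \<le> (cmod (v z))\<^sup>2 * (cmod (v w))\<^sup>2 * 2\<^sup>2"
      by (intro mult_left_mono) auto
    then show "(cmod (v z * cnj (v w) * (1 - g z * cnj (g w))))\<^sup>2 \<le> 4 * ((cmod (v z))\<^sup>2 * (cmod (v w))\<^sup>2)"
      by (simp add: norm_mult power_mult_distrib)
  qed
  also have "\<dots> = 4 * (\<Sum>z\<in>F. (cmod (v z))\<^sup>2)\<^sup>2"
    unfolding power2_eq_square[of "\<Sum>z\<in>F. (cmod (v z))\<^sup>2"] sum_product by (simp only: sum_distrib_left)
  finally show ?thesis .
qed

text \<open>For a near-minimiser \<open>c\<close> of the distance from \<open>B\<close> to the cone, \<open>B - c\<close> is almost negative on the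
  cone; adding a small multiple of the identity kernel to \<open>c - B\<close> gives an exactly admissible test kernel.
  In this way no compactness of the set of generators is needed.\<close>

lemma szego_cone_approx:
  fixes B :: "'a \<Rightarrow> 'a \<Rightarrow> complex" and g :: "'j \<Rightarrow> 'a \<Rightarrow> complex"
  assumes fin: "finite F" and FX: "F \<subseteq> X" and J: "J \<noteq> {}"
    and g: "\<And>j z. j \<in> J \<Longrightarrow> z \<in> X \<Longrightarrow> cmod (g j z) \<le> \<rho> z" and \<rho>: "\<And>z. z \<in> X \<Longrightarrow> \<rho> z < 1"
    and herm: "\<And>z w. z \<in> X \<Longrightarrow> w \<in> X \<Longrightarrow> B w z = cnj (B z w)"
    and dual: "\<And>K. kernel_on X K \<Longrightarrow> (\<And>j. j \<in> J \<Longrightarrow> psd_on X (\<lambda>z w. (1 - g j z * cnj (g j w)) * K z w)) \<Longrightarrow>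
       psd_on X (\<lambda>z w. B z w * K z w)"
    and \<delta>: "\<delta> > 0"
  shows "\<exists>c\<in>szego_cone J g. \<forall>z\<in>F. \<forall>w\<in>F. cmod (B z w - c z w) \<le> \<delta>"
proof -
  define dist2 where "dist2 = (\<lambda>c. frobenius F (\<lambda>z w. B z w - c z w) (\<lambda>z w. B z w - c z w))"
  define d where "d = (INF c\<in>szego_cone J g. dist2 c)"
  have ne: "szego_cone J g \<noteq> {}" using szego_cone_zero[OF J] by auto
  have d_le: "d \<le> dist2 c" if "c \<in> szego_cone J g" for c
    unfolding d_def using that by (intro cINF_lower bdd_belowI[of _ 0])
        (auto simp: dist2_def frobenius_nonneg)
  have near: "\<exists>c\<in>szego_cone J g. dist2 c < y" if "d < y" for y
    using cInf_lessD[of "dist2 ` szego_cone J g" y] ne that by (auto simp: d_def)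
  \<comment> \<open>On the finite set \<open>F\<close> the functions stay away from modulus 1
    uniformly in \<open>j\<close>. This margin \<open>m\<close> bounds the diagonal
    \<open>1 - |g j z|^2\<close> from below and decides how much identity kernel has to be
    added.\<close>
  have "\<exists>m>0. \<forall>z\<in>F. \<forall>j\<in>J. (cmod (g j z))\<^sup>2 \<le> 1 - m"
    using fin FX
  proof (induction F rule: finite_induct)
    case empty then show ?case by (auto intro: exI[of _ 1])
  next
    case (insert x F)
    then obtain m where m: "m > 0" "\<forall>z\<in>F. \<forall>j\<in>J. (cmod (g j z))\<^sup>2 \<le> 1 - m" by auto
    have x: "x \<in> X" using insert by auto
    obtain j0 where "j0 \<in> J" using J by auto
    then have r0: "0 \<le> \<rho> x" using g[OF _ x] norm_ge_zero order_trans by blast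
    then have "(\<rho> x)\<^sup>2 < 1" using \<rho>[OF x] by (simp add: abs_square_less_1)
    moreover have "(cmod (g j x))\<^sup>2 \<le> (\<rho> x)\<^sup>2" if "j \<in> J" for j
      using g[OF that x] by (intro power_mono) auto
    ultimately show ?case using m by (intro exI[of _ "min m (1 - (\<rho> x)\<^sup>2)"]) (auto simp: min_def, force+)
  qed
  then obtain m where m: "m > 0" and gm: "\<And>z j. z \<in> F \<Longrightarrow> j \<in> J \<Longrightarrow> (cmod (g j z))\<^sup>2 \<le> 1 - m" by blast
  have gX: "cmod (g j z) < 1" if "j \<in> J" "z \<in> X" for j z using g[OF that] \<rho>[OF that(2)] by simp
  define M where "M = 2 * frobenius F B B + 2 * (d + 1)"
  define tr where "tr = (\<Sum>z\<in>F. Re (B z z))"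
  have key: "d \<le> \<eta> * ((1 + M) / 2 + 5 / m * tr)" if \<eta>: "0 < \<eta>" "\<eta> \<le> 1" for \<eta>
  proof -
    \<comment> \<open>The excess \<open>\<eta>^2\<close> matches the second-order term of a
      perturbation of size \<open>\<eta>\<close>, so the first-order conditions \<open>dir\<close>
      and \<open>rad\<close> hold up to an error of order \<open>\<eta>\<close>.\<close>
    have "d < d + \<eta>\<^sup>2" using \<eta> by simp
    then obtain c where c: "c \<in> szego_cone J g" "dist2 c < d + \<eta>\<^sup>2"
      using near by blast
    define R where "R = (\<lambda>z w. B z w - c z w)"
    have RR: "frobenius F R R < d + \<eta>\<^sup>2" using c(2) by (simp add: dist2_def R_def)
    have dir: "frobenius F R s \<le> \<eta> / 2 * (1 + frobenius F s s)" if s: "s \<in> szego_cone J g" for s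
    proof -
      have "(\<lambda>z w. c z w + of_real \<eta> * s z w) \<in> szego_cone J g"
        using \<eta> by (intro szego_cone_add c szego_cone_scale s) auto
      from d_le[OF this] have "d \<le> frobenius F (\<lambda>z w. R z w + of_real (- \<eta>) * s z w) (\<lambda>z w. R z w
          + of_real (- \<eta>) * s z w)"
        by (simp add: dist2_def R_def algebra_simps)
      also have "\<dots> = frobenius F R R - 2 * \<eta> * frobenius F R s + \<eta>\<^sup>2 * frobenius F s s"
          unfolding frobenius_add_scale by simp
      finally have "\<eta> * (2 * frobenius F R s) \<le> \<eta> * (\<eta> * (1 + frobenius F s s))" using RR
          by (simp add: algebra_simps power2_eq_square)
      then show ?thesis using \<eta> by (simp add: mult_le_cancel_left_pos)
    qed
    have rad: "- frobenius F R c \<le> \<eta> / 2 * (1 + frobenius F c c)"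
    proof -
      have "(\<lambda>z w. of_real (1 - \<eta>) * c z w) \<in> szego_cone J g" using \<eta> by (intro szego_cone_scale c) auto
      from d_le[OF this] have "d \<le> frobenius F (\<lambda>z w. R z w + of_real \<eta> * c z w) (\<lambda>z w. R z w
          + of_real \<eta> * c z w)"
        by (simp add: dist2_def R_def algebra_simps)
      also have "\<dots> = frobenius F R R + 2 * \<eta> * frobenius F R c + \<eta>\<^sup>2 * frobenius F c c"
          unfolding frobenius_add_scale by simp
      finally have "\<eta> * (- 2 * frobenius F R c) \<le> \<eta> * (\<eta> * (1 + frobenius F c c))" using RR
          by (simp add: algebra_simps power2_eq_square)
      then have "- 2 * frobenius F R c \<le> \<eta> * (1 + frobenius F c c)" using \<eta>(1)
          by (simp only: mult_le_cancel_left_pos)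
      then show ?thesis by simp
    qed
    \<comment> \<open>Parallelogram inequality; \<open>\<eta> <= 1\<close> accounts for the
      \<open>d + 1\<close> in \<open>M\<close>.\<close>
    have cc: "frobenius F c c \<le> M"
    proof -
      have cB: "c = (\<lambda>z w. B z w + of_real (-1) * R z w)" by (simp add: R_def)
      have "frobenius F c c = frobenius F B B + 2 * (-1) * frobenius F B R + (-1)\<^sup>2 * frobenius F R R"
        using frobenius_add_scale[of F B "-1" R] unfolding cB[symmetric] .
      moreover have "0 \<le> frobenius F B B + 2 * 1 * frobenius F B R + 1\<^sup>2 * frobenius F R R"
        unfolding frobenius_add_scale[symmetric] by (rule frobenius_nonneg)
      moreover have "\<eta>\<^sup>2 \<le> 1" using \<eta> by (simp add: power_le_one)
      ultimately show ?thesis using RR by (simp add: M_def)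
    qed
    \<comment> \<open>For a generator with \<open>n = 1\<close>, \<open>dir\<close> and
      \<open>frobenius F s s <= 4\<close> bound the pairing by \<open>\<eta> / 2 * (1 + 4)\<close>;
      \<open>\<tau> * m\<close> is exactly this number.\<close>
    define \<tau> where "\<tau> = 5 * \<eta> / (2 * m)"
    have \<tau>: "\<tau> > 0" using \<eta> m by (simp add: \<tau>_def)
    define \<Delta> where "\<Delta> = (\<lambda>z w :: 'a. if z = w then complex_of_real \<tau> else 0)"
    \<comment> \<open>The conjugate makes \<open>\<Sum> B z w * K z w\<close> a Frobenius pairing
      with \<open>R\<close>. The identity part lives on all of \<open>X\<close>, so that points
      outside \<open>F\<close> are covered as well.\<close>
    define k1 where "k1 = (\<lambda>z w. (if z \<in> F \<and> w \<in> F then cnj (- R z w) else 0) + \<Delta> z w)"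
    have psdF: "psd_on F (\<lambda>z w. (1 - g j z * cnj (g j w)) * (cnj (- R z w) + \<Delta> z w))" if j: "j \<in> J" for j
    proof (rule psd_on_setI[OF fin])
      fix a :: "'a \<Rightarrow> complex"
      define v where "v = (\<lambda>z. cnj (a z))"
      define s where "s = (\<lambda>z w. v z * cnj (v w) * (1 - g j z * cnj (g j w)))"
      define n where "n = (\<Sum>z\<in>F. (cmod (a z))\<^sup>2)"
      have s: "s \<in> szego_cone J g" unfolding s_def by (rule szego_cone_generator[OF j])
      have ss: "frobenius F s s \<le> 4 * n\<^sup>2"
        unfolding s_def n_def using generator_norm_bound[OF fin, of "g j" v] gX[OF j] FX
            by (force simp: v_def)
      have Rs: "frobenius F R s \<le> 5 / 2 * \<eta> * n"
      proof (cases "n = 0")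
        case True
        then have "a z = 0" if "z \<in> F" for z using that fin by (simp add: n_def sum_nonneg_eq_0_iff)
        then have "frobenius F R s = 0" unfolding frobenius_def s_def v_def
            by (intro sum.neutral ballI) simp
        then show ?thesis using True by simp
      next
        case False
        then have n0: "n > 0" by (simp add: n_def sum_nonneg order_less_le)
        \<comment> \<open>\<open>dir\<close> is not homogeneous; applied to \<open>s / n\<close> it
          gives a bound that scales like \<open>n\<close>.\<close>
        have "frobenius F R (\<lambda>z w. of_real (1 / n) * s z w)
            \<le> \<eta> / 2 * (1 + frobenius F (\<lambda>z w. of_real (1 / n) * s z w) (\<lambda>z w. of_real (1 / n) * s z w))"
          using n0 by (intro dir szego_cone_scale s) auto
        also have "frobenius F (\<lambda>z w. of_real (1 / n) * s z w) (\<lambda>z w. of_real (1 / n) * s z w)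
            = (1 / n)\<^sup>2 * frobenius F s s"
          using frobenius_scale[of F s "1/n" s] frobenius_scale[of F "\<lambda>z w. of_real (1 / n) * s z w"
              "1/n" s]
          by (simp add: frobenius_commute power2_eq_square)
        also have "\<dots> \<le> (1 / n)\<^sup>2 * (4 * n\<^sup>2)" by (intro mult_left_mono ss) auto
        also have "\<dots> = 4" using n0 by (simp add: power2_eq_square)
        finally have "1 / n * frobenius F R s \<le> \<eta> / 2 * (1 + 4)" unfolding frobenius_scale using \<eta> by simp
        then show ?thesis using n0 by (simp add: field_simps)
      qed
      define Sg where "Sg = (\<Sum>z\<in>F. \<Sum>w\<in>F. (1 - g j z * cnj (g j w)) * (cnj (- R z w)
          + \<Delta> z w) * a w * cnj (a z))"
      have split: "Sg = - (\<Sum>z\<in>F. \<Sum>w\<in>F. cnj (R z w) * s z w)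
          + (\<Sum>z\<in>F. of_real (\<tau> * (1 - (cmod (g j z))\<^sup>2) * (cmod (a z))\<^sup>2))"
      proof -
        have "Sg = - (\<Sum>z\<in>F. \<Sum>w\<in>F. cnj (R z w) * s z w) + (\<Sum>z\<in>F. \<Sum>w\<in>F. \<Delta> z w * s z w)"
          unfolding Sg_def sum_negf[symmetric] sum.distrib[symmetric]
          by (intro sum.cong refl) (simp add: s_def v_def algebra_simps)
        also have "(\<Sum>z\<in>F. \<Sum>w\<in>F. \<Delta> z w * s z w) = (\<Sum>z\<in>F. \<Sum>w\<in>F. if z = w then of_real \<tau> * s z z else 0)"
          by (intro sum.cong refl) (simp add: \<Delta>_def)
        also have "\<dots> = (\<Sum>z\<in>F. of_real \<tau> * s z z)" using fin by simp
        also have "\<dots> = (\<Sum>z\<in>F. of_real (\<tau> * (1 - (cmod (g j z))\<^sup>2) * (cmod (a z))\<^sup>2))"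
        proof (intro sum.cong refl)
          fix z
          have "s z z = (a z * cnj (a z)) * (1 - g j z * cnj (g j z))" by (simp add: s_def v_def mult_ac)
          also have "\<dots> = of_real ((cmod (a z))\<^sup>2 * (1 - (cmod (g j z))\<^sup>2))"
              unfolding complex_norm_square[symmetric] by simp
          finally show "of_real \<tau> * s z z = of_real (\<tau> * (1 - (cmod (g j z))\<^sup>2) * (cmod (a z))\<^sup>2)" by simp
        qed
        finally show ?thesis .
      qed
      have Rh: "R w z = cnj (R z w)" if "z \<in> F" "w \<in> F" for z w
        using herm[of z w] szego_cone_hermitian[OF c(1), of w z] that FX by (auto simp: R_def)
      have "cnj (\<Sum>z\<in>F. \<Sum>w\<in>F. cnj (R z w) * s z w) = (\<Sum>z\<in>F. \<Sum>w\<in>F. cnj (R w z) * s w z)"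
        unfolding cnj_sum
      proof (intro sum.cong refl)
        fix z w assume zw: "z \<in> F" "w \<in> F"
        show "cnj (cnj (R z w) * s z w) = cnj (R w z) * s w z"
          unfolding Rh[OF zw] szego_cone_hermitian[OF s, of w z] by simp
      qed
      also have "\<dots> = (\<Sum>z\<in>F. \<Sum>w\<in>F. cnj (R z w) * s z w)" by (rule sum.swap)
      finally have sa: "cnj (\<Sum>z\<in>F. \<Sum>w\<in>F. cnj (R z w) * s z w) = (\<Sum>z\<in>F. \<Sum>w\<in>F. cnj (R z w) * s z w)" .
      have "Im x = 0" if "cnj x = x" for x using arg_cong[OF that, of Im] by simp
      note im = this[OF sa]
      have re: "Re (\<Sum>z\<in>F. \<Sum>w\<in>F. cnj (R z w) * s z w) = frobenius F R s" by (simp add: frobenius_def)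
      have "5 / 2 * \<eta> * n = (\<Sum>z\<in>F. \<tau> * m * (cmod (a z))\<^sup>2)"
        using m by (simp add: \<tau>_def n_def sum_distrib_left)
      also have "\<dots> \<le> (\<Sum>z\<in>F. \<tau> * (1 - (cmod (g j z))\<^sup>2) * (cmod (a z))\<^sup>2)"
        using gm[OF _ j] \<tau> by (intro sum_mono mult_right_mono mult_left_mono) force+
      finally have "0 \<le> Re Sg" unfolding split using Rs re by simp
      moreover have "Im Sg = 0" unfolding split using im by simp
      ultimately show "(\<Sum>z\<in>F. \<Sum>w\<in>F. (1 - g j z * cnj (g j w)) * (cnj (- R z w)
          + \<Delta> z w) * a w * cnj (a z)) \<in> \<real>\<^sub>\<ge>\<^sub>0"
        unfolding Sg_def[symmetric] by (simp add: complex_nonneg_Reals_iff)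
    qed
    have psd1: "psd_on X (\<lambda>z w. (1 - g j z * cnj (g j w)) * k1 z w)" if j: "j \<in> J" for j
    proof -
      have "psd_on X (\<lambda>z w. (if z \<in> F \<and> w \<in> F then (1 - g j z * cnj (g j w)) * (cnj (- R z w)
          + \<Delta> z w) else 0)
         + (if z = w then of_real (if z \<in> F then 0 else \<tau> * (1 - (cmod (g j z))\<^sup>2)) else 0))"
        using \<tau> gX[OF j] by (intro psd_on_add psd_on_extend_zero psdF j psd_on_delta)
            (auto simp: abs_square_le_1 less_imp_le)
      moreover have "(if z \<in> F \<and> w \<in> F then (1 - g j z * cnj (g j w)) * (cnj (- R z w) + \<Delta> z w) else 0)
         + (if z = w then of_real (if z \<in> F then 0 else \<tau> * (1 - (cmod (g j z))\<^sup>2)) else 0)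
             = (1 - g j z * cnj (g j w)) * k1 z w" for z w
        unfolding k1_def \<Delta>_def using complex_norm_square[of "g j z"] by auto
      ultimately show ?thesis by simp
    qed
    have psdD: "psd_on X (\<lambda>z w. (1 - g j z * cnj (g j w)) * \<Delta> z w)" if j: "j \<in> J" for j
    proof -
      have "psd_on X (\<lambda>z w. if z = w then of_real (\<tau> * (1 - (cmod (g j z))\<^sup>2)) else 0)"
        using \<tau> gX[OF j] by (intro psd_on_delta) (auto simp: abs_square_le_1 less_imp_le)
      moreover have "(if z = w then complex_of_real (\<tau> * (1 - (cmod (g j z))\<^sup>2)) else 0)
          = (1 - g j z * cnj (g j w)) * \<Delta> z w" for z w
        unfolding \<Delta>_def using complex_norm_square[of "g j z"] by auto
      ultimately show ?thesis by simp
    qed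
    \<comment> \<open>The diagonal of \<open>k1\<close> is only known to be nonnegative; a second
      copy of \<open>\<Delta>\<close> makes it nonzero.\<close>
    define K where "K = (\<lambda>z w. k1 z w + \<Delta> z w)"
    obtain j0 where j0: "j0 \<in> J" using J by auto
    have psdk1: "psd_on X k1" by (rule psd_on_szego_divide[OF psd1[OF j0] gX[OF j0]])
    have psdDD: "psd_on X \<Delta>" by (rule psd_on_szego_divide[OF psdD[OF j0] gX[OF j0]])
    have "psd_on X K" unfolding K_def by (intro psd_on_add psdk1 psdDD)
    moreover have "K z z \<noteq> 0" if "z \<in> X" for z
      using psd_on_diag[OF psdk1 that] \<tau> by (auto simp: K_def \<Delta>_def complex_nonneg_Reals_iff complex_eq_iff)
    ultimately have "kernel_on X K" by (simp add: kernel_on_def)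
    moreover have "psd_on X (\<lambda>z w. (1 - g j z * cnj (g j w)) * K z w)" if "j \<in> J" for j
      unfolding K_def distrib_left by (intro psd_on_add psd1 psdD that)
    ultimately have "psd_on X (\<lambda>z w. B z w * K z w)" by (rule dual)
    from psd_on_setD[OF this fin FX, of "\<lambda>_. 1"] have "0 \<le> Re (\<Sum>z\<in>F. \<Sum>w\<in>F. B z w * K z w)"
      by (simp add: complex_nonneg_Reals_iff)
    also have "(\<Sum>z\<in>F. \<Sum>w\<in>F. B z w * K z w) = - (\<Sum>z\<in>F. \<Sum>w\<in>F. B z w * cnj (R z w))
        + (\<Sum>z\<in>F. \<Sum>w\<in>F. if z = w then 2 * of_real \<tau> * B z z else 0)"
      unfolding sum_negf[symmetric] sum.distrib[symmetric] K_def k1_def \<Delta>_def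
          by (intro sum.cong refl) (auto simp: algebra_simps)
    also have "(\<Sum>z\<in>F. \<Sum>w\<in>F. if z = w then 2 * of_real \<tau> * B z z else 0) = (\<Sum>z\<in>F. 2 * of_real \<tau> * B z z)"
        using fin by simp
    finally have "frobenius F B R \<le> 2 * \<tau> * tr" by (simp add: frobenius_def tr_def sum_distrib_left)
    \<comment> \<open>Duality bounds the left side by \<open>2 \<tau> tr\<close>, of order
      \<open>\<eta>\<close>. On the right the first term is at least \<open>d\<close> and
      \<open>rad\<close> controls the second, so \<open>d\<close> itself is of order
      \<open>\<eta>\<close>.\<close>
    moreover have "frobenius F B R = frobenius F R R + frobenius F R c"
    proof -
      have "frobenius F B R = frobenius F (\<lambda>z w. R z w + c z w) R" by (simp add: R_def)
      also have "\<dots> = frobenius F R R + frobenius F c R"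
          by (simp add: frobenius_def distrib_right sum.distrib)
      finally show ?thesis by (simp add: frobenius_commute)
    qed
    moreover have "d \<le> frobenius F R R" using d_le[OF c(1)] by (simp add: dist2_def R_def)
    moreover have "\<eta> / 2 * (1 + frobenius F c c) \<le> \<eta> / 2 * (1 + M)" using cc \<eta>
        by (intro mult_left_mono) auto
    ultimately have "d \<le> \<eta> / 2 * (1 + M) + 2 * \<tau> * tr" using rad by linarith
    then show ?thesis by (simp add: \<tau>_def algebra_simps)
  qed
  have "((\<lambda>\<eta>. \<eta> * ((1 + M) / 2 + 5 / m * tr)) \<longlongrightarrow> 0 * ((1 + M) / 2 + 5 / m * tr)) (at_right 0)"
    by (intro tendsto_intros)
  moreover have "\<forall>\<^sub>F \<eta> in at_right 0. d \<le> \<eta> * ((1 + M) / 2 + 5 / m * tr)"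
    by (rule eventually_at_rightI[of 0 1], rule key) auto
  ultimately have "d \<le> 0 * ((1 + M) / 2 + 5 / m * tr)" by (intro tendsto_lowerbound) auto
  then have "d < \<delta>\<^sup>2" using \<delta> by (simp add: le_less_trans)
  then obtain c where c: "c \<in> szego_cone J g" "dist2 c < \<delta>\<^sup>2"
    using near by blast
  have "cmod (B z w - c z w) \<le> \<delta>" if zw: "z \<in> F" "w \<in> F" for z w
  proof -
    have "(cmod (B z w - c z w))\<^sup>2 \<le> (\<Sum>w\<in>F. (cmod (B z w - c z w))\<^sup>2)"
      using zw fin by (intro member_le_sum[of w F "\<lambda>w. (cmod (B z w - c z w))\<^sup>2"]) auto
    also have "\<dots> \<le> dist2 c" unfolding dist2_def frobenius_self
      using zw fin by (intro member_le_sum[of z F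
          "\<lambda>z. \<Sum>w\<in>F. (cmod (B z w - c z w))\<^sup>2"]) (auto intro: sum_nonneg)
    finally have "(cmod (B z w - c z w))\<^sup>2 \<le> \<delta>\<^sup>2" using c by simp
    then show ?thesis by (rule power2_le_imp_le) (use \<delta> in simp)
  qed
  then show ?thesis using c by blast
qed

section \<open>Compactness and the representing functional\<close>

lemma compact_bounded_functions:
  "compact {f :: 'p \<Rightarrow> complex. \<forall>p. cmod (f p) \<le> r p}"
proof -
  have eq: "{f :: 'p \<Rightarrow> complex. \<forall>p. cmod (f p) \<le> r p} = PiE UNIV (\<lambda>p. cball 0 (r p))"
      by (auto simp: PiE_UNIV_domain)
  have "compactin (product_topology (\<lambda>_::'p. euclidean) UNIV) (PiE UNIV (\<lambda>p. cball (0::complex) (r p)))"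
    unfolding compactin_PiE by simp
  then show ?thesis unfolding eq euclidean_product_topology by simp
qed

lemma finite_intersection_functions:
  fixes E :: "'i \<Rightarrow> ('p \<Rightarrow> complex) set"
  assumes S: "closed S" "\<And>f p. f \<in> S \<Longrightarrow> cmod (f p) \<le> r p"
    and E: "\<And>i. i \<in> I \<Longrightarrow> closed (E i)"
    and fip: "\<And>I'. finite I' \<Longrightarrow> I' \<subseteq> I \<Longrightarrow> \<exists>f\<in>S. \<forall>i\<in>I'. f \<in> E i"
  shows "\<exists>f\<in>S. \<forall>i\<in>I. f \<in> E i"
proof -
  have "S = {f. \<forall>p. cmod (f p) \<le> r p} \<inter> S" using S(2) by auto
  then have "compact S" using compact_Int_closed[OF compact_bounded_functions S(1)] by metis
  then have "S \<inter> (\<Inter>i\<in>I. E i) \<noteq> {}"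
  proof (rule compact_imp_fip_image[OF _ E])
    fix I' assume "finite I'" "I' \<subseteq> I"
    then obtain f where "f \<in> S" "\<forall>i\<in>I'. f \<in> E i" using fip by blast
    then show "S \<inter> (\<Inter>i\<in>I'. E i) \<noteq> {}" by auto
  qed
  then show ?thesis by auto
qed

lemma continuous_on_eval: "continuous_on A (\<lambda>f :: 'p \<Rightarrow> complex. f p)"
  using continuous_on_product_coordinates[of p, THEN continuous_on_subset] by blast

lemma bounded_image_mult:
  fixes f h :: "'j \<Rightarrow> complex"
  assumes "bounded (f ` J)" "bounded (h ` J)"
  shows "bounded ((\<lambda>j. f j * h j) ` J)"
proof -
  obtain a b where "\<And>j. j \<in> J \<Longrightarrow> cmod (f j) \<le> a" "\<And>j. j \<in> J \<Longrightarrow> cmod (h j) \<le> b"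
    using assms unfolding bounded_iff by blast
  then have "cmod (f j * h j) \<le> a * b" if "j \<in> J" for j
    unfolding norm_mult using that by (intro mult_mono) (auto intro: order_trans[OF norm_ge_zero])
  then show ?thesis unfolding bounded_iff by blast
qed

text \<open>Tychonoff's theorem passes from approximate solutions on finite sets to an exact functional. The
  values are bounded because on the diagonal \<open>(1 - (\<rho> z)\<^sup>2) (\<Sum>\<^sub>k |v\<^sub>k z|\<^sup>2) \<le> |B z z| + 1\<close>.\<close>

lemma szego_functional:
  fixes B :: "'a \<Rightarrow> 'a \<Rightarrow> complex" and g :: "'j \<Rightarrow> 'a \<Rightarrow> complex"
  assumes J: "J \<noteq> {}"
    and g: "\<And>j z. j \<in> J \<Longrightarrow> z \<in> X \<Longrightarrow> cmod (g j z) \<le> \<rho> z" and \<rho>: "\<And>z. z \<in> X \<Longrightarrow> \<rho> z < 1"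
    and herm: "\<And>z w. z \<in> X \<Longrightarrow> w \<in> X \<Longrightarrow> B w z = cnj (B z w)"
    and dual: "\<And>K. kernel_on X K \<Longrightarrow> (\<And>j. j \<in> J \<Longrightarrow> psd_on X (\<lambda>z w. (1 - g j z * cnj (g j w)) * K z w)) \<Longrightarrow>
       psd_on X (\<lambda>z w. B z w * K z w)"
  obtains \<Xi> :: "'a \<Rightarrow> 'a \<Rightarrow> ('j \<Rightarrow> complex) \<Rightarrow> complex" and C :: "'a \<Rightarrow> 'a \<Rightarrow> real"
  where "\<And>z w h h'. bounded (h ` J) \<Longrightarrow> bounded (h' ` J) \<Longrightarrow> \<Xi> z w (\<lambda>j. h j + h' j) = \<Xi> z w h + \<Xi> z w h'"
    "\<And>z w h c. bounded (h ` J) \<Longrightarrow> \<Xi> z w (\<lambda>j. c * h j) = c * \<Xi> z w h"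
    "\<And>z w. C z w \<ge> 0"
    "\<And>z w h s. z \<in> X \<Longrightarrow> w \<in> X \<Longrightarrow> (\<And>j. j \<in> J \<Longrightarrow> cmod (h j) \<le> s) \<Longrightarrow> cmod (\<Xi> z w h) \<le> C z w * s"
    "\<And>(N::nat) z h c. (\<And>i. i \<in> {1..N} \<Longrightarrow> bounded (h i ` J)) \<Longrightarrow>
       (\<Sum>i=1..N. \<Sum>l=1..N. \<Xi> (z i) (z l) (\<lambda>j. h i j * cnj (h l j)) * c l * cnj (c i)) \<in> \<real>\<^sub>\<ge>\<^sub>0"
    "\<And>z w. z \<in> X \<Longrightarrow> w \<in> X \<Longrightarrow> \<Xi> z w (\<lambda>j. 1 - g j z * cnj (g j w)) = B z w"
proof -
  define D where "D = (\<lambda>z. if z \<in> X then (cmod (B z z) + 1) / (1 - (\<rho> z)\<^sup>2) else 0)"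
  have \<rho>2: "(\<rho> z)\<^sup>2 < 1" if z: "z \<in> X" for z
  proof -
    obtain j where "j \<in> J" using J by auto
    then have "0 \<le> \<rho> z" using g[OF _ z] norm_ge_zero order_trans by blast
    then show ?thesis using \<rho>[OF z] by (simp add: abs_square_less_1)
  qed
  have D0: "D z \<ge> 0" for z using \<rho>2[of z] by (auto simp: D_def)
  define C where "C = (\<lambda>z w. (D z + D w) / 2)"
  have C0: "C z w \<ge> 0" for z w using D0 by (simp add: C_def)
  \<comment> \<open>The value \<open>0\<close> for unbounded \<open>h\<close> gives every argument
    of the functional a bound, as compactness requires; the approximants \<open>f\<close> below
    vanish there too.\<close>
  define nb where "nb = (\<lambda>h :: 'j \<Rightarrow> complex. if bounded (h ` J) then SUP j\<in>J. cmod (h j) else 0)"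
  have nb: "cmod (h j) \<le> nb h" if "bounded (h ` J)" "j \<in> J" for h j
    using that unfolding nb_def by (auto intro!: cSUP_upper simp: bounded_iff bdd_above_def)
  have nb_le: "nb h \<le> s" if "\<And>j. j \<in> J \<Longrightarrow> cmod (h j) \<le> s" for h s
  proof -
    have "bounded (h ` J)" using that by (auto simp: bounded_iff)
    then show ?thesis using that J by (auto simp: nb_def intro!: cSUP_least)
  qed
  have nb0: "nb h \<ge> 0" for h
  proof (cases "bounded (h ` J)")
    case True
    obtain j where "j \<in> J" using J by auto
    then show ?thesis using nb[OF True, of j] norm_ge_zero[of "h j"] by linarith
  qed (simp add: nb_def)
  define r where "r = (\<lambda>(z, w, h). C z w * nb h)"
  \<comment> \<open>Every clause constrains finitely many values of \<open>f\<close>, so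
    \<open>S\<close> is closed under pointwise convergence.\<close>
  define S where "S = {f :: 'a \<times> 'a \<times> ('j \<Rightarrow> complex) \<Rightarrow> complex.
     (\<forall>p. cmod (f p) \<le> r p) \<and>
     (\<forall>z w h h'. bounded (h ` J) \<longrightarrow> bounded (h' ` J) \<longrightarrow> f (z, w, \<lambda>j. h j + h' j) = f (z, w, h)
         + f (z, w, h')) \<and>
     (\<forall>z w h c. bounded (h ` J) \<longrightarrow> f (z, w, \<lambda>j. c * h j) = c * f (z, w, h)) \<and>
     (\<forall>(N::nat) z h c. (\<forall>i\<in>{1..N}. bounded (h i ` J)) \<longrightarrow>
       (\<Sum>i=1..N. \<Sum>l=1..N. f (z i, z l, \<lambda>j. h i j * cnj (h l j)) * c l * cnj (c i)) \<in> \<real>\<^sub>\<ge>\<^sub>0)}"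
  have nonneg: "{f :: 'a \<times> 'a \<times> ('j \<Rightarrow> complex) \<Rightarrow> complex. (\<Sum>i=1..N::nat. \<Sum>l=1..N. f (z i, z l, \<lambda>j. h i j
      * cnj (h l j)) * c l * cnj (c i)) \<in> \<real>\<^sub>\<ge>\<^sub>0}
      = (\<lambda>f. \<Sum>i=1..N. \<Sum>l=1..N. f (z i, z l, \<lambda>j. h i j * cnj (h l j)) * c l * cnj (c i)) -` \<real>\<^sub>\<ge>\<^sub>0" for N z h c
    by auto
  have closedS: "closed S"
    unfolding S_def
  proof (intro closed_Collect_conj closed_Collect_all closed_Collect_imp open_Collect_const)
    show "closed {f :: 'a \<times> 'a \<times> ('j \<Rightarrow> complex) \<Rightarrow> complex.
        (\<Sum>i=1..N::nat. \<Sum>l=1..N. f (z i, z l, \<lambda>j. h i j * cnj (h l j)) * c l * cnj (c i)) \<in> \<real>\<^sub>\<ge>\<^sub>0}" for N z h c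
      unfolding nonneg by (intro closed_vimage closed_nonneg_Reals_complex continuous_intros
          continuous_on_eval)
  qed (intro closed_Collect_le closed_Collect_eq continuous_intros continuous_on_eval)+
  define I where "I = X \<times> X \<times> {0::real<..}"
  define E where "E = (\<lambda>(z, w, \<delta>). {f :: 'a \<times> 'a \<times> ('j \<Rightarrow> complex) \<Rightarrow> complex. cmod (B z w
      - f (z, w, \<lambda>j. 1 - g j z * cnj (g j w))) \<le> \<delta>})"
  have "\<exists>f\<in>S. \<forall>i\<in>I. f \<in> E i"
  proof (rule finite_intersection_functions[OF closedS])
    show "cmod (f p) \<le> r p" if "f \<in> S" for f p using that unfolding S_def by blast
    show "closed (E i)" if "i \<in> I" for i
      unfolding E_def by (cases i) (auto intro!: closed_Collect_le continuous_intros continuous_on_eval)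
    fix I' assume I': "finite I'" "I' \<subseteq> I"
    define F where "F = fst ` I' \<union> (fst \<circ> snd) ` I'"
    \<comment> \<open>The inserted \<open>1\<close> caps the tolerance; it is the \<open>+ 1\<close>
      in \<open>D\<close>.\<close>
    define \<delta> where "\<delta> = Min (insert 1 ((snd \<circ> snd) ` I'))"
    have F: "finite F" "F \<subseteq> X" using I' by (auto simp: F_def I_def)
    have \<delta>: "\<delta> > 0" "\<delta> \<le> 1" "\<And>z w e. (z, w, e) \<in> I' \<Longrightarrow> \<delta> \<le> e"
      using I' by (auto simp: \<delta>_def I_def Min_gr_iff) (force intro: Min_le)
    obtain c where c: "c \<in> szego_cone J g" "\<And>z w. z \<in> F \<Longrightarrow> w \<in> F \<Longrightarrow> cmod (B z w - c z w) \<le> \<delta>"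
      using szego_cone_approx[where X = X and B = B and g = g, OF F J g \<rho> herm dual \<delta>(1)] by blast
    then obtain m v j where cm: "c = (\<lambda>z w. \<Sum>k<(m::nat). v k z * cnj (v k w)
        * (1 - g (j k) z * cnj (g (j k) w)))" "\<And>k. j k \<in> J"
      unfolding szego_cone_def by auto
    \<comment> \<open>Nothing is known about \<open>v\<close> outside \<open>F\<close>; truncation
      makes the bound by \<open>D\<close> valid at every point.\<close>
    define v' where "v' = (\<lambda>k z. if z \<in> F then v k z else 0)"
    have v'D: "(\<Sum>k<m. (cmod (v' k z))\<^sup>2) \<le> D z" for z
    proof (cases "z \<in> F")
      case False then show ?thesis using D0 by (simp add: v'_def)
    next
      case True
      then have z: "z \<in> X" using F by auto
      have "(1 - (\<rho> z)\<^sup>2) * (\<Sum>k<m. (cmod (v' k z))\<^sup>2) \<le> (\<Sum>k<m. (cmod (v k z))\<^sup>2 * (1 - (cmod (g (j k) z))\<^sup>2))"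
        unfolding sum_distrib_left
      proof (rule sum_mono)
        fix k
        have "(cmod (g (j k) z))\<^sup>2 \<le> (\<rho> z)\<^sup>2" using g[OF cm(2) z] by (intro power_mono) auto
        then show "(1 - (\<rho> z)\<^sup>2) * (cmod (v' k z))\<^sup>2 \<le> (cmod (v k z))\<^sup>2 * (1 - (cmod (g (j k) z))\<^sup>2)"
          using True by (subst mult.commute) (auto simp: v'_def intro!: mult_left_mono)
      qed
      also have "\<dots> = Re (c z z)"
        unfolding cm(1) Re_sum
      proof (rule sum.cong[OF refl])
        fix k
        have "v k z * cnj (v k z) * (1 - g (j k) z * cnj (g (j k) z))
            = of_real ((cmod (v k z))\<^sup>2 * (1 - (cmod (g (j k) z))\<^sup>2))"
          unfolding complex_norm_square[symmetric] by simp
        then show "(cmod (v k z))\<^sup>2 * (1 - (cmod (g (j k) z))\<^sup>2)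
            = Re (v k z * cnj (v k z) * (1 - g (j k) z * cnj (g (j k) z)))" by simp
      qed
      also have "\<dots> \<le> cmod (c z z)" by (rule complex_Re_le_cmod)
      also have "\<dots> \<le> cmod (B z z) + 1"
        using c(2)[OF True True] \<delta> norm_triangle_ineq3[of "B z z" "c z z"] by linarith
      finally show ?thesis using \<rho>2[OF z] z by (simp add: D_def field_simps)
    qed
    define f where "f = (\<lambda>(z, w, h). if bounded (h ` J) then \<Sum>k<m. v' k z * cnj (v' k w) * h (j k) else 0)"
    have "cmod (f (z, w, h)) \<le> C z w * nb h" for z w h
    proof (cases "bounded (h ` J)")
      case True
      have "cmod (f (z, w, h)) \<le> (\<Sum>k<m. ((cmod (v' k z))\<^sup>2 + (cmod (v' k w))\<^sup>2) / 2 * nb h)"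
        unfolding f_def using True
      proof (simp, intro sum_norm_le)
        fix k
        have "cmod (v' k z) * cmod (v' k w) \<le> ((cmod (v' k z))\<^sup>2 + (cmod (v' k w))\<^sup>2) / 2"
          using sum_squares_bound[of "cmod (v' k z)" "cmod (v' k w)"] by simp
        then have "cmod (v' k z) * cmod (v' k w) * cmod (h (j k))
            \<le> ((cmod (v' k z))\<^sup>2 + (cmod (v' k w))\<^sup>2) / 2 * nb h"
          by (intro mult_mono nb True cm) auto
        then show "cmod (v' k z * cnj (v' k w) * h (j k))
            \<le> ((cmod (v' k z))\<^sup>2 + (cmod (v' k w))\<^sup>2) * nb h / 2"
          by (simp add: norm_mult)
      qed
      also have "\<dots> = ((\<Sum>k<m. (cmod (v' k z))\<^sup>2) + (\<Sum>k<m. (cmod (v' k w))\<^sup>2)) / 2 * nb h"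
        by (simp add: sum_distrib_right[symmetric] sum_divide_distrib[symmetric] sum.distrib)
      also have "\<dots> \<le> C z w * nb h"
        unfolding C_def using v'D[of z] v'D[of w] by (intro mult_right_mono nb0) auto
      finally show ?thesis .
    qed (use C0 nb0 in \<open>simp add: f_def\<close>)
    moreover have "f (z, w, \<lambda>j. h j + h' j) = f (z, w, h) + f (z, w, h')"
        if "bounded (h ` J)" "bounded (h' ` J)" for z w h h'
    proof -
      have "bounded ((\<lambda>j. h j + h' j) ` J)" using bounded_plus_comp[of h J h'] that by simp
      then show ?thesis using that by (simp add: f_def sum.distrib distrib_left)
    qed
    moreover have "f (z, w, \<lambda>j. a * h j) = a * f (z, w, h)" if "bounded (h ` J)" for z w h a
    proof -
      have "bounded ((\<lambda>j. a * h j) ` J)" using bounded_image_mult[of "\<lambda>_. a" J h] that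
          by (auto simp: image_constant_conv)
      then show ?thesis using that by (simp add: f_def sum_distrib_left mult_ac)
    qed
    moreover have "(\<Sum>i=1..N. \<Sum>l=1..N. f (z i, z l, \<lambda>j. h i j * cnj (h l j)) * a l * cnj (a i)) \<in> \<real>\<^sub>\<ge>\<^sub>0"
      if h: "\<forall>i\<in>{1..N}. bounded (h i ` J)" for N :: nat and z h a
    proof -
      have "(\<Sum>i=1..N. \<Sum>l=1..N. f (z i, z l, \<lambda>j. h i j * cnj (h l j)) * a l * cnj (a i))
        = (\<Sum>i=1..N. \<Sum>l=1..N. \<Sum>k<m. (v' k (z i) * h i (j k) * cnj (a i)) * cnj (v' k (z l) * h l (j k)
            * cnj (a l)))"
      proof (intro sum.cong refl)
        fix i l assume "i \<in> {1..N}" "l \<in> {1..N}"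
        then have "bounded (h i ` J)" "bounded ((\<lambda>j. cnj (h l j)) ` J)" using h by (auto simp: bounded_iff)
        then have "bounded ((\<lambda>j. h i j * cnj (h l j)) ` J)" by (rule bounded_image_mult)
        then show "f (z i, z l, \<lambda>j. h i j * cnj (h l j)) * a l * cnj (a i)
            = (\<Sum>k<m. (v' k (z i) * h i (j k) * cnj (a i)) * cnj (v' k (z l) * h l (j k) * cnj (a l)))"
          by (simp add: f_def sum_distrib_left sum_distrib_right mult_ac)
      qed
      also have "\<dots> = (\<Sum>k<m. \<Sum>i=1..N. \<Sum>l=1..N. (v' k (z i) * h i (j k) * cnj (a i))
          * cnj (v' k (z l) * h l (j k) * cnj (a l)))"
        unfolding sum.swap[of _ "{1..N}" "{..<m}"] ..
      also have "\<dots> = (\<Sum>k<m. of_real ((cmod (\<Sum>i=1..N. v' k (z i) * h i (j k) * cnj (a i)))\<^sup>2))"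
        unfolding complex_norm_square cnj_sum sum_product ..
      also have "\<dots> = of_real (\<Sum>k<m. (cmod (\<Sum>i=1..N. v' k (z i) * h i (j k) * cnj (a i)))\<^sup>2)" by simp
      finally show ?thesis by (simp only: nonneg_Reals_of_real_iff sum_nonneg zero_le_power2)
    qed
    ultimately have "f \<in> S" by (simp add: S_def r_def)
    moreover have "f \<in> E i" if "i \<in> I'" for i
    proof -
      obtain z w e where i: "i = (z, w, e)" by (cases i)
      have zw: "z \<in> F" "w \<in> F" using that i by (force simp: F_def)+
      then have zX: "z \<in> X" "w \<in> X" using F by auto
      have "bounded ((\<lambda>j. 1 - g j z * cnj (g j w)) ` J)"
      proof -
        have "cmod (1 - g j z * cnj (g j w)) \<le> 2" if "j \<in> J" for j
        proof -
          have "cmod (g j z) * cmod (g j w) \<le> 1 * 1"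
            using g[OF that zX(1)] g[OF that zX(2)] \<rho>[OF zX(1)] \<rho>[OF zX(2)] by (intro mult_mono) auto
          then show ?thesis using norm_triangle_ineq4[of 1 "g j z * cnj (g j w)"] by (simp add: norm_mult)
        qed
        then show ?thesis unfolding bounded_iff by blast
      qed
      then have "f (z, w, \<lambda>j. 1 - g j z * cnj (g j w)) = c z w" using zw by (simp add: f_def cm v'_def)
      then show ?thesis using c(2)[OF zw] \<delta>(3)[of z w e] that by (simp add: i E_def)
    qed
    ultimately show "\<exists>f\<in>S. \<forall>i\<in>I'. f \<in> E i" by blast
  qed
  then obtain f where f: "f \<in> S" "\<And>i. i \<in> I \<Longrightarrow> f \<in> E i" by blast
  show ?thesis
  proof (rule that[of "\<lambda>z w h. f (z, w, h)" C])
    show "cmod (f (z, w, h)) \<le> C z w * s" if "\<And>j. j \<in> J \<Longrightarrow> cmod (h j) \<le> s" for z w h s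
    proof -
      have "cmod (f (z, w, h)) \<le> C z w * nb h" using f(1) by (auto simp: S_def r_def)
      also have "\<dots> \<le> C z w * s" by (intro mult_left_mono nb_le that C0)
      finally show ?thesis .
    qed
    show "f (z, w, \<lambda>j. 1 - g j z * cnj (g j w)) = B z w" if "z \<in> X" "w \<in> X" for z w
    proof -
      have "cmod (B z w - f (z, w, \<lambda>j. 1 - g j z * cnj (g j w))) \<le> 0"
      proof (rule field_le_epsilon)
        fix e :: real assume "e > 0"
        then show "cmod (B z w - f (z, w, \<lambda>j. 1 - g j z * cnj (g j w))) \<le> 0 + e"
          using f(2)[of "(z, w, e)"] that by (simp add: I_def E_def)
      qed
      then show ?thesis by simp
    qed
  qed (use f(1) C0 in \<open>auto simp: S_def\<close>)
qed

section \<open>Functionals on the continuous functions on the closed disc\<close>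

lemma Cdisc_bounded: "h \<in> Cdisc \<Longrightarrow> bounded (h ` cball 0 1)"
  unfolding Cdisc_def using compact_imp_bounded[OF compact_continuous_image[OF _ compact_cball]] by auto

lemma sup_norm_upper: "h \<in> Cdisc \<Longrightarrow> \<alpha> \<in> cball 0 1 \<Longrightarrow> cmod (h \<alpha>) \<le> sup_norm h"
  unfolding sup_norm_def using Cdisc_bounded[of h]
  by (intro cSUP_upper) (auto simp: bounded_iff bdd_above_def)

lemma sup_norm_nonneg: "h \<in> Cdisc \<Longrightarrow> 0 \<le> sup_norm h"
  using order_trans[OF norm_ge_zero sup_norm_upper[of h 0]] by simp

lemma sup_norm_le: "(\<And>\<alpha>. \<alpha> \<in> cball 0 1 \<Longrightarrow> cmod (h \<alpha>) \<le> s) \<Longrightarrow> sup_norm h \<le> s"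
  unfolding sup_norm_def by (intro cSUP_least) auto

lemma Cdisc_dual_bound:
  assumes "L \<in> Cdisc_dual"
  obtains B where "B \<ge> 0" "\<And>h s. h \<in> Cdisc \<Longrightarrow> (\<And>\<alpha>. \<alpha> \<in> cball 0 1 \<Longrightarrow> cmod (h \<alpha>) \<le> s) \<Longrightarrow> cmod (L h) \<le> B * s"
proof -
  obtain B where B: "\<And>h. h \<in> Cdisc \<Longrightarrow> cmod (L h) \<le> B * sup_norm h"
    using assms unfolding Cdisc_dual_def by blast
  show ?thesis
  proof (rule that[of "max 0 B"])
    fix h s assume h: "h \<in> Cdisc" and s: "\<And>\<alpha>. \<alpha> \<in> cball 0 1 \<Longrightarrow> cmod (h \<alpha>) \<le> s"
    have n0: "0 \<le> sup_norm h" by (rule sup_norm_nonneg[OF h])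
    have "cmod (L h) \<le> B * sup_norm h" by (rule B[OF h])
    also have "\<dots> \<le> max 0 B * sup_norm h" using n0 by (intro mult_right_mono) auto
    also have "\<dots> \<le> max 0 B * s" using sup_norm_le[OF s] by (intro mult_left_mono) auto
    finally show "cmod (L h) \<le> max 0 B * s" .
  qed simp
qed

lemma Cdisc_dual_linear:
  assumes "L \<in> Cdisc_dual" "g \<in> Cdisc" "h \<in> Cdisc"
  shows "L (\<lambda>\<alpha>. g \<alpha> + h \<alpha>) = L g + L h" "L (\<lambda>\<alpha>. c * h \<alpha>) = c * L h"
  using assms unfolding Cdisc_dual_def by auto

lemma Cdisc_intros:
  "(\<lambda>\<alpha>. c) \<in> Cdisc" "g \<in> Cdisc \<Longrightarrow> h \<in> Cdisc \<Longrightarrow> (\<lambda>\<alpha>. g \<alpha> + h \<alpha>) \<in> Cdisc"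
  "g \<in> Cdisc \<Longrightarrow> h \<in> Cdisc \<Longrightarrow> (\<lambda>\<alpha>. g \<alpha> * h \<alpha>) \<in> Cdisc"
  "g \<in> Cdisc \<Longrightarrow> h \<in> Cdisc \<Longrightarrow> (\<lambda>\<alpha>. g \<alpha> - h \<alpha>) \<in> Cdisc"
  "h \<in> Cdisc \<Longrightarrow> (\<lambda>\<alpha>. cnj (h \<alpha>)) \<in> Cdisc"
  unfolding Cdisc_def by (auto intro: continuous_intros)

lemma Cdisc_dual_diff:
  assumes "L \<in> Cdisc_dual" "g \<in> Cdisc" "h \<in> Cdisc"
  shows "L (\<lambda>\<alpha>. g \<alpha> - h \<alpha>) = L g - L h"
  using Cdisc_dual_linear(1)[OF assms(1,2) Cdisc_intros(3)[OF Cdisc_intros(1)[of "-1"] assms(3)]]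
    Cdisc_dual_linear(2)[OF assms(1,3,3), of "-1"] by simp

lemma Cdisc_dual_sum:
  assumes L: "L \<in> Cdisc_dual" and "finite A" and h: "\<And>a. a \<in> A \<Longrightarrow> h a \<in> Cdisc"
  shows "(\<lambda>\<alpha>. \<Sum>a\<in>A. c a * h a \<alpha>) \<in> Cdisc \<and> L (\<lambda>\<alpha>. \<Sum>a\<in>A. c a * h a \<alpha>) = (\<Sum>a\<in>A. c a * L (h a))"
  using assms(2) h
proof (induction A rule: finite_induct)
  case empty
  then show ?case using Cdisc_intros(1)[of 0] Cdisc_dual_linear(2)[OF L Cdisc_intros(1)[of 0]
      Cdisc_intros(1)[of 0], of 0] by simp
next
  case (insert x A)
  have 1: "(\<lambda>\<alpha>. c x * h x \<alpha>) \<in> Cdisc" using insert by (intro Cdisc_intros) auto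
  have 2: "(\<lambda>\<alpha>. \<Sum>a\<in>A. c a * h a \<alpha>) \<in> Cdisc" "L (\<lambda>\<alpha>. \<Sum>a\<in>A. c a * h a \<alpha>) = (\<Sum>a\<in>A. c a * L (h a))"
    using insert by auto
  show ?case
    using insert.hyps Cdisc_dual_linear(1)[OF L 1 2(1)] Cdisc_dual_linear(2)[OF L, of "h x" "h x"
        "c x"] 2(2) insert.prems
      Cdisc_intros(2)[OF 1 2(1)] by simp
qed

definition disc_partition :: "real \<Rightarrow> complex set \<Rightarrow> (complex \<Rightarrow> complex \<Rightarrow> real) \<Rightarrow> bool" where
  "disc_partition \<tau> A \<theta> \<longleftrightarrow> finite A \<and> A \<subseteq> cball 0 1 \<and> (\<forall>a\<in>A. continuous_on (cball 0 1) (\<theta> a)) \<and>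
     (\<forall>a \<alpha>. \<theta> a \<alpha> \<ge> 0) \<and> (\<forall>\<alpha>\<in>cball 0 1. (\<Sum>a\<in>A. \<theta> a \<alpha>) = 1) \<and> (\<forall>a \<alpha>. \<theta> a \<alpha> \<noteq> 0 \<longrightarrow> dist a \<alpha> < \<tau>)"

text \<open>Tent functions of radius \<open>\<tau>\<close> centred at a finite net, divided by their
  sum, which is positive on the disc because the net covers it.\<close>

lemma disc_partition_exists:
  assumes \<tau>: "\<tau> > 0"
  shows "\<exists>A \<theta>. disc_partition \<tau> A \<theta>"
proof -
  have "\<exists>A\<subseteq>cball (0::complex) 1. finite A \<and> cball 0 1 \<subseteq> (\<Union>a\<in>A. ball a \<tau>)"
  proof (rule compactE_image[of "cball (0::complex) 1" "cball 0 1" "\<lambda>a. ball a \<tau>"])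
    show "cball (0::complex) 1 \<subseteq> (\<Union>a\<in>cball 0 1. ball a \<tau>)" using \<tau> by fastforce
  qed auto
  then obtain A where A: "A \<subseteq> cball (0::complex) 1" "finite A" "cball 0 1 \<subseteq> (\<Union>a\<in>A. ball a \<tau>)" by blast
  define u where "u = (\<lambda>a \<alpha> :: complex. max 0 (\<tau> - dist a \<alpha>))"
  have u0: "u a \<alpha> \<ge> 0" for a \<alpha> by (simp add: u_def)
  have pos: "(\<Sum>a\<in>A. u a \<alpha>) > 0" if "\<alpha> \<in> cball 0 1" for \<alpha>
  proof -
    have "\<alpha> \<in> (\<Union>a\<in>A. ball a \<tau>)" using A(3) that by blast
    then obtain a where "a \<in> A" "dist a \<alpha> < \<tau>" by auto
    then show ?thesis using A(2) u0 by (intro sum_pos2[of A a]) (auto simp: u_def)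
  qed
  have "continuous_on (cball 0 1) (\<lambda>\<alpha>. u a \<alpha> / (\<Sum>b\<in>A. u b \<alpha>))" for a
    using pos unfolding u_def by (intro continuous_intros) (metis less_irrefl)
  moreover have "(\<Sum>a\<in>A. u a \<alpha> / (\<Sum>b\<in>A. u b \<alpha>)) = 1" if "\<alpha> \<in> cball 0 1" for \<alpha>
    using pos[OF that] by (simp flip: sum_divide_distrib)
  moreover have "u a \<alpha> / (\<Sum>b\<in>A. u b \<alpha>) \<ge> 0" for a \<alpha> using u0 by (simp add: sum_nonneg)
  moreover have "dist a \<alpha> < \<tau>" if "u a \<alpha> / (\<Sum>b\<in>A. u b \<alpha>) \<noteq> 0" for a \<alpha>
    using that by (auto simp: u_def max_def split: if_splits)
  ultimately show ?thesis using A unfolding disc_partition_def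
    by (intro exI[of _ A] exI[of _ "\<lambda>a \<alpha>. u a \<alpha> / (\<Sum>b\<in>A. u b \<alpha>)"]) blast
qed

text \<open>A Riemann-sum argument: on a fine partition of unity \<open>(\<theta>\<^sub>a)\<close> the functional is replaced by the
  sum of the positive kernels \<open>\<xi>(z,w)(\<theta>\<^sub>a) (1 - G z a (G w a)\<^sup>*) k(z,w)\<close>.\<close>

lemma positive_kernel_schur:
  assumes \<xi>: "positive_kernel_on X \<xi>" and G: "\<And>z. z \<in> X \<Longrightarrow> G z \<in> Cdisc"
    and k: "\<And>\<alpha>. \<alpha> \<in> cball 0 1 \<Longrightarrow> psd_on X (\<lambda>z w. (1 - G z \<alpha> * cnj (G w \<alpha>)) * k z w)"
  shows "psd_on X (\<lambda>z w. \<xi> z w (\<lambda>\<alpha>. 1 - G z \<alpha> * cnj (G w \<alpha>)) * k z w)"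
proof -
  have "\<exists>A \<theta>. disc_partition (inverse (real (Suc n))) A \<theta>" for n
    by (rule disc_partition_exists) simp
  then obtain A :: "nat \<Rightarrow> complex set" and \<theta> :: "nat \<Rightarrow> complex \<Rightarrow> complex \<Rightarrow> real" where
    "\<And>n. disc_partition (inverse (real (Suc n))) (A n) (\<theta> n)" by metis
  then have A: "\<And>n. finite (A n)" "\<And>n. A n \<subseteq> cball 0 1"
    and \<theta>: "\<And>n a. a \<in> A n \<Longrightarrow> continuous_on (cball 0 1) (\<theta> n a)" "\<And>n a \<alpha>. \<theta> n a \<alpha> \<ge> 0"
      "\<And>n \<alpha>. \<alpha> \<in> cball 0 1 \<Longrightarrow> (\<Sum>a\<in>A n. \<theta> n a \<alpha>) = 1" "\<And>n a \<alpha>. \<theta> n a \<alpha> \<noteq> 0 \<Longrightarrow>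
          dist a \<alpha> < inverse (real (Suc n))"
    unfolding disc_partition_def by blast+
  have \<theta>C: "(\<lambda>\<alpha>. complex_of_real (\<theta> n a \<alpha>)) \<in> Cdisc" if "a \<in> A n" for n a
    using \<theta>(1)[OF that] unfolding Cdisc_def by (auto intro: continuous_intros)
  have dual: "\<xi> z w \<in> Cdisc_dual" if "z \<in> X" "w \<in> X" for z w using \<xi> that
      unfolding positive_kernel_on_def by blast
  show ?thesis
  proof (rule psd_on_tendsto)
    fix n
    have pos: "psd_on X (\<lambda>z w. \<xi> z w (\<lambda>\<alpha>. of_real (\<theta> n a \<alpha>)))" if a: "a \<in> A n" for a
    proof (rule psd_onI)
      fix N :: nat and z :: "nat \<Rightarrow> 'a" and c :: "nat \<Rightarrow> complex" assume z: "\<And>i. i \<in> {1..N} \<Longrightarrow> z i \<in> X"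
      \<comment> \<open>With this square root at every index, the products
        \<open>h i * cnj (h j)\<close> all equal the partition function, and positivity of
        \<open>\<xi>\<close> becomes that of a scalar kernel.\<close>
      define h where "h = (\<lambda>(i::nat) \<alpha>. complex_of_real (sqrt (\<theta> n a \<alpha>)))"
      have "h i \<in> Cdisc" for i
        using \<theta>(1)[OF a] unfolding Cdisc_def h_def by (auto intro!: continuous_intros)
      then have "(\<Sum>i=1..N. \<Sum>j=1..N. \<xi> (z i) (z j) (\<lambda>\<alpha>. h i \<alpha> * cnj (h j \<alpha>)) * c j * cnj (c i)) \<in> \<real>\<^sub>\<ge>\<^sub>0"
        using \<xi> z unfolding positive_kernel_on_def by blast
      moreover have "h i \<alpha> * cnj (h j \<alpha>) = of_real (\<theta> n a \<alpha>)" for i j \<alpha>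
        using \<theta>(2)[of n a \<alpha>] by (simp add: h_def flip: of_real_mult)
      ultimately show "(\<Sum>i=1..N. \<Sum>j=1..N. \<xi> (z i) (z j) (\<lambda>\<alpha>. of_real (\<theta> n a \<alpha>)) * c j * cnj (c i))
          \<in> \<real>\<^sub>\<ge>\<^sub>0" by simp
    qed
    show "psd_on X (\<lambda>z w. \<Sum>a\<in>A n. \<xi> z w (\<lambda>\<alpha>. of_real (\<theta> n a \<alpha>)) * ((1 - G z a * cnj (G w a)) * k z w))"
    proof (intro psd_on_sum)
      fix a assume a: "a \<in> A n"
      then have "a \<in> cball 0 1" using A(2) by blast
      from psd_on_schur[OF pos[OF a] k[OF this]]
      show "psd_on X (\<lambda>z w. \<xi> z w (\<lambda>\<alpha>. of_real (\<theta> n a \<alpha>)) * ((1 - G z a * cnj (G w a)) * k z w))" .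
    qed
  next
    fix z w assume zw: "z \<in> X" "w \<in> X"
    define u where "u = (\<lambda>\<alpha>. 1 - G z \<alpha> * cnj (G w \<alpha>))"
    have uC: "u \<in> Cdisc" unfolding u_def using G zw by (intro Cdisc_intros) auto
    obtain B where B: "B \<ge> 0" "\<And>h s. h \<in> Cdisc \<Longrightarrow> (\<And>\<alpha>. \<alpha> \<in> cball 0 1 \<Longrightarrow> cmod (h \<alpha>) \<le> s) \<Longrightarrow> cmod (\<xi> z w h)
        \<le> B * s"
      using Cdisc_dual_bound[OF dual[OF zw]] by blast
    have uc: "uniformly_continuous_on (cball 0 1) u"
      using uC unfolding Cdisc_def by (intro compact_uniformly_continuous) auto
    have lim: "(\<lambda>n. \<Sum>a\<in>A n. u a * \<xi> z w (\<lambda>\<alpha>. of_real (\<theta> n a \<alpha>))) \<longlonglongrightarrow> \<xi> z w u"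
    proof (rule LIMSEQ_I)
      fix e :: real assume e: "e > 0"
      define e' where "e' = e / (2 * (B + 1))"
      have e': "e' > 0" using e B by (simp add: e'_def)
      obtain d where d: "d > 0" "\<And>x y. x \<in> cball 0 1 \<Longrightarrow> y \<in> cball 0 1 \<Longrightarrow> dist x y < d \<Longrightarrow> dist (u x) (u y) < e'"
        using uc e' unfolding uniformly_continuous_on_def by metis
      obtain n0 where n0: "inverse (real (Suc n0)) < d" using reals_Archimedean[OF d(1)] by blast
      show "\<exists>no. \<forall>n\<ge>no. norm ((\<Sum>a\<in>A n. u a * \<xi> z w (\<lambda>\<alpha>. of_real (\<theta> n a \<alpha>))) - \<xi> z w u) < e"
      proof (intro exI allI impI)
        fix n assume "n \<ge> n0"
        then have "inverse (real (Suc n)) \<le> inverse (real (Suc n0))" by simp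
        then have nd: "inverse (real (Suc n)) < d" using n0 by (rule le_less_trans)
        \<comment> \<open>The Riemann sum: \<open>\<theta> n a\<close> lives where \<open>u\<close>
          is within \<open>e'\<close> of \<open>u a\<close>, so \<open>S\<close> is uniformly close
          to \<open>u\<close>, and boundedness of \<open>\<xi> z w\<close> transfers this to the
          values.\<close>
        define S where "S = (\<lambda>\<alpha>. \<Sum>a\<in>A n. u a * of_real (\<theta> n a \<alpha>))"
        have S: "S \<in> Cdisc" "\<xi> z w S = (\<Sum>a\<in>A n. u a * \<xi> z w (\<lambda>\<alpha>. of_real (\<theta> n a \<alpha>)))"
          using Cdisc_dual_sum[OF dual[OF zw] A(1)[of n], of "\<lambda>a \<alpha>. of_real (\<theta> n a \<alpha>)" u] \<theta>C
              unfolding S_def by auto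
        have "cmod (S \<alpha> - u \<alpha>) \<le> e'" if \<alpha>: "\<alpha> \<in> cball 0 1" for \<alpha>
        proof -
          have "u \<alpha> = (\<Sum>a\<in>A n. u \<alpha> * of_real (\<theta> n a \<alpha>))"
            using \<theta>(3)[OF \<alpha>, of n] by (simp flip: sum_distrib_left of_real_sum)
          then have "S \<alpha> - u \<alpha> = (\<Sum>a\<in>A n. (u a - u \<alpha>) * of_real (\<theta> n a \<alpha>))"
            unfolding S_def by (simp add: left_diff_distrib sum_subtractf)
          also have "cmod \<dots> \<le> (\<Sum>a\<in>A n. e' * \<theta> n a \<alpha>)"
          proof (rule sum_norm_le)
            fix a assume a: "a \<in> A n"
            show "cmod ((u a - u \<alpha>) * of_real (\<theta> n a \<alpha>)) \<le> e' * \<theta> n a \<alpha>"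
            proof (cases "\<theta> n a \<alpha> = 0")
              case False
              then have "dist a \<alpha> < d" using \<theta>(4)[OF False] nd by simp
              moreover have "a \<in> cball 0 1" using a A(2) by blast
              ultimately have "cmod (u a - u \<alpha>) \<le> e'" using d(2)[of a \<alpha>] \<alpha> by (simp add: dist_norm)
              then show ?thesis using \<theta>(2)[of n a \<alpha>] by (simp add: norm_mult mult_right_mono)
            qed simp
          qed
          also have "\<dots> = e'" using \<theta>(3)[OF \<alpha>, of n] by (simp flip: sum_distrib_left)
          finally show ?thesis .
        qed
        then have "cmod (\<xi> z w (\<lambda>\<alpha>. S \<alpha> - u \<alpha>)) \<le> B * e'" using S uC by (intro B Cdisc_intros) auto
        also have "\<dots> < (B + 1) * e'" using e' by simp
        also have "\<dots> \<le> e" using B(1) e by (simp add: e'_def divide_simps)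
        finally show "norm ((\<Sum>a\<in>A n. u a * \<xi> z w (\<lambda>\<alpha>. of_real (\<theta> n a \<alpha>))) - \<xi> z w u) < e"
          unfolding S(2)[symmetric] Cdisc_dual_diff[OF dual[OF zw] S(1) uC] .
      qed
    qed
    have "(\<lambda>n. (\<Sum>a\<in>A n. u a * \<xi> z w (\<lambda>\<alpha>. of_real (\<theta> n a \<alpha>))) * k z w) \<longlonglongrightarrow> \<xi> z w u * k z w"
      by (intro tendsto_mult lim tendsto_const)
    then show "(\<lambda>n. \<Sum>a\<in>A n. \<xi> z w (\<lambda>\<alpha>. of_real (\<theta> n a \<alpha>)) * ((1 - G z a * cnj (G w a)) * k z w))
      \<longlonglongrightarrow> \<xi> z w (\<lambda>\<alpha>. 1 - G z \<alpha> * cnj (G w \<alpha>)) * k z w"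
      unfolding u_def by (simp add: sum_distrib_left sum_distrib_right mult_ac)
  qed
qed

lemma Jpsi_in_Cdisc: "z \<in> pentablock \<Longrightarrow> Jpsi z \<in> Cdisc"
  by (simp add: Cdisc_def continuous_on_Jpsi)

lemma jPhi_in_Cdisc: "z \<in> pentablock \<Longrightarrow> jPhi z \<in> Cdisc"
  by (simp add: Cdisc_def continuous_on_jPhi)

lemma decomposition_imp_psd:
  assumes \<xi>: "positive_kernel_on pentablock \<xi>" and \<eta>: "positive_kernel_on pentablock \<eta>"
      and \<delta>: "psd_on pentablock \<delta>"
    and eq: "\<And>z w. z \<in> pentablock \<Longrightarrow> w \<in> pentablock \<Longrightarrow> B z w = \<xi> z w (\<lambda>\<alpha>. 1 - Jpsi z \<alpha> * cnj (Jpsi w \<alpha>))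
            + \<eta> z w (\<lambda>\<alpha>. 1 - jPhi z \<alpha> * cnj (jPhi w \<alpha>)) + (1 - c2 z * cnj (c2 w) / 4) * \<delta> z w"
    and k: "k \<in> AK"
  shows "psd_on pentablock (\<lambda>z w. B z w * k z w)"
proof -
  have 1: "psd_on pentablock (\<lambda>z w. \<xi> z w (\<lambda>\<alpha>. 1 - Jpsi z \<alpha> * cnj (Jpsi w \<alpha>)) * k z w)"
    using k by (intro positive_kernel_schur[OF \<xi>] Jpsi_in_Cdisc) (auto simp: AK_def Jpsi_def)
  have 2: "psd_on pentablock (\<lambda>z w. \<eta> z w (\<lambda>\<alpha>. 1 - jPhi z \<alpha> * cnj (jPhi w \<alpha>)) * k z w)"
    using k by (intro positive_kernel_schur[OF \<eta>] jPhi_in_Cdisc) (auto simp: AK_def jPhi_def)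
  have 3: "psd_on pentablock (\<lambda>z w. \<delta> z w * ((1 - c2 z * cnj (c2 w) / 4) * k z w))"
    using k by (intro psd_on_schur[OF \<delta>]) (auto simp: AK_def dest: bspec[of _ _ 0])
  show ?thesis
    using psd_on_add[OF psd_on_add[OF 1 2] 3]
    by (subst psd_on_cong) (auto simp: eq algebra_simps)
qed

section \<open>Decomposition on the pentablock\<close>

text \<open>The index is a disjoint union of two discs and a point, so a single functional on
  bounded functions of the index splits into the three terms of (3).\<close>

definition penta_family :: "complex + complex + unit \<Rightarrow> cpoint \<Rightarrow> complex" where
  "penta_family j z = (case j of Inl \<alpha> \<Rightarrow> psi \<alpha> z | Inr (Inl \<alpha>) \<Rightarrow> Phi \<alpha> (c2 z) (c3 z) | Inr (Inr _) \<Rightarrow> c2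
      z / 2)"

text \<open>\<open>szego_functional\<close> is applied to \<open>penta_family\<close>. Extension by
  zero from one of the discs (\<open>e1\<close>, \<open>e2\<close>) is linear, multiplicative and
  compatible with conjugation, so positivity and norm bounds pass to the two restrictions. At the
  isolated index a function is a scalar, and \<open>1 - c2 z * cnj (c2 w) / 4\<close> comes out by
  linearity.\<close>

lemma psd_imp_decomposition:
  assumes herm: "\<And>z w. z \<in> pentablock \<Longrightarrow> w \<in> pentablock \<Longrightarrow> B w z = cnj (B z w)"
    and psd: "\<And>k. k \<in> AK \<Longrightarrow> psd_on pentablock (\<lambda>z w. B z w * k z w)"
  shows "\<exists>\<xi> \<eta> \<delta>. positive_kernel_on pentablock \<xi> \<and> positive_kernel_on pentablock \<eta> \<and> psd_on pentablock \<delta> \<and>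
    (\<forall>z\<in>pentablock. \<forall>w\<in>pentablock. B z w = \<xi> z w (\<lambda>\<alpha>. 1 - Jpsi z \<alpha> * cnj (Jpsi w \<alpha>))
            + \<eta> z w (\<lambda>\<alpha>. 1 - jPhi z \<alpha> * cnj (jPhi w \<alpha>)) + (1 - c2 z * cnj (c2 w) / 4) * \<delta> z w)"
proof -
  define J where "J = (cball 0 1 :: complex set) <+> ((cball 0 1 :: complex set) <+> {()})"
  have J0: "J \<noteq> {}" by (auto simp: J_def)
  have "\<exists>r<1. \<forall>j\<in>J. cmod (penta_family j z) \<le> r" if z: "z \<in> pentablock" for z
  proof -
    obtain r1 where r1: "r1 < 1" "\<And>\<alpha>. cmod \<alpha> \<le> 1 \<Longrightarrow> cmod (psi \<alpha> z) \<le> r1"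
      using uniform_strict_bound[OF continuous_on_Jpsi[OF z]] pentablock_psi_less[OF z]
          unfolding Jpsi_def by blast
    obtain r2 where r2: "r2 < 1" "\<And>\<alpha>. cmod \<alpha> \<le> 1 \<Longrightarrow> cmod (Phi \<alpha> (c2 z) (c3 z)) \<le> r2"
      using uniform_strict_bound[OF continuous_on_jPhi[OF z]] pentablock_Phi_less(1)[OF z]
          unfolding jPhi_def by blast
    show ?thesis
      using r1 r2 pentablock_c2_less[OF z]
      by (intro exI[of _ "max r1 (max r2 (cmod (c2 z / 2)))"]) (auto simp: J_def penta_family_def
          le_max_iff_disj)
  qed
  then obtain \<rho> where \<rho>: "\<And>z. z \<in> pentablock \<Longrightarrow> \<rho> z < 1" "\<And>z j. z \<in> pentablock \<Longrightarrow> j \<in> J \<Longrightarrow>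
      cmod (penta_family j z) \<le> \<rho> z"
    by metis
  have dual: "psd_on pentablock (\<lambda>z w. B z w * K z w)"
    if K: "kernel_on pentablock K" "\<And>j. j \<in> J \<Longrightarrow> psd_on pentablock (\<lambda>z w. (1 - penta_family j z
        * cnj (penta_family j w)) * K z w)" for K
  proof (rule psd)
    show "K \<in> AK"
      unfolding AK_def
    proof (intro CollectI conjI ballI K(1))
      fix \<alpha> :: complex assume "\<alpha> \<in> cball 0 1"
      then have "Inl \<alpha> \<in> J" "Inr (Inl \<alpha>) \<in> J" "Inr (Inr ()) \<in> J" by (auto simp: J_def)
      from this[THEN K(2)] show
        "psd_on pentablock (\<lambda>z w. (1 - psi \<alpha> z * cnj (psi \<alpha> w)) * K z w)"
        "psd_on pentablock (\<lambda>z w. (1 - Phi \<alpha> (c2 z) (c3 z) * cnj (Phi \<alpha> (c2 w) (c3 w))) * K z w)"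
        "psd_on pentablock (\<lambda>z w. (1 - c2 z * cnj (c2 w) / 4) * K z w)"
        by (simp_all add: penta_family_def)
    qed
  qed
  obtain \<Xi> :: "cpoint \<Rightarrow> cpoint \<Rightarrow> (complex + complex + unit \<Rightarrow> complex) \<Rightarrow> complex"
      and C :: "cpoint \<Rightarrow> cpoint \<Rightarrow> real" where
    add: "\<And>z w h h'. bounded (h ` J) \<Longrightarrow> bounded (h' ` J) \<Longrightarrow> \<Xi> z w (\<lambda>j. h j + h' j) = \<Xi> z w h + \<Xi> z w h'"
    and scale: "\<And>z w h c. bounded (h ` J) \<Longrightarrow> \<Xi> z w (\<lambda>j. c * h j) = c * \<Xi> z w h"
    and C0: "\<And>z w. C z w \<ge> 0"
    and bound: "\<And>z w h s. z \<in> pentablock \<Longrightarrow> w \<in> pentablock \<Longrightarrow> (\<And>j. j \<in> J \<Longrightarrow> cmod (h j) \<le> s) \<Longrightarrow>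
        cmod (\<Xi> z w h) \<le> C z w * s"
    and pos: "\<And>(N::nat) z h c. (\<And>i. i \<in> {1..N} \<Longrightarrow> bounded (h i ` J)) \<Longrightarrow>
       (\<Sum>i=1..N. \<Sum>l=1..N. \<Xi> (z i) (z l) (\<lambda>j. h i j * cnj (h l j)) * c l * cnj (c i)) \<in> \<real>\<^sub>\<ge>\<^sub>0"
    and eq: "\<And>z w. z \<in> pentablock \<Longrightarrow> w \<in> pentablock \<Longrightarrow>
        \<Xi> z w (\<lambda>j. 1 - penta_family j z * cnj (penta_family j w)) = B z w"
    using szego_functional[where X = pentablock and g = penta_family and B = B and \<rho> = \<rho>,
        OF J0 \<rho>(2) \<rho>(1) herm dual]
    by blast
  define e1 where "e1 = (\<lambda>(h :: complex \<Rightarrow> complex) (j :: complex + complex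
      + unit). case j of Inl \<alpha> \<Rightarrow> h \<alpha> | Inr _ \<Rightarrow> 0)"
  define e2 where "e2 = (\<lambda>(h :: complex \<Rightarrow> complex) (j :: complex + complex
      + unit). case j of Inl _ \<Rightarrow> 0 | Inr (Inl \<alpha>) \<Rightarrow> h \<alpha> | Inr (Inr _) \<Rightarrow> 0)"
  define e3 where "e3 = (\<lambda>j :: complex + complex + unit. if j = Inr (Inr ()) then 1 else (0 :: complex))"
  have pk: "positive_kernel_on pentablock (\<lambda>z w h. \<Xi> z w (e h))"
    if bd: "\<And>h j. h \<in> Cdisc \<Longrightarrow> j \<in> J \<Longrightarrow> cmod (e h j) \<le> sup_norm h"
      and e: "\<And>h h'. e (\<lambda>\<alpha>. h \<alpha> + h' \<alpha>) = (\<lambda>j. e h j + e h' j)" "\<And>h c. e (\<lambda>\<alpha>. c * h \<alpha>) = (\<lambda>j. c * e h j)"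
        "\<And>h h'. e (\<lambda>\<alpha>. h \<alpha> * cnj (h' \<alpha>)) = (\<lambda>j. e h j * cnj (e h' j))" for e
  proof -
    have b: "bounded (e h ` J)" if "h \<in> Cdisc" for h using bd[OF that] unfolding bounded_iff by blast
    have "(\<lambda>h. \<Xi> z w (e h)) \<in> Cdisc_dual" if zw: "z \<in> pentablock" "w \<in> pentablock" for z w
      unfolding Cdisc_dual_def using bound[OF zw] bd
      by (auto simp: e add scale b intro!: exI[of _ "C z w"])
    moreover have "(\<Sum>i=1..N. \<Sum>j=1..N. \<Xi> (z i) (z j) (e (\<lambda>\<alpha>. h i \<alpha> * cnj (h j \<alpha>))) * c j * cnj (c i)) \<in> \<real>\<^sub>\<ge>\<^sub>0"
      if "\<forall>i\<in>{1..N}. z i \<in> pentablock \<and> h i \<in> Cdisc" for N :: nat and z h c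
      unfolding e using that b by (intro pos) auto
    ultimately show ?thesis unfolding positive_kernel_on_def by blast
  qed
  have bd1: "cmod (e1 h j) \<le> sup_norm h" if "h \<in> Cdisc" "j \<in> J" for h j
    using that sup_norm_upper[OF that(1)] sup_norm_nonneg[OF that(1)] by (auto simp: e1_def J_def)
  have bd2: "cmod (e2 h j) \<le> sup_norm h" if "h \<in> Cdisc" "j \<in> J" for h j
    using that sup_norm_upper[OF that(1)] sup_norm_nonneg[OF that(1)] by (auto simp: e2_def J_def)
  have b3: "bounded (e3 ` J)" unfolding bounded_iff by (intro exI[of _ 1]) (auto simp: e3_def J_def)
  have p1: "positive_kernel_on pentablock (\<lambda>z w h. \<Xi> z w (e1 h))"
    by (rule pk[OF bd1]) (auto simp: e1_def fun_eq_iff split: sum.splits)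
  have p2: "positive_kernel_on pentablock (\<lambda>z w h. \<Xi> z w (e2 h))"
    by (rule pk[OF bd2]) (auto simp: e2_def fun_eq_iff split: sum.splits)
  have p3: "psd_on pentablock (\<lambda>z w. \<Xi> z w e3)"
  proof (rule psd_onI)
    fix N :: nat and z :: "nat \<Rightarrow> cpoint" and c :: "nat \<Rightarrow> complex"
    have "e3 = (\<lambda>j. e3 j * cnj (e3 j))" by (auto simp: e3_def fun_eq_iff split: sum.splits)
    then show "(\<Sum>i=1..N. \<Sum>j=1..N. \<Xi> (z i) (z j) e3 * c j * cnj (c i)) \<in> \<real>\<^sub>\<ge>\<^sub>0"
      using pos[of N "\<lambda>_. e3" z c] b3 by simp
  qed
  have "B z w = \<Xi> z w (e1 (\<lambda>\<alpha>. 1 - Jpsi z \<alpha> * cnj (Jpsi w \<alpha>)))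
      + \<Xi> z w (e2 (\<lambda>\<alpha>. 1 - jPhi z \<alpha> * cnj (jPhi w \<alpha>)))
     + (1 - c2 z * cnj (c2 w) / 4) * \<Xi> z w e3" if zw: "z \<in> pentablock" "w \<in> pentablock" for z w
  proof -
    define u1 where "u1 = (\<lambda>\<alpha>. 1 - Jpsi z \<alpha> * cnj (Jpsi w \<alpha>))"
    define u2 where "u2 = (\<lambda>\<alpha>. 1 - jPhi z \<alpha> * cnj (jPhi w \<alpha>))"
    define s where "s = 1 - c2 z * cnj (c2 w) / 4"
    have u: "u1 \<in> Cdisc" "u2 \<in> Cdisc"
      unfolding u1_def u2_def
      by (rule Cdisc_intros(4)[OF Cdisc_intros(1) Cdisc_intros(3)[OF Jpsi_in_Cdisc[OF zw(1)]
          Cdisc_intros(5)[OF Jpsi_in_Cdisc[OF zw(2)]]]],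
          rule Cdisc_intros(4)[OF Cdisc_intros(1) Cdisc_intros(3)[OF jPhi_in_Cdisc[OF zw(1)]
              Cdisc_intros(5)[OF jPhi_in_Cdisc[OF zw(2)]]]])
    have b1: "bounded (e1 u1 ` J)" using bd1[OF u(1)] unfolding bounded_iff by blast
    have b2: "bounded (e2 u2 ` J)" using bd2[OF u(2)] unfolding bounded_iff by blast
    have b3': "bounded ((\<lambda>j. s * e3 j) ` J)" using bounded_image_mult[of "\<lambda>_. s", OF _ b3]
        by (auto simp: image_constant_conv)
    have b12: "bounded ((\<lambda>j. e1 u1 j + e2 u2 j) ` J)" using bounded_plus_comp[OF b1 b2] .
    have "(\<lambda>j. 1 - penta_family j z * cnj (penta_family j w)) = (\<lambda>j. (e1 u1 j + e2 u2 j) + s * e3 j)"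
      by (auto simp: penta_family_def e1_def e2_def e3_def u1_def u2_def s_def Jpsi_def jPhi_def
          fun_eq_iff split: sum.splits)
    then have "B z w = \<Xi> z w (\<lambda>j. (e1 u1 j + e2 u2 j) + s * e3 j)" using eq[OF zw] by simp
    also have "\<dots> = \<Xi> z w (e1 u1) + \<Xi> z w (e2 u2) + s * \<Xi> z w e3"
      by (simp add: add[OF b12 b3'] add[OF b1 b2] scale[OF b3])
    finally show ?thesis unfolding u1_def u2_def s_def .
  qed
  then show ?thesis
    by (intro exI[of _ "\<lambda>z w h. \<Xi> z w (e1 h)"] exI[of _ "\<lambda>z w h. \<Xi> z w (e2 h)"] exI[of _
        "\<lambda>z w. \<Xi> z w e3"] conjI p1 p2 p3 ballI)
qed

section \<open>Realization on the bidisc\<close>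

text \<open>The slice \<open>{(a, 0, p)}\<close> of the pentablock is a copy of the bidisc. Off the slice the identity kernel
  keeps the diagonal nonzero without affecting admissibility.\<close>

definition slice_kernel :: "(complex \<times> complex \<Rightarrow> complex \<times> complex \<Rightarrow> complex) \<Rightarrow> cpoint \<Rightarrow> cpoint \<Rightarrow>
    complex" where
  "slice_kernel K z w = of_bool (c2 z = 0) * cnj (of_bool (c2 w = 0)) * K (c1 z, c3 z) (c1 w, c3 w)
     + (if z = w then of_real (of_bool (c2 z \<noteq> 0)) else 0)"

lemma psd_on_slice_kernel:
  assumes psd: "psd_on bidisc (\<lambda>z w. (1 - g (fst z, 0, snd z) * cnj (g (fst w, 0, snd w))) * K z w)"
    and g: "\<And>z. z \<in> pentablock \<Longrightarrow> cmod (g z) \<le> 1"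
  shows "psd_on pentablock (\<lambda>z w. (1 - g z * cnj (g w)) * slice_kernel K z w)"
proof -
  have "psd_on pentablock (\<lambda>z w. of_bool (c2 z = 0) * cnj (of_bool (c2 w = 0)) *
      ((1 - g (fst (c1 z, c3 z), 0, snd (c1 z, c3 z)) * cnj (g (fst (c1 w, c3 w), 0, snd (c1 w, c3 w))))
          * K (c1 z, c3 z) (c1 w, c3 w))
     + (if z = w then of_real (of_bool (c2 z \<noteq> 0) * (1 - (cmod (g z))\<^sup>2)) else 0))"
    using g by (intro psd_on_add psd_on_conj_mult psd_on_pullback[OF psd] psd_on_delta)
       (auto simp: pentablock_bidisc abs_square_le_1)
  moreover have "of_bool (c2 z = 0) * cnj (of_bool (c2 w = 0)) *
      ((1 - g (fst (c1 z, c3 z), 0, snd (c1 z, c3 z)) * cnj (g (fst (c1 w, c3 w), 0, snd (c1 w, c3 w))))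
          * K (c1 z, c3 z) (c1 w, c3 w))
     + (if z = w then of_real (of_bool (c2 z \<noteq> 0) * (1 - (cmod (g z))\<^sup>2)) else 0)
         = (1 - g z * cnj (g w)) * slice_kernel K z w" for z w
  proof -
    have 1: "c2 x = 0 \<Longrightarrow> (c1 x, 0, c3 x) = x" for x :: cpoint by (cases x) auto
    show ?thesis using complex_norm_square[of "g z"] by (auto simp: slice_kernel_def 1)
  qed
  ultimately show ?thesis by simp
qed

text \<open>With \<open>r = |\<alpha>|^2\<close>, coordinates \<open>a\<close> and \<open>p\<close>,
  and \<open>D = 1 + \<alpha>^2 p\<close>, the polarised identity is \<open>|D|^2 - (1 - r)^2 |a|^2
  = (1 - r)^2 (1 - |a|^2) + |f|^2 + r (1 - r) (1 - |p|^2)\<close>; it remains to divide by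
  \<open>D z * cnj (D w)\<close>.\<close>

lemma psi_slice_psd:
  assumes K: "psd_on bidisc K" and K1: "psd_on bidisc (\<lambda>z w. (1 - fst z * cnj (fst w)) * K z w)"
    and K2: "psd_on bidisc (\<lambda>z w. (1 - snd z * cnj (snd w)) * K z w)" and \<alpha>: "cmod \<alpha> \<le> 1"
  shows "psd_on bidisc (\<lambda>z w. (1 - psi \<alpha> (fst z, 0, snd z) * cnj (psi \<alpha> (fst w, 0, snd w))) * K z w)"
proof -
  define r where "r = (cmod \<alpha>)\<^sup>2"
  have r: "0 \<le> r" "r \<le> 1" using \<alpha> by (auto simp: r_def power_le_one)
  define D where "D = (\<lambda>z :: complex \<times> complex. 1 + \<alpha>\<^sup>2 * snd z)"
  \<comment> \<open>Chosen so that \<open>f z * cnj (f w)\<close> carries the cross terms of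
    \<open>D z * cnj (D w)\<close>. At \<open>\<alpha> = 0\<close> division by zero gives
    \<open>f = 0\<close>, the value needed there.\<close>
  define f where "f = (\<lambda>z :: complex \<times> complex. of_real (cmod \<alpha>) + \<alpha>\<^sup>2 * snd z / of_real (cmod \<alpha>))"
  have D0: "D z \<noteq> 0" if "z \<in> bidisc" for z
    using pentablock_denominator[OF pentablock_slice[of "fst z" "snd z"] \<alpha>] that by (simp add: D_def)
  have ra: "of_real r = \<alpha> * cnj \<alpha>" unfolding r_def by (rule complex_norm_square)
  have ff: "f z * cnj (f w) = of_real r + \<alpha>\<^sup>2 * snd z + cnj (\<alpha>\<^sup>2 * snd w)
      + of_real r * (snd z * cnj (snd w))" for z w
  proof (cases "\<alpha> = 0")
    case True then show ?thesis by (simp add: f_def r_def)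
  next
    case False
    define s where "s = complex_of_real (cmod \<alpha>)"
    have s: "s \<noteq> 0" "s * s = \<alpha> * cnj \<alpha>" "cnj s = s"
      using False complex_norm_square[of \<alpha>] by (auto simp: s_def power2_eq_square)
    have "f z * cnj (f w) = s * s + \<alpha>\<^sup>2 * snd z + cnj (\<alpha>\<^sup>2 * snd w)
        + (\<alpha> * cnj \<alpha>) * (\<alpha> * cnj \<alpha>) * (snd z * cnj (snd w)) / (s * s)"
      unfolding f_def s_def[symmetric] using s by (simp add: field_simps power2_eq_square)
    then show ?thesis unfolding ra using False s by (simp add: s(2))
  qed
  have "psd_on bidisc (\<lambda>z w. (1 / D z) * cnj (1 / D w)
      * (of_real ((1 - r)\<^sup>2) * ((1 - fst z * cnj (fst w)) * K z w)
     + f z * cnj (f w) * K z w + of_real (r * (1 - r)) * ((1 - snd z * cnj (snd w)) * K z w)))"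
    using r by (intro psd_on_conj_mult[where f = "\<lambda>z. 1
        / D z"] psd_on_add psd_on_scale psd_on_conj_mult[where f = f] K K1 K2) auto
  moreover have "(1 / D z) * cnj (1 / D w) * (of_real ((1 - r)\<^sup>2) * ((1 - fst z * cnj (fst w)) * K z w)
     + f z * cnj (f w) * K z w + of_real (r * (1 - r)) * ((1 - snd z * cnj (snd w)) * K z w)) =
     (1 - psi \<alpha> (fst z, 0, snd z) * cnj (psi \<alpha> (fst w, 0, snd w))) * K z w" if "z \<in> bidisc" "w \<in> bidisc"
         for z w
  proof -
    have "of_real ((1 - r)\<^sup>2) * ((1 - fst z * cnj (fst w)) * K z w)
     + f z * cnj (f w) * K z w + of_real (r * (1 - r)) * ((1 - snd z * cnj (snd w)) * K z w)
     = (D z * cnj (D w) - (1 - of_real r)\<^sup>2 * fst z * cnj (fst w)) * K z w"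
      unfolding ff D_def of_real_mult of_real_diff of_real_power of_real_1 ra
      by (simp add: algebra_simps power2_eq_square)
    moreover have "psi \<alpha> (fst x, 0, snd x) = (1 - of_real r) * fst x / D x" for x
      by (simp add: psi_def D_def r_def)
    ultimately show ?thesis using D0[OF that(1)] D0[OF that(2)] by (simp add: field_simps power2_eq_square)
  qed
  ultimately show ?thesis by (subst psd_on_cong[symmetric]) auto
qed

lemma slice_kernel_AK:
  assumes K: "kernel_on bidisc K" and K1: "psd_on bidisc (\<lambda>z w. (1 - fst z * cnj (fst w)) * K z w)"
    and K2: "psd_on bidisc (\<lambda>z w. (1 - snd z * cnj (snd w)) * K z w)"
  shows "slice_kernel K \<in> AK"
  unfolding AK_def
proof (intro CollectI conjI ballI)
  have psd: "psd_on bidisc K" using K by (simp add: kernel_on_def)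
  have "psd_on pentablock (slice_kernel K)"
    using psd_on_slice_kernel[of "\<lambda>_. 0" K] psd by simp
  moreover have "slice_kernel K z z \<noteq> 0" if "z \<in> pentablock" for z
    using K pentablock_bidisc[OF that] by (auto simp: slice_kernel_def kernel_on_def)
  ultimately show "kernel_on pentablock (slice_kernel K)" by (simp add: kernel_on_def)
  fix \<alpha> :: complex assume "\<alpha> \<in> cball 0 1"
  then have \<alpha>: "cmod \<alpha> \<le> 1" by simp
  have "psd_on pentablock (\<lambda>z w. (1 - c2 z / 2 * cnj (c2 w / 2)) * slice_kernel K z w)"
    using psd by (intro psd_on_slice_kernel less_imp_le pentablock_c2_less) simp_all
  then show "psd_on pentablock (\<lambda>z w. (1 - c2 z * cnj (c2 w) / 4) * slice_kernel K z w)" by simp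
  show "psd_on pentablock (\<lambda>z w. (1 - psi \<alpha> z * cnj (psi \<alpha> w)) * slice_kernel K z w)"
    by (intro psd_on_slice_kernel psi_slice_psd psd K1 K2 \<alpha> less_imp_le pentablock_psi_less)
  define r where "r = (cmod \<alpha>)\<^sup>2"
  have r: "0 \<le> r" "r \<le> 1" using \<alpha> by (auto simp: r_def power_le_one)
  have ra: "of_real r = \<alpha> * cnj \<alpha>" unfolding r_def by (rule complex_norm_square)
  \<comment> \<open>On the slice \<open>Phi\<close> is \<open>\<alpha> p\<close>, and
    \<open>1 - r |p|^2 = (1 - r) + r (1 - |p|^2)\<close>.\<close>
  have "psd_on bidisc (\<lambda>z w. of_real (1 - r) * K z w + of_real r * ((1 - snd z * cnj (snd w)) * K z w))"
    using r by (intro psd_on_add psd_on_scale psd K2) auto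
  then have "psd_on bidisc (\<lambda>z w. (1 - Phi \<alpha> 0 (snd z) * cnj (Phi \<alpha> 0 (snd w))) * K z w)"
    by (simp add: Phi_def ra algebra_simps)
  then show "psd_on pentablock (\<lambda>z w. (1 - Phi \<alpha> (c2 z) (c3 z) * cnj (Phi \<alpha> (c2 w) (c3 w)))
      * slice_kernel K z w)"
    by (intro psd_on_slice_kernel less_imp_le pentablock_Phi_less \<alpha>) simp_all
qed

text \<open>A kernel tested against the two coordinates is the restriction of an admissible
  \<open>slice_kernel\<close>, so the dual condition holds for a family indexed by
  \<open>bool\<close>. The indicators \<open>i1\<close> and \<open>i2\<close> of the two indices are
  real and idempotent, which makes the functional at each of them a positive kernel.\<close>

lemma bidisc_decomposition:
  assumes herm: "\<And>z w. B w z = cnj (B z w)"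
    and psd: "\<And>k. k \<in> AK \<Longrightarrow> psd_on pentablock (\<lambda>z w. B (c1 z, c3 z) (c1 w, c3 w) * k z w)"
  shows "\<exists>\<Gamma>1 \<Gamma>2. psd_on bidisc \<Gamma>1 \<and> psd_on bidisc \<Gamma>2 \<and>
    (\<forall>z\<in>bidisc. \<forall>w\<in>bidisc. B z w = (1 - fst z * cnj (fst w)) * \<Gamma>1 z w + (1 - snd z * cnj (snd w)) * \<Gamma>2 z w)"
proof -
  define g where "g = (\<lambda>b (z :: complex \<times> complex). if b then fst z else snd z)"
  define \<rho> where "\<rho> = (\<lambda>z :: complex \<times> complex. max (cmod (fst z)) (cmod (snd z)))"
  have dual: "psd_on bidisc (\<lambda>z w. B z w * K z w)"
    if K: "kernel_on bidisc K" "\<And>j. j \<in> UNIV \<Longrightarrow> psd_on bidisc (\<lambda>z w. (1 - g j z * cnj (g j w)) * K z w)"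
        for K
  proof -
    have "slice_kernel K \<in> AK"
      using slice_kernel_AK[OF K(1)] K(2)[of True] K(2)[of False] by (simp add: g_def)
    from psd_on_pullback[OF psd[OF this], of bidisc "\<lambda>z. (fst z, 0, snd z)"]
    have "psd_on bidisc (\<lambda>z w. B z w * slice_kernel K (fst z, 0, snd z) (fst w, 0, snd w))"
      by (simp add: pentablock_slice)
    moreover have "slice_kernel K (fst z, 0, snd z) (fst w, 0, snd w) = K z w" for z w
      by (auto simp: slice_kernel_def)
    ultimately show ?thesis by simp
  qed
  have \<rho>: "\<And>j z. j \<in> UNIV \<Longrightarrow> z \<in> bidisc \<Longrightarrow> cmod (g j z) \<le> \<rho> z" "\<And>z. z \<in> bidisc \<Longrightarrow> \<rho> z < 1"
    by (auto simp: g_def \<rho>_def bidisc_def)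
  show ?thesis
  proof (rule szego_functional[where X = bidisc and g = g and B = B and \<rho> = \<rho>,
      OF UNIV_not_empty \<rho> herm dual])
    fix \<Xi> :: "complex \<times> complex \<Rightarrow> complex \<times> complex \<Rightarrow> (bool \<Rightarrow> complex) \<Rightarrow> complex"
    assume add: "\<And>z w h h'. bounded (h ` UNIV) \<Longrightarrow> bounded (h' ` UNIV) \<Longrightarrow> \<Xi> z w (\<lambda>j. h j + h' j) = \<Xi> z w h
        + \<Xi> z w h'"
      and scale: "\<And>z w h c. bounded (h ` UNIV) \<Longrightarrow> \<Xi> z w (\<lambda>j. c * h j) = c * \<Xi> z w h"
      and pos: "\<And>(N::nat) z h c. (\<And>i. i \<in> {1..N} \<Longrightarrow> bounded (h i ` UNIV)) \<Longrightarrow>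
         (\<Sum>i=1..N. \<Sum>l=1..N. \<Xi> (z i) (z l) (\<lambda>j. h i j * cnj (h l j)) * c l * cnj (c i)) \<in> \<real>\<^sub>\<ge>\<^sub>0"
      and eq: "\<And>z w. z \<in> bidisc \<Longrightarrow> w \<in> bidisc \<Longrightarrow> \<Xi> z w (\<lambda>j. 1 - g j z * cnj (g j w)) = B z w"
    have bdd: "bounded (h ` UNIV)" for h :: "bool \<Rightarrow> complex" by (intro finite_imp_bounded) simp
    define i1 where "i1 = (\<lambda>b :: bool. of_bool b :: complex)"
    define i2 where "i2 = (\<lambda>b :: bool. of_bool (\<not> b) :: complex)"
    have p: "psd_on bidisc (\<lambda>z w. \<Xi> z w i)" if "(\<lambda>j. i j * cnj (i j)) = i" for i
    proof (rule psd_onI)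
      fix N :: nat and z :: "nat \<Rightarrow> complex \<times> complex" and c :: "nat \<Rightarrow> complex"
      show "(\<Sum>k=1..N. \<Sum>j=1..N. \<Xi> (z k) (z j) i * c j * cnj (c k)) \<in> \<real>\<^sub>\<ge>\<^sub>0"
        using pos[of N "\<lambda>_. i" z c] bdd by (simp add: that)
    qed
    have "B z w = (1 - fst z * cnj (fst w)) * \<Xi> z w i1 + (1 - snd z * cnj (snd w)) * \<Xi> z w i2"
      if "z \<in> bidisc" "w \<in> bidisc" for z w
    proof -
      have "(\<lambda>j. 1 - g j z * cnj (g j w)) = (\<lambda>j. (1 - fst z * cnj (fst w)) * i1 j
          + (1 - snd z * cnj (snd w)) * i2 j)"
        by (auto simp: g_def i1_def i2_def)
      then show ?thesis unfolding eq[OF that, symmetric] by (simp add: add[OF bdd bdd] scale[OF bdd])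
    qed
    moreover have "psd_on bidisc (\<lambda>z w. \<Xi> z w i1)" "psd_on bidisc (\<lambda>z w. \<Xi> z w i2)"
      by (rule p, auto simp: i1_def i2_def)+
    ultimately show ?thesis by (intro exI[of _ "\<lambda>z w. \<Xi> z w i1"] exI[of _ "\<lambda>z w. \<Xi> z w i2"] conjI ballI)
  qed
qed

section \<open>Transfer functions of unitaries\<close>

text \<open>With \<open>M\<close> the matrix of the unitary, acting on rows, \<open>transpose_op\<close> is its action on columns.\<close>

definition transpose_op :: "'i set \<Rightarrow> (('i \<Rightarrow> complex) \<Rightarrow> 'i \<Rightarrow> complex) \<Rightarrow> ('i \<Rightarrow> complex) \<Rightarrow> 'i \<Rightarrow> complex" where
  "transpose_op I G y b = (\<Sum>c\<in>I. G (\<lambda>i. of_bool (i = b)) c * y c)"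

lemma transpose_op_pairing:
  assumes G: "complex_linear G" and fin: "finite I" and x: "\<And>i. i \<notin> I \<Longrightarrow> x i = 0"
  shows "(\<Sum>c\<in>I. G x c * y c) = (\<Sum>b\<in>I. x b * transpose_op I G y b)"
proof -
  have "x = (\<lambda>i. \<Sum>b\<in>I. x b * of_bool (i = b))"
  proof
    fix i
    have "(\<Sum>b\<in>I. x b * of_bool (i = b)) = (\<Sum>b\<in>I. if b = i then x i else 0)" by (intro sum.cong) auto
    then show "x i = (\<Sum>b\<in>I. x b * of_bool (i = b))" using fin x[of i] by simp
  qed
  then have "G x = G (\<lambda>i. \<Sum>b\<in>I. x b * of_bool (i = b))" by (rule arg_cong)
  also have "\<dots> = (\<lambda>c. \<Sum>b\<in>I. x b * G (\<lambda>i. of_bool (i = b)) c)" by (rule complex_linear_sum[OF G])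
  finally have "(\<Sum>c\<in>I. G x c * y c) = (\<Sum>c\<in>I. \<Sum>b\<in>I. x b * (G (\<lambda>i. of_bool (i = b)) c * y c))"
    by (simp add: sum_distrib_left sum_distrib_right mult_ac)
  also have "\<dots> = (\<Sum>b\<in>I. x b * transpose_op I G y b)"
    unfolding transpose_op_def sum_distrib_left by (rule sum.swap)
  finally show ?thesis .
qed

text \<open>Duality: the column image is paired with its own conjugate, \<open>G\<close> is moved to
  the other factor, where it is isometric, and Cauchy-Schwarz finishes.\<close>

lemma transpose_op_contractive:
  assumes G: "unitary_on I G G'" and fin: "finite I"
  shows "sqnorm I (transpose_op I G y) \<le> sqnorm I y"
proof -
  define x where "x = (\<lambda>b. if b \<in> I then cnj (transpose_op I G y b) else 0)"
  define t where "t = sqnorm I (transpose_op I G y)"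
  have nx: "sqnorm I x = t" by (simp add: t_def x_def sqnorm_def)
  have "complex_of_real t = (\<Sum>b\<in>I. x b * transpose_op I G y b)"
    unfolding t_def inner_on_self[symmetric] inner_on_def by (intro sum.cong) (auto simp: x_def)
  also have "\<dots> = (\<Sum>c\<in>I. G x c * y c)"
    by (rule transpose_op_pairing[OF unitary_onD(1)[OF G] fin, symmetric]) (simp add: x_def)
  also have "\<dots> = inner_on I (G x) (\<lambda>c. cnj (y c))" by (simp add: inner_on_def)
  finally have "(cmod (complex_of_real t))\<^sup>2 = (cmod (inner_on I (G x) (\<lambda>c. cnj (y c))))\<^sup>2" by simp
  also have "\<dots> \<le> sqnorm I (G x) * sqnorm I (\<lambda>c. cnj (y c))" by (rule norm_inner_on_le)
  also have "\<dots> = t * sqnorm I y" by (simp add: unitary_onD(5)[OF G] nx) (simp add: sqnorm_def)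
  finally have "t * t \<le> t * sqnorm I y" by (simp add: power2_eq_square)
  moreover have "t \<ge> 0" by (simp add: t_def sqnorm_nonneg)
  moreover have "sqnorm I y \<ge> 0" by (rule sqnorm_nonneg)
  ultimately show ?thesis unfolding t_def[symmetric] by (cases "t = 0") (auto simp: mult_le_cancel_left)
qed

text \<open>Channels: \<open>nat\<close> for the outputs, \<open>unit\<close> for the input, and two
  copies of \<open>'f\<close> for the states delayed by the first and by the second
  variable.\<close>

type_synonym 'f state = "nat + unit + 'f + 'f"

definition delay :: "complex \<times> complex \<Rightarrow> ('f state \<Rightarrow> complex) \<Rightarrow> 'f state \<Rightarrow> complex" where
  "delay p x c = (case c of Inr (Inr (Inl _)) \<Rightarrow> fst p * x c | Inr (Inr (Inr _)) \<Rightarrow> snd p * x c | _ \<Rightarrow> 0)"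

text \<open>The terms of the Neumann series for the solution \<open>y\<close> of \<open>y = e + delay p (M y)\<close>, where \<open>e\<close> is the
  unit vector of the input channel \<open>Inr (Inl ())\<close>.\<close>

primrec transfer_step :: "'f state set \<Rightarrow> (('f state \<Rightarrow> complex) \<Rightarrow> 'f state \<Rightarrow> complex) \<Rightarrow> complex \<times> complex
    \<Rightarrow> nat \<Rightarrow> 'f state \<Rightarrow> complex" where
  "transfer_step I G p 0 = (\<lambda>c. of_bool (c = Inr (Inl ())))"
| "transfer_step I G p (Suc k) = delay p (transpose_op I G (transfer_step I G p k))"

lemma sqnorm_delay:
  assumes "cmod (fst p) \<le> r" "cmod (snd p) \<le> r"
  shows "sqnorm I (delay p x) \<le> r\<^sup>2 * sqnorm I x"
  unfolding sqnorm_def sum_distrib_left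
proof (rule sum_mono)
  fix c
  have "(cmod (fst p))\<^sup>2 \<le> r\<^sup>2" "(cmod (snd p))\<^sup>2 \<le> r\<^sup>2" using assms by (auto intro: power_mono)
  then show "(cmod (delay p x c))\<^sup>2 \<le> r\<^sup>2 * (cmod (x c))\<^sup>2"
    by (auto simp: delay_def norm_mult power_mult_distrib intro: mult_right_mono split: sum.splits)
qed

lemma transfer_step_bound:
  assumes G: "unitary_on I G G'" and fin: "finite I" and r: "cmod (fst p) \<le> r" "cmod (snd p) \<le> r"
      and c: "c \<in> I"
  shows "cmod (transfer_step I G p k c) \<le> r ^ k"
proof -
  have r0: "0 \<le> r" using r(1) norm_ge_zero order_trans by blast
  have "sqnorm I (transfer_step I G p k) \<le> (r ^ k)\<^sup>2"
  proof (induction k)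
    case 0
    have "sqnorm I (transfer_step I G p 0) = (\<Sum>c\<in>I. if c = Inr (Inl ()) then 1 else 0)"
      unfolding sqnorm_def by (intro sum.cong) auto
    also have "\<dots> \<le> 1" using fin by (simp add: sum.delta)
    finally show ?case by simp
  next
    case (Suc k)
    have "sqnorm I (transfer_step I G p (Suc k)) \<le> r\<^sup>2 * sqnorm I (transpose_op I G (transfer_step I G p k))"
      using sqnorm_delay[OF r] by simp
    also have "\<dots> \<le> r\<^sup>2 * (r ^ k)\<^sup>2"
      using transpose_op_contractive[OF G fin] Suc by (intro mult_left_mono) (auto intro: order_trans)
    finally show ?case by (simp add: power_mult_distrib)
  qed
  moreover have "(cmod (transfer_step I G p k c))\<^sup>2 \<le> sqnorm I (transfer_step I G p k)"
    unfolding sqnorm_def using fin c by (intro member_le_sum) auto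
  ultimately have "(cmod (transfer_step I G p k c))\<^sup>2 \<le> (r ^ k)\<^sup>2" by linarith
  then show ?thesis by (rule power2_le_imp_le) (use r0 in simp)
qed

definition transfer_state where
  "transfer_state I G p c = (\<Sum>k. transfer_step I G p k c)"

lemma transfer_step_sums:
  assumes G: "unitary_on I G G'" and fin: "finite I" and p: "p \<in> bidisc" and c: "c \<in> I"
  shows "(\<lambda>k. transfer_step I G p k c) sums transfer_state I G p c"
proof -
  define r where "r = max (cmod (fst p)) (cmod (snd p))"
  have r: "r < 1" "0 \<le> r" using p by (auto simp: r_def bidisc_def le_max_iff_disj)
  have "summable (\<lambda>k. transfer_step I G p k c)"
    by (rule summable_comparison_test'[of "\<lambda>k. r ^ k" 0])
       (use r transfer_step_bound[OF G fin _ _ c, of p r] in \<open>auto simp: r_def intro!: summable_geometric\<close>)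
  then show ?thesis unfolding transfer_state_def by (rule summable_sums)
qed

lemma transfer_state_eq:
  assumes G: "unitary_on I G G'" and fin: "finite I" and p: "p \<in> bidisc" and c: "c \<in> I"
  shows "transfer_state I G p c = of_bool (c = Inr (Inl ()))
      + delay p (transpose_op I G (transfer_state I G p)) c"
proof -
  note S = transfer_step_sums[OF G fin p]
  have "(\<lambda>k. transpose_op I G (transfer_step I G p k) b) sums transpose_op I G (transfer_state I G p) b"
      for b
    unfolding transpose_op_def by (intro sums_sum sums_mult S)
  then have "(\<lambda>k. delay p (transpose_op I G (transfer_step I G p k)) c) sums delay p
      (transpose_op I G (transfer_state I G p)) c"
    unfolding delay_def by (auto intro!: sums_mult split: sum.splits)
  then have "(\<lambda>k. transfer_step I G p (Suc k) c) sums delay p (transpose_op I G (transfer_state I G p))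
      c" by simp
  then have "(\<lambda>k. transfer_step I G p k c) sums (delay p (transpose_op I G (transfer_state I G p)) c
      + transfer_step I G p 0 c)"
    by (rule sums_Suc)
  from sums_unique2[OF S[OF c] this] show ?thesis by simp
qed

text \<open>The point moves along a holomorphic curve, so that the slices in both variables are
  instances, one component being the identity and the other constant. The series converges uniformly
  on small closed discs by the M-test.\<close>

lemma transfer_state_holomorphic:
  assumes G: "unitary_on I G G'" and fin: "finite I" and c: "c \<in> I"
    and \<alpha>: "\<alpha> holomorphic_on ball 0 1" "\<And>t. t \<in> ball 0 1 \<Longrightarrow> cmod (\<alpha> t) < 1"
    and \<beta>: "\<beta> holomorphic_on ball 0 1" "\<And>t. t \<in> ball 0 1 \<Longrightarrow> cmod (\<beta> t) < 1"
  shows "(\<lambda>t. transfer_state I G (\<alpha> t, \<beta> t) c) holomorphic_on ball 0 1"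
proof (rule holomorphic_uniform_sequence[of _ "\<lambda>n t. \<Sum>k<n. transfer_step I G (\<alpha> t, \<beta> t) k c"])
  have "(\<lambda>t. transfer_step I G (\<alpha> t, \<beta> t) k c) holomorphic_on ball 0 1" for k c
  proof (induction k arbitrary: c)
    case (Suc k)
    have "(\<lambda>t. transpose_op I G (transfer_step I G (\<alpha> t, \<beta> t) k) c) holomorphic_on ball 0 1" for c
      unfolding transpose_op_def by (intro holomorphic_intros Suc)
    then have "(\<lambda>t. \<alpha> t * transpose_op I G (transfer_step I G (\<alpha> t, \<beta> t) k) c) holomorphic_on ball 0 1"
      "(\<lambda>t. \<beta> t * transpose_op I G (transfer_step I G (\<alpha> t, \<beta> t) k) c) holomorphic_on ball 0 1" for c
      using \<alpha>(1) \<beta>(1) by (auto intro!: holomorphic_intros)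
    moreover obtain l u m where "c = Inl l \<or> c = Inr (Inl u) \<or> c = Inr (Inr (Inl m)) \<or> c
        = Inr (Inr (Inr m))"
      by (metis sum.exhaust)
    ultimately show ?case by (auto simp: delay_def)
  qed (auto intro: holomorphic_intros)
  then show "(\<lambda>t. \<Sum>k<n. transfer_step I G (\<alpha> t, \<beta> t) k c) holomorphic_on ball 0 1" for n
    by (intro holomorphic_intros)
  fix x :: complex assume x: "x \<in> ball 0 1"
  obtain d where d: "d > 0" "cball x d \<subseteq> ball 0 1" using open_contains_cball[of "ball 0 1"] x open_ball
      by blast
  have "continuous_on (cball x d) (\<lambda>t. max (cmod (\<alpha> t)) (cmod (\<beta> t)))"
    using \<alpha>(1) \<beta>(1) d(2) by (intro continuous_intros) (auto intro: holomorphic_on_imp_continuous_on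
        holomorphic_on_subset)
  then obtain t0 where t0: "t0 \<in> cball x d" "\<And>t. t \<in> cball x d \<Longrightarrow> max (cmod (\<alpha> t)) (cmod (\<beta> t))
      \<le> max (cmod (\<alpha> t0)) (cmod (\<beta> t0))"
    using continuous_attains_sup[of "cball x d" "\<lambda>t. max (cmod (\<alpha> t)) (cmod (\<beta> t))"] d by auto
  define r where "r = max (cmod (\<alpha> t0)) (cmod (\<beta> t0))"
  have r: "0 \<le> r" "r < 1" using \<alpha>(2)[of t0] \<beta>(2)[of t0] t0(1) d by (auto simp: r_def le_max_iff_disj)
  have "uniform_limit (cball x d) (\<lambda>n t. \<Sum>k<n. transfer_step I G (\<alpha> t, \<beta> t) k c)
      (\<lambda>t. \<Sum>k. transfer_step I G (\<alpha> t, \<beta> t) k c) sequentially"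
  proof (rule Weierstrass_m_test[where M = "\<lambda>k. r ^ k"])
    show "norm (transfer_step I G (\<alpha> t, \<beta> t) k c) \<le> r ^ k" if "t \<in> cball x d" for k t
      using t0(2)[OF that] by (intro transfer_step_bound[OF G fin _ _ c]) (auto simp: r_def)
  qed (use r in \<open>simp add: summable_geometric\<close>)
  then show "\<exists>d>0. cball x d \<subseteq> ball 0 1 \<and> uniform_limit (cball x d) (\<lambda>n t. \<Sum>k<n. transfer_step I G
      (\<alpha> t, \<beta> t) k c)
      (\<lambda>t. transfer_state I G (\<alpha> t, \<beta> t) c) sequentially"
    unfolding transfer_state_def using d by blast
qed auto

text \<open>Lurking isometry: by the decomposition the rows \<open>a z\<close> and \<open>b z\<close> have the same Gram matrix, so some
  unitary takes \<open>a z\<close> to \<open>b z\<close>; \<open>f\<close> is its transfer function.\<close>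

lemma finite_realization:
  fixes \<phi> :: "nat \<Rightarrow> complex \<times> complex \<Rightarrow> complex"
  assumes fin: "finite F" and Fb: "F \<subseteq> bidisc"
    and \<Gamma>: "psd_on F \<Gamma>1" "psd_on F \<Gamma>2"
    and eq: "\<And>z w. z \<in> F \<Longrightarrow> w \<in> F \<Longrightarrow> (\<Sum>j=1..n. \<phi> j z * cnj (\<phi> j w)) - (of_real \<epsilon>)\<^sup>2 =
      (1 - fst z * cnj (fst w)) * \<Gamma>1 z w + (1 - snd z * cnj (snd w)) * \<Gamma>2 z w"
  shows "\<exists>f :: nat \<Rightarrow> complex \<times> complex \<Rightarrow> complex.
     (\<forall>j. \<forall>y\<in>ball 0 1. (\<lambda>x. f j (x, y)) holomorphic_on ball 0 1) \<and>
     (\<forall>j. \<forall>x\<in>ball 0 1. (\<lambda>y. f j (x, y)) holomorphic_on ball 0 1) \<and>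
     (\<forall>z\<in>bidisc. (\<Sum>j=1..n. (cmod (f j z))\<^sup>2) \<le> 1) \<and>
     (\<forall>z\<in>F. (\<Sum>j=1..n. \<phi> j z * f j z) = of_real \<epsilon>)"
proof -
  obtain e1 where e1: "\<And>z w. z \<in> F \<Longrightarrow> w \<in> F \<Longrightarrow> \<Gamma>1 z w = (\<Sum>m\<in>F. e1 m z * cnj (e1 m w))"
    using psd_on_imp_gram[OF fin \<Gamma>(1)] by metis
  obtain e2 where e2: "\<And>z w. z \<in> F \<Longrightarrow> w \<in> F \<Longrightarrow> \<Gamma>2 z w = (\<Sum>m\<in>F. e2 m z * cnj (e2 m w))"
    using psd_on_imp_gram[OF fin \<Gamma>(2)] by metis
  define I :: "(complex \<times> complex) state set" where "I = {1..n} <+> {()} <+> F <+> F"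
  have finI: "finite I" using fin by (simp add: I_def)
  have sumI: "(\<Sum>c\<in>I. h c) = (\<Sum>j=1..n. h (Inl j)) + (h (Inr (Inl ())) + ((\<Sum>m\<in>F. h (Inr (Inr (Inl m))))
      + (\<Sum>m\<in>F. h (Inr (Inr (Inr m))))))"
    for h :: "(complex \<times> complex) state \<Rightarrow> 'x :: comm_monoid_add"
    using fin by (simp add: I_def sum.Plus)
  define a where "a = (\<lambda>z (c :: (complex \<times> complex) state).
      if c \<in> I then (case c of Inl j \<Rightarrow> \<phi> j z | Inr (Inl _) \<Rightarrow> 0
     | Inr (Inr (Inl m)) \<Rightarrow> fst z * e1 m z | Inr (Inr (Inr m)) \<Rightarrow> snd z * e2 m z) else 0)"
  define b where "b = (\<lambda>z (c :: (complex \<times> complex) state).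
      if c \<in> I then (case c of Inl j \<Rightarrow> 0 | Inr (Inl _) \<Rightarrow> complex_of_real \<epsilon>
     | Inr (Inr (Inl m)) \<Rightarrow> e1 m z | Inr (Inr (Inr m)) \<Rightarrow> e2 m z) else 0)"
  have inI: "j \<in> {1..n} \<Longrightarrow> Inl j \<in> I" "Inr (Inl ()) \<in> I" "m \<in> F \<Longrightarrow> Inr (Inr (Inl m)) \<in> I" "m \<in> F \<Longrightarrow>
      Inr (Inr (Inr m)) \<in> I" for j m
    by (auto simp: I_def)
  have a_simps: "j \<in> {1..n} \<Longrightarrow> a z (Inl j) = \<phi> j z" "a z (Inr (Inl ())) = 0"
    "m \<in> F \<Longrightarrow> a z (Inr (Inr (Inl m))) = fst z * e1 m z" "m \<in> F \<Longrightarrow> a z (Inr (Inr (Inr m)))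
        = snd z * e2 m z" for z j m
    by (auto simp: a_def inI)
  have b_simps: "b z (Inl j) = 0" "b z (Inr (Inl ())) = of_real \<epsilon>"
    "m \<in> F \<Longrightarrow> b z (Inr (Inr (Inl m))) = e1 m z" "m \<in> F \<Longrightarrow> b z (Inr (Inr (Inr m))) = e2 m z" for z j m
    by (auto simp: b_def inI)
  have gram: "inner_on I (a z) (a w) = inner_on I (b z) (b w)" if "z \<in> F" "w \<in> F" for z w
  proof -
    have "inner_on I (a z) (a w) = (\<Sum>j=1..n. \<phi> j z * cnj (\<phi> j w)) + (fst z * cnj (fst w) * \<Gamma>1 z w
        + snd z * cnj (snd w) * \<Gamma>2 z w)"
      unfolding inner_on_def sumI by (simp add: a_simps e1[OF that] e2[OF that] sum_distrib_left mult_ac)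
    also have "\<dots> = (of_real \<epsilon>)\<^sup>2 + (\<Gamma>1 z w + \<Gamma>2 z w)" using eq[OF that] by (simp add: algebra_simps)
    also have "\<dots> = inner_on I (b z) (b w)"
      unfolding inner_on_def sumI by (simp add: b_simps e1[OF that] e2[OF that] power2_eq_square)
    finally show ?thesis .
  qed
  have supp: "a z c = 0" "b z c = 0" if "c \<notin> I" for z c using that by (auto simp: a_def b_def)
  obtain G G' where G: "unitary_on I G G'" "\<And>z. z \<in> F \<Longrightarrow> G (a z) = b z"
    using unitary_extension[OF fin finI, of a b] supp gram by metis
  define y where "y = transfer_state I G"
  define f where "f = (\<lambda>j p. transpose_op I G (y p) (Inl j))"
  have y1: "y p (Inl j) = 0" if "p \<in> bidisc" "j \<in> {1..n}" for p j
    using transfer_state_eq[OF G(1) finI that(1) inI(1)[OF that(2)]] by (simp add: y_def delay_def)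
  have y2: "y p (Inr (Inl ())) = 1" if "p \<in> bidisc" for p
    using transfer_state_eq[OF G(1) finI that inI(2)] by (simp add: y_def delay_def)
  have y3: "y p (Inr (Inr (Inl m))) = fst p * transpose_op I G (y p) (Inr (Inr (Inl m)))"
      if "p \<in> bidisc" "m \<in> F" for p m
    using transfer_state_eq[OF G(1) finI that(1) inI(3)[OF that(2)]] by (simp add: y_def delay_def)
  have y4: "y p (Inr (Inr (Inr m))) = snd p * transpose_op I G (y p) (Inr (Inr (Inr m)))"
      if "p \<in> bidisc" "m \<in> F" for p m
    using transfer_state_eq[OF G(1) finI that(1) inI(4)[OF that(2)]] by (simp add: y_def delay_def)
  have hol: "(\<lambda>t. f j (\<alpha> t, \<beta> t)) holomorphic_on ball 0 1"
    if "\<alpha> holomorphic_on ball 0 1" "\<And>t. t \<in> ball 0 1 \<Longrightarrow> cmod (\<alpha> t) < 1"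
       "\<beta> holomorphic_on ball 0 1" "\<And>t. t \<in> ball 0 1 \<Longrightarrow> cmod (\<beta> t) < 1" for j \<alpha> \<beta>
    unfolding f_def transpose_op_def y_def
    by (intro holomorphic_intros transfer_state_holomorphic[OF G(1) finI _ that])
  \<comment> \<open>Contractivity gives \<open>|T|^2 <= |y|^2 = 1 + |delay T|^2\<close>. The delayed
    entries are at most the state entries of \<open>T\<close>; cancelling these leaves the
    outputs.\<close>
  have "(\<Sum>j=1..n. (cmod (f j p))\<^sup>2) \<le> 1" if p: "p \<in> bidisc" for p
  proof -
    define T where "T = transpose_op I G (y p)"
    have le1: "(cmod (fst p))\<^sup>2 \<le> 1" "(cmod (snd p))\<^sup>2 \<le> 1" using p by (auto simp: bidisc_def abs_square_le_1)
    have "sqnorm I T \<le> sqnorm I (y p)" unfolding T_def by (rule transpose_op_contractive[OF G(1) finI])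
    also have "\<dots> = 1 + ((\<Sum>m\<in>F. (cmod (fst p))\<^sup>2 * (cmod (T (Inr (Inr (Inl m)))))\<^sup>2)
        + (\<Sum>m\<in>F. (cmod (snd p))\<^sup>2 * (cmod (T (Inr (Inr (Inr m)))))\<^sup>2))"
      unfolding sqnorm_def sumI T_def using p by (simp add: y1 y2 y3 y4 norm_mult power_mult_distrib)
    also have "\<dots> \<le> 1 + ((\<Sum>m\<in>F. (cmod (T (Inr (Inr (Inl m)))))\<^sup>2) + (\<Sum>m\<in>F. (cmod (T (Inr (Inr (Inr m)))))\<^sup>2))"
      using le1 by (intro add_left_mono add_mono sum_mono mult_left_le_one_le) auto
    finally have "(\<Sum>j=1..n. (cmod (T (Inl j)))\<^sup>2) + (cmod (T (Inr (Inl ()))))\<^sup>2 \<le> 1"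
        unfolding sqnorm_def sumI by simp
    then show ?thesis unfolding f_def T_def[symmetric] by (smt (verit) zero_le_power2)
  qed
  \<comment> \<open>Pair \<open>y z\<close> with \<open>G (a z) = b z\<close>. The factors
    \<open>fst z\<close> and \<open>snd z\<close> in \<open>a z\<close> turn the state entries of
    the column image into those of \<open>y z\<close>, so the state terms on both sides agree and
    cancel.\<close>
  moreover have "(\<Sum>j=1..n. \<phi> j z * f j z) = of_real \<epsilon>" if z: "z \<in> F" for z
  proof -
    have zb: "z \<in> bidisc" using z Fb by auto
    have "(\<Sum>c\<in>I. G (a z) c * y z c) = (\<Sum>c\<in>I. a z c * transpose_op I G (y z) c)"
      by (rule transpose_op_pairing[OF unitary_onD(1)[OF G(1)] finI supp(1)])
    moreover have "(\<Sum>c\<in>I. G (a z) c * y z c) = of_real \<epsilon> + ((\<Sum>m\<in>F. e1 m z * y z (Inr (Inr (Inl m))))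
        + (\<Sum>m\<in>F. e2 m z * y z (Inr (Inr (Inr m)))))"
      unfolding G(2)[OF z] sumI by (simp add: b_simps y2[OF zb])
    moreover have "(\<Sum>c\<in>I. a z c * transpose_op I G (y z) c) = (\<Sum>j=1..n. \<phi> j z * f j z) +
      ((\<Sum>m\<in>F. e1 m z * y z (Inr (Inr (Inl m)))) + (\<Sum>m\<in>F. e2 m z * y z (Inr (Inr (Inr m)))))"
      unfolding sumI by (simp add: a_simps f_def y3[OF zb] y4[OF zb] mult_ac)
    ultimately show ?thesis by simp
  qed
  moreover have "(\<lambda>x. f j (x, y)) holomorphic_on ball 0 1" if "y \<in> ball 0 1" for j y
    by (rule hol[of "\<lambda>t. t" "\<lambda>t. y"]) (use that in \<open>auto intro: holomorphic_intros\<close>)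
  moreover have "(\<lambda>y. f j (x, y)) holomorphic_on ball 0 1" if "x \<in> ball 0 1" for j x
    by (rule hol[of "\<lambda>t. x" "\<lambda>t. t"]) (use that in \<open>auto intro: holomorphic_intros\<close>)
  ultimately show ?thesis by (intro exI[of _ f]) blast
qed

section \<open>Holomorphy in the limit and the corona solution\<close>

text \<open>Converse of \<open>interp_error\<close>: the estimates say that polynomials converge to
  \<open>g\<close> uniformly on each smaller disc.\<close>

lemma interp_limit_holomorphic:
  assumes "\<And>r R x. 0 < r \<Longrightarrow> r < 1 \<Longrightarrow> R > 0 \<Longrightarrow> cmod x \<le> r \<Longrightarrow> cmod (g x - interp r R g x)
      \<le> 2 * M * r ^ R / (1 - r)"
  shows "g holomorphic_on ball 0 1"
proof -
  have hol: "g holomorphic_on ball 0 r" if r: "0 < r" "r < 1" for r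
  proof (rule holomorphic_uniform_sequence[of _ "\<lambda>n. interp r (Suc n) g"])
    show "interp r (Suc n) g holomorphic_on ball 0 r" for n
      unfolding interp_def by (intro holomorphic_intros)
    fix x :: complex assume x: "x \<in> ball 0 r"
    obtain d where d: "d > 0" "cball x d \<subseteq> ball 0 r"
        using open_contains_cball[of "ball 0 r"] x open_ball by blast
    have lim: "(\<lambda>n. 2 * M * r ^ Suc n / (1 - r)) \<longlonglongrightarrow> 2 * M * 0 / (1 - r)"
      using r by (intro tendsto_intros LIMSEQ_Suc LIMSEQ_realpow_zero) auto
    have "uniform_limit (cball x d) (\<lambda>n. interp r (Suc n) g) g sequentially"
    proof (rule uniform_limitI)
      fix e :: real assume "e > 0"
      then have "\<forall>\<^sub>F n in sequentially. 2 * M * r ^ Suc n / (1 - r) < e"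
        using order_tendstoD(2)[OF lim] by simp
      then show "\<forall>\<^sub>F n in sequentially. \<forall>x\<in>cball x d. dist (interp r (Suc n) g x) (g x) < e"
      proof eventually_elim
        case (elim n)
        show ?case
        proof
          fix y assume "y \<in> cball x d"
          then have "cmod y \<le> r" using d(2) by auto
          then have "cmod (g y - interp r (Suc n) g y) \<le> 2 * M * r ^ Suc n / (1 - r)" using r
              by (intro assms) auto
          then show "dist (interp r (Suc n) g y) (g y) < e" using elim
              by (simp add: dist_norm norm_minus_commute)
        qed
      qed
    qed
    then show "\<exists>d>0. cball x d \<subseteq> ball 0 r \<and> uniform_limit (cball x d) (\<lambda>n. interp r (Suc n) g) g
        sequentially"
      using d by blast
  qed auto
  have "g field_differentiable at x" if "x \<in> ball 0 1" for x
  proof -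
    have x: "cmod x < 1" using that by simp
    obtain r where r: "cmod x < r" "r < 1" using dense[OF x] by blast
    then have "0 < r" using norm_ge_zero[of x] by linarith
    from hol[OF this r(2)] show ?thesis using r by (auto simp: holomorphic_on_open field_differentiable_def)
  qed
  then show ?thesis unfolding holomorphic_on_def using field_differentiable_at_within by blast
qed

text \<open>Cauchy's inequality on circles of radius \<open>\<rho> / 2\<close> around points of the
  small ball, which stay in the large one, bounds the derivative by
  \<open>2 M / \<rho>\<close>.\<close>

lemma holomorphic_lipschitz:
  assumes hol: "g holomorphic_on ball x0 (2 * \<rho>)" and M: "\<And>x. x \<in> ball x0 (2 * \<rho>) \<Longrightarrow> cmod (g x) \<le> M"
    and \<rho>: "\<rho> > 0" and x: "x \<in> ball x0 \<rho>"
  shows "cmod (g x - g x0) \<le> 2 * M / \<rho> * cmod (x - x0)"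
proof (rule field_differentiable_bound[of "ball x0 \<rho>" g "deriv g"])
  fix z assume z: "z \<in> ball x0 \<rho>"
  have sub: "cball z (\<rho> / 2) \<subseteq> ball x0 (2 * \<rho>)"
  proof
    fix w assume "w \<in> cball z (\<rho> / 2)"
    then show "w \<in> ball x0 (2 * \<rho>)" using z \<rho> dist_triangle[of x0 w z] by simp
  qed
  have "z \<in> ball x0 (2 * \<rho>)" using z \<rho> by simp
  then have "(g has_field_derivative deriv g z) (at z)"
    using hol holomorphic_derivI open_ball by blast
  then show "(g has_field_derivative deriv g z) (at z within ball x0 \<rho>)"
      by (rule has_field_derivative_at_within)
  have "cmod ((deriv ^^ 1) g z) \<le> fact 1 * M / (\<rho> / 2) ^ 1"
  proof (rule Cauchy_inequality)
    show "g holomorphic_on ball z (\<rho> / 2)" using sub ball_subset_cball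
        by (intro holomorphic_on_subset[OF hol]) blast
    show "continuous_on (cball z (\<rho> / 2)) g" using sub
        by (intro holomorphic_on_imp_continuous_on holomorphic_on_subset[OF hol])
    show "cmod (g w) \<le> M" if "cmod (z - w) = \<rho> / 2" for w
      using sub that by (intro M) (auto simp: dist_norm)
  qed (use \<rho> in auto)
  then show "cmod (deriv g z) \<le> 2 * M / \<rho>" by (simp add: mult.commute)
qed (use x \<rho> in auto)

text \<open>The mixed difference of \<open>f\<close> is
  \<open>O(|x - x\<^sub>0| |y - y\<^sub>0|)\<close> because the increment in \<open>x\<close> is itself small and holomorphic in \<open>y\<close>.\<close>

lemma bounded_separately_holomorphic_imp_Hinf:
  assumes sl1: "\<And>y. y \<in> ball 0 1 \<Longrightarrow> (\<lambda>x. f (x, y)) holomorphic_on ball 0 1"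
    and sl2: "\<And>x. x \<in> ball 0 1 \<Longrightarrow> (\<lambda>y. f (x, y)) holomorphic_on ball 0 1"
    and M: "\<And>z. z \<in> bidisc \<Longrightarrow> cmod (f z) \<le> M"
  shows "f \<in> Hinf bidisc"
proof -
  have "\<exists>a b. (f has_derivative (\<lambda>h. a * fst h + b * snd h)) (at z0)" if z0: "z0 \<in> bidisc" for z0
  proof -
    obtain x0 y0 where xy: "z0 = (x0, y0)" "x0 \<in> ball 0 1" "y0 \<in> ball 0 1" using z0
        by (auto simp: bidisc_def)
    \<comment> \<open>Halved so that the balls of radius \<open>2 * \<rho>\<close>, on which the
      Lipschitz bounds rest, lie in the disc.\<close>
    define \<rho> where "\<rho> = min (1 - cmod x0) (1 - cmod y0) / 2"
    have \<rho>: "\<rho> > 0" using xy by (simp add: \<rho>_def)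
    have sub: "ball x0 (2 * \<rho>) \<subseteq> ball 0 1" "ball y0 (2 * \<rho>) \<subseteq> ball 0 1"
    proof -
      have "w \<in> ball 0 1" if "dist c w < 2 * \<rho>" "2 * \<rho> \<le> 1 - cmod c" for c w :: complex
        using that norm_triangle_ineq2[of w c] by (simp add: dist_norm norm_minus_commute)
      moreover have "2 * \<rho> \<le> 1 - cmod x0" "2 * \<rho> \<le> 1 - cmod y0" by (auto simp: \<rho>_def)
      ultimately show "ball x0 (2 * \<rho>) \<subseteq> ball 0 1" "ball y0 (2 * \<rho>) \<subseteq> ball 0 1" by (metis mem_ball subsetI)+
    qed
    define a where "a = deriv (\<lambda>x. f (x, y0)) x0"
    define b where "b = deriv (\<lambda>y. f (x0, y)) y0"
    have da: "((\<lambda>x. f (x, y0)) has_derivative (*) a) (at x0)"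
      unfolding a_def using holomorphic_derivI[OF sl1[OF xy(3)] open_ball xy(2)]
          by (simp add: has_field_derivative_def)
    have db: "((\<lambda>y. f (x0, y)) has_derivative (*) b) (at y0)"
      unfolding b_def using holomorphic_derivI[OF sl2[OF xy(2)] open_ball xy(3)]
          by (simp add: has_field_derivative_def)
    have mixed: "cmod ((f (x, y) - f (x0, y)) - (f (x, y0) - f (x0, y0)))
        \<le> 4 * M / \<rho>\<^sup>2 * cmod (x - x0) * cmod (y - y0)"
      if x: "x \<in> ball x0 \<rho>" and y: "y \<in> ball y0 \<rho>" for x y
    proof -
      have xb: "x \<in> ball 0 1" using x sub \<rho> by (auto simp: subset_iff)
      have L: "cmod (f (x, y') - f (x0, y')) \<le> 2 * M / \<rho> * cmod (x - x0)" if "y' \<in> ball y0 (2 * \<rho>)" for y'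
      proof (rule holomorphic_lipschitz[of "\<lambda>x. f (x, y')"])
        have y': "y' \<in> ball 0 1" using that sub by blast
        show "(\<lambda>x. f (x, y')) holomorphic_on ball x0 (2 * \<rho>)"
            by (rule holomorphic_on_subset[OF sl1[OF y'] sub(1)])
        show "cmod (f (x, y')) \<le> M" if "x \<in> ball x0 (2 * \<rho>)" for x using that sub y'
            by (intro M) (auto simp: bidisc_def)
      qed (use \<rho> x in auto)
      have "cmod ((f (x, y) - f (x0, y)) - (f (x, y0) - f (x0, y0)))
          \<le> 2 * (2 * M / \<rho> * cmod (x - x0)) / \<rho> * cmod (y - y0)"
      proof (rule holomorphic_lipschitz[of "\<lambda>y. f (x, y) - f (x0, y)"])
        show "(\<lambda>y. f (x, y) - f (x0, y)) holomorphic_on ball y0 (2 * \<rho>)"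
          by (intro holomorphic_intros holomorphic_on_subset[OF sl2[OF xb] sub(2)]
              holomorphic_on_subset[OF sl2[OF xy(2)] sub(2)])
      qed (use L \<rho> y in auto)
      then show ?thesis by (simp add: power2_eq_square mult_ac)
    qed
    have M0: "M \<ge> 0" using M[OF z0] norm_ge_zero order_trans by blast
    define K where "K = 4 * M / \<rho>\<^sup>2"
    have K0: "K \<ge> 0" using M0 by (simp add: K_def)
    have "(f has_derivative (\<lambda>h. a * fst h + b * snd h)) (at (x0, y0))"
      unfolding has_derivative_at_alt
    proof (intro conjI allI impI)
      show "bounded_linear (\<lambda>h. a * fst h + b * snd h)"
        by (intro bounded_linear_add bounded_linear_const_mult bounded_linear_fst bounded_linear_snd)
      fix e :: real assume e: "e > 0"
      define e' where "e' = e / 3"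
      have e': "e' > 0" using e by (simp add: e'_def)
      obtain d1 where d1: "d1 > 0" "\<And>x. norm (x - x0) < d1 \<Longrightarrow>
          norm (f (x, y0) - f (x0, y0) - a * (x - x0)) \<le> e' * norm (x - x0)"
        using da e' unfolding has_derivative_at_alt by blast
      obtain d2 where d2: "d2 > 0" "\<And>y. norm (y - y0) < d2 \<Longrightarrow>
          norm (f (x0, y) - f (x0, y0) - b * (y - y0)) \<le> e' * norm (y - y0)"
        using db e' unfolding has_derivative_at_alt by blast
      \<comment> \<open>The entry \<open>e' / (K + 1)\<close> makes the quadratic mixed term at most
        \<open>e' * t\<close>; the other entries serve \<open>mixed\<close> and the two partial
        derivatives.\<close>
      define d where "d = min (min \<rho> (e' / (K + 1))) (min d1 d2)"
      have d: "d > 0" using \<rho> e' d1 d2 K0 by (simp add: d_def)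
      show "\<exists>d>0. \<forall>z. norm (z - (x0, y0)) < d \<longrightarrow>
         norm (f z - f (x0, y0) - (a * fst (z - (x0, y0)) + b * snd (z - (x0, y0))))
             \<le> e * norm (z - (x0, y0))"
      proof (intro exI[of _ d] conjI d allI impI)
        fix z :: "complex \<times> complex" assume z: "norm (z - (x0, y0)) < d"
        obtain x y where zxy: "z = (x, y)" by (cases z)
        define t where "t = norm (z - (x0, y0))"
        have nx: "norm (x - x0) \<le> t" and ny: "norm (y - y0) \<le> t"
          using norm_fst_le[of "x - x0" "y - y0"] norm_snd_le[of "y - y0" "x - x0"]
              by (auto simp: t_def zxy)
        have td: "t < d" "t \<ge> 0" using z by (auto simp: t_def)
        have 1: "norm (f (x, y0) - f (x0, y0) - a * (x - x0)) \<le> e' * t"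
          using d1(2)[of x] nx td e' by (auto simp: d_def intro: order_trans mult_left_mono)
        have 2: "norm (f (x0, y) - f (x0, y0) - b * (y - y0)) \<le> e' * t"
          using d2(2)[of y] ny td e' by (auto simp: d_def intro: order_trans mult_left_mono)
        have 3: "cmod ((f (x, y) - f (x0, y)) - (f (x, y0) - f (x0, y0))) \<le> e' * t"
        proof -
          have "cmod ((f (x, y) - f (x0, y)) - (f (x, y0) - f (x0, y0)))
              \<le> K * cmod (x - x0) * cmod (y - y0)"
            unfolding K_def using nx ny td by (intro mixed) (auto simp: d_def dist_norm norm_minus_commute)
          also have "\<dots> \<le> K * t * t" using nx ny td K0 by (intro mult_mono) auto
          also have "\<dots> \<le> e' * t"
          proof (rule mult_right_mono)
            have "K * t \<le> (K + 1) * (e' / (K + 1))" using td K0 by (intro mult_mono) (auto simp: d_def)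
            also have "\<dots> = e'" using K0 by simp
            finally show "K * t \<le> e'" .
          qed (use td in simp)
          finally show ?thesis .
        qed
        have "f z - f (x0, y0) - (a * fst (z - (x0, y0)) + b * snd (z - (x0, y0))) =
          (f (x, y0) - f (x0, y0) - a * (x - x0)) + (f (x0, y) - f (x0, y0) - b * (y - y0))
              + ((f (x, y) - f (x0, y)) - (f (x, y0) - f (x0, y0)))"
          by (simp add: zxy algebra_simps)
        also have "norm \<dots> \<le> e' * t + e' * t + e' * t"
          using 1 2 3 by (intro norm_triangle_le add_mono) (auto intro: norm_triangle_le)
        finally show "norm (f z - f (x0, y0) - (a * fst (z - (x0, y0)) + b * snd (z - (x0, y0))))
            \<le> e * norm (z - (x0, y0))"
          by (simp add: t_def[symmetric] e'_def)
      qed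
    qed
    then show ?thesis using xy(1) by blast
  qed
  moreover have "bounded (f ` bidisc)" using M unfolding bounded_iff by blast
  ultimately show ?thesis unfolding Hinf_def holomorphic2_on_def by blast
qed

lemma psd_imp_corona:
  fixes \<phi> :: "nat \<Rightarrow> complex \<times> complex \<Rightarrow> complex"
  assumes \<epsilon>: "\<epsilon> > 0"
    and psd: "\<And>k. k \<in> AK \<Longrightarrow> psd_on pentablock
       (\<lambda>z w. ((\<Sum>j=1..n. \<phi> j (c1 z, c3 z) * cnj (\<phi> j (c1 w, c3 w))) - (of_real \<epsilon>)\<^sup>2) * k z w)"
  shows "\<exists>f. (\<forall>j\<in>{1..n}. f j \<in> Hinf bidisc) \<and> (\<forall>z\<in>bidisc. (\<Sum>j=1..n. (cmod (f j z))\<^sup>2) \<le> 1 / \<epsilon>\<^sup>2) \<and>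
    (\<forall>z\<in>bidisc. (\<Sum>j=1..n. \<phi> j z * f j z) = 1)"
proof -
  define B where "B = (\<lambda>z w. (\<Sum>j=1..n. \<phi> j z * cnj (\<phi> j w)) - (complex_of_real \<epsilon>)\<^sup>2)"
  have herm: "B w z = cnj (B z w)" for z w by (simp add: B_def mult.commute)
  obtain \<Gamma>1 \<Gamma>2 where \<Gamma>: "psd_on bidisc \<Gamma>1" "psd_on bidisc \<Gamma>2"
    "\<And>z w. z \<in> bidisc \<Longrightarrow> w \<in> bidisc \<Longrightarrow> B z w = (1 - fst z * cnj (fst w)) * \<Gamma>1 z w
        + (1 - snd z * cnj (snd w)) * \<Gamma>2 z w"
    using bidisc_decomposition[of B, OF herm] psd unfolding B_def by blast
  \<comment> \<open>Candidate rows of norm at most 1. Holomorphy in each variable is imposed through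
    interpolation estimates, which keeps the set closed under pointwise limits.\<close>
  define S where "S = {g :: nat \<times> complex \<times> complex \<Rightarrow> complex. (\<forall>p. cmod (g p) \<le> 1) \<and>
     (\<forall>z\<in>bidisc. (\<Sum>j=1..n. (cmod (g (j, z)))\<^sup>2) \<le> 1) \<and>
     (\<forall>j y r R x. y \<in> ball 0 1 \<longrightarrow> 0 < r \<and> r < 1 \<and> R > 0 \<and> cmod x \<le> r \<longrightarrow>
        cmod (g (j, x, y) - interp r R (\<lambda>x. g (j, x, y)) x) \<le> 2 * 1 * r ^ R / (1 - r)) \<and>
     (\<forall>j y r R x. y \<in> ball 0 1 \<longrightarrow> 0 < r \<and> r < 1 \<and> R > 0 \<and> cmod x \<le> r \<longrightarrow>
        cmod (g (j, y, x) - interp r R (\<lambda>x. g (j, y, x)) x) \<le> 2 * 1 * r ^ R / (1 - r))}"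
  have cont: "continuous_on UNIV (\<lambda>g :: nat \<times> complex \<times> complex \<Rightarrow> complex. interp r R (\<lambda>x. g (\<sigma> x)) x)"
      for r R x \<sigma>
    unfolding interp_def interp_coeff_def divide_inverse
    by (intro continuous_on_sum continuous_on_mult continuous_on_const continuous_on_eval)
  have closedS: "closed S"
    unfolding S_def Ball_def
    by (intro closed_Collect_conj closed_Collect_all closed_Collect_imp open_Collect_const closed_Collect_le
        continuous_on_norm continuous_on_diff continuous_on_const continuous_on_eval continuous_on_sum
            continuous_on_power cont)
  have "\<exists>g\<in>S. \<forall>z\<in>bidisc. g \<in> {g. (\<Sum>j=1..n. \<phi> j z * g (j, z)) = of_real \<epsilon>}"
  proof (rule finite_intersection_functions[OF closedS])
    show "cmod (g p) \<le> 1" if "g \<in> S" for g p using that unfolding S_def by blast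
    show "closed {g :: nat \<times> complex \<times> complex \<Rightarrow> complex. (\<Sum>j=1..n. \<phi> j z * g (j, z)) = of_real \<epsilon>}" for z
      by (intro closed_Collect_eq continuous_on_sum continuous_on_mult continuous_on_const
          continuous_on_eval)
    fix F assume F: "finite F" "F \<subseteq> bidisc"
    obtain f where f: "\<And>j y. y \<in> ball 0 1 \<Longrightarrow> (\<lambda>x. f j (x, y)) holomorphic_on ball 0 1"
      "\<And>j x. x \<in> ball 0 1 \<Longrightarrow> (\<lambda>y. f j (x, y)) holomorphic_on ball 0 1"
      "\<And>z. z \<in> bidisc \<Longrightarrow> (\<Sum>j=1..n. (cmod (f j z))\<^sup>2) \<le> 1" "\<And>z. z \<in> F \<Longrightarrow> (\<Sum>j=1..n. \<phi> j z * f j z) = of_real \<epsilon>"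
    proof -
      have "(\<Sum>j=1..n. \<phi> j z * cnj (\<phi> j w)) - (of_real \<epsilon>)\<^sup>2 = (1 - fst z * cnj (fst w)) * \<Gamma>1 z w
          + (1 - snd z * cnj (snd w)) * \<Gamma>2 z w"
        if "z \<in> F" "w \<in> F" for z w using \<Gamma>(3)[of z w] that F by (auto simp: B_def)
      from finite_realization[OF F psd_on_subset[OF \<Gamma>(1) F(2)] psd_on_subset[OF \<Gamma>(2) F(2)] this]
      show ?thesis using that by blast
    qed
    \<comment> \<open>Set to zero outside the indices and the bidisc, so that the bound 1 holds at
      every argument.\<close>
    define g where "g = (\<lambda>(j, z). if j \<in> {1..n} \<and> z \<in> bidisc then f j z else 0)"
    have f1: "cmod (f j z) \<le> 1" if "j \<in> {1..n}" "z \<in> bidisc" for j z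
    proof -
      have "(cmod (f j z))\<^sup>2 \<le> (\<Sum>j=1..n. (cmod (f j z))\<^sup>2)" using that by (intro member_le_sum) auto
      then have "(cmod (f j z))\<^sup>2 \<le> 1\<^sup>2" using f(3)[OF that(2)] by simp
      then show ?thesis by (rule power2_le_imp_le) simp
    qed
    then have g1: "cmod (g p) \<le> 1" for p by (cases p) (auto simp: g_def)
    have gs: "(\<Sum>j=1..n. (cmod (g (j, z)))\<^sup>2) \<le> 1" if "z \<in> bidisc" for z
      using f(3)[OF that] that by (simp add: g_def)
    have hol1: "(\<lambda>x. g (j, x, y)) holomorphic_on ball 0 1" if y: "y \<in> ball 0 1" for j y
    proof (cases "j \<in> {1..n}")
      case True
      have "(\<lambda>x. g (j, x, y)) holomorphic_on ball 0 1 \<longleftrightarrow> (\<lambda>x. f j (x, y)) holomorphic_on ball 0 1"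
        using True y by (intro holomorphic_cong) (auto simp: g_def bidisc_def)
      then show ?thesis using f(1)[OF y] by blast
    next
      case False
      then have "(\<lambda>x. g (j, x, y)) = (\<lambda>x. 0)" by (auto simp: g_def)
      then show ?thesis by simp
    qed
    have hol2: "(\<lambda>x. g (j, y, x)) holomorphic_on ball 0 1" if y: "y \<in> ball 0 1" for j y
    proof (cases "j \<in> {1..n}")
      case True
      have "(\<lambda>x. g (j, y, x)) holomorphic_on ball 0 1 \<longleftrightarrow> (\<lambda>x. f j (y, x)) holomorphic_on ball 0 1"
        using True y by (intro holomorphic_cong) (auto simp: g_def bidisc_def)
      then show ?thesis using f(2)[OF y] by blast
    next
      case False
      then have "(\<lambda>x. g (j, y, x)) = (\<lambda>x. 0)" by (auto simp: g_def)
      then show ?thesis by simp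
    qed
    have "g \<in> S"
      unfolding S_def using g1 gs interp_error[OF hol1 g1] interp_error[OF hol2 g1] by blast
    moreover have "(\<Sum>j=1..n. \<phi> j z * g (j, z)) = of_real \<epsilon>" if "z \<in> F" for z
      using f(4)[OF that] that F by (auto simp: g_def intro!: sum.cong trans[OF sum.cong f(4)[OF that]])
    ultimately show "\<exists>g\<in>S. \<forall>z\<in>F. g \<in> {g. (\<Sum>j=1..n. \<phi> j z * g (j, z)) = of_real \<epsilon>}" by blast
  qed
  then obtain g where g: "g \<in> S" "\<And>z. z \<in> bidisc \<Longrightarrow> (\<Sum>j=1..n. \<phi> j z * g (j, z)) = of_real \<epsilon>" by blast
  \<comment> \<open>The compactness argument solves \<open>\<Sum> \<phi> g = \<epsilon>\<close> with
    rows of norm at most 1; rescaling restores the right side 1.\<close>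
  define f where "f = (\<lambda>j z. g (j, z) / of_real \<epsilon>)"
  have "f j \<in> Hinf bidisc" for j
  proof (rule bounded_separately_holomorphic_imp_Hinf)
    have "(\<lambda>x. g (j, x, y)) holomorphic_on ball 0 1" "(\<lambda>x. g (j, y, x)) holomorphic_on ball 0 1"
        if "y \<in> ball 0 1" for y
      by (rule interp_limit_holomorphic[where M = 1], use g(1) that in \<open>simp add: S_def\<close>)+
    then show "y \<in> ball 0 1 \<Longrightarrow> (\<lambda>x. f j (x, y)) holomorphic_on ball 0 1" 
      "y \<in> ball 0 1 \<Longrightarrow> (\<lambda>x. f j (y, x)) holomorphic_on ball 0 1" for y
      using \<epsilon> unfolding f_def by (auto intro!: holomorphic_intros)
    have "cmod (g p) \<le> 1" for p using g(1) unfolding S_def by blast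
    then show "cmod (f j z) \<le> 1 / \<epsilon>" for z using \<epsilon> by (simp add: f_def norm_divide divide_right_mono)
  qed
  moreover have "(\<Sum>j=1..n. (cmod (f j z))\<^sup>2) \<le> 1 / \<epsilon>\<^sup>2" if "z \<in> bidisc" for z
  proof -
    have "(\<Sum>j=1..n. (cmod (g (j, z)))\<^sup>2) \<le> 1" using g(1) that unfolding S_def by blast
    then show ?thesis using \<epsilon> by (simp add: f_def norm_divide power_divide divide_right_mono flip:
        sum_divide_distrib)
  qed
  moreover have "(\<Sum>j=1..n. \<phi> j z * f j z) = 1" if "z \<in> bidisc" for z
    using g(2)[OF that] \<epsilon> by (simp add: f_def flip: sum_divide_distrib)
  ultimately show ?thesis by blast
qed

theorem theorem3p4:
  fixes n :: nat and \<phi> :: "nat \<Rightarrow> complex \<times> complex \<Rightarrow> complex" and \<epsilon> :: real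
  assumes "n \<ge> 1"
    and "\<And>i. i \<in> {1..n} \<Longrightarrow> \<phi> i \<in> Hinf bidisc"
    and "\<epsilon> > 0"
  shows
    "((\<exists>f :: nat \<Rightarrow> complex \<times> complex \<Rightarrow> complex.
         (\<forall>i\<in>{1..n}. f i \<in> Hinf bidisc) \<and>
         (SUP z\<in>bidisc. \<Sum>i=1..n. (cmod (f i z))\<^sup>2) \<le> 1 / \<epsilon>\<^sup>2 \<and>
         (\<forall>z\<in>bidisc. (\<Sum>i=1..n. \<phi> i z * f i z) = 1))
      \<longleftrightarrow>
      (\<forall>k\<in>AK. psd_on pentablock
         (\<lambda>z w. ((\<Sum>j=1..n. \<phi> j (c1 z, c3 z) * cnj (\<phi> j (c1 w, c3 w))) - (of_real \<epsilon>)\<^sup>2) * k z w)))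
     \<and>
     ((\<forall>k\<in>AK. psd_on pentablock
         (\<lambda>z w. ((\<Sum>j=1..n. \<phi> j (c1 z, c3 z) * cnj (\<phi> j (c1 w, c3 w))) - (of_real \<epsilon>)\<^sup>2) * k z w))
      \<longleftrightarrow>
      (\<exists>\<xi> \<eta> \<delta>. positive_kernel_on pentablock \<xi> \<and> positive_kernel_on pentablock \<eta> \<and>
         weak_kernel_on pentablock \<delta> \<and>
         (\<forall>z\<in>pentablock. \<forall>w\<in>pentablock.
            (\<Sum>j=1..n. \<phi> j (c1 z, c3 z) * cnj (\<phi> j (c1 w, c3 w))) - (of_real \<epsilon>)\<^sup>2 =
              \<xi> z w (\<lambda>\<alpha>. 1 - Jpsi z \<alpha> * cnj (Jpsi w \<alpha>))
            + \<eta> z w (\<lambda>\<alpha>. 1 - jPhi z \<alpha> * cnj (jPhi w \<alpha>))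
            + (1 - c2 z * cnj (c2 w) / 4) * \<delta> z w)))"
    (is "(?corona \<longleftrightarrow> ?psd) \<and> (_ \<longleftrightarrow> ?decomposition)")
proof (intro conjI iffI)
  assume ?corona
  then obtain f where f: "\<forall>i\<in>{1..n}. f i \<in> Hinf bidisc" "(SUP z\<in>bidisc. \<Sum>i=1..n. (cmod (f i z))\<^sup>2) \<le> 1 / \<epsilon>\<^sup>2"
    "\<forall>z\<in>bidisc. (\<Sum>i=1..n. \<phi> i z * f i z) = 1" by blast
  have "\<forall>i\<in>{1..n}. \<exists>b. \<forall>z\<in>bidisc. cmod (f i z) \<le> b" using f(1) by (auto simp: Hinf_def bounded_iff)
  then obtain b where b: "\<And>i z. i \<in> {1..n} \<Longrightarrow> z \<in> bidisc \<Longrightarrow> cmod (f i z) \<le> b i" by metis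
  \<comment> \<open>A real \<open>SUP\<close> bounds the values only for a family bounded above,
    which boundedness of each \<open>f i\<close> supplies.\<close>
  have "bdd_above ((\<lambda>z. \<Sum>i=1..n. (cmod (f i z))\<^sup>2) ` bidisc)"
    using b by (intro bdd_aboveI2[where M = "\<Sum>i=1..n. (b i)\<^sup>2"] sum_mono power_mono) auto
  then have "(\<Sum>i=1..n. (cmod (f i z))\<^sup>2) \<le> 1 / \<epsilon>\<^sup>2" if "z \<in> bidisc" for z
    using cSUP_upper[OF that, of "\<lambda>z. \<Sum>i=1..n. (cmod (f i z))\<^sup>2"] f(2) by linarith
  then show ?psd using f by (intro ballI corona_imp_psd[OF assms(3)]) auto
next
  assume ?psd
  then obtain f where f: "\<forall>j\<in>{1..n}. f j \<in> Hinf bidisc" "\<forall>z\<in>bidisc. (\<Sum>j=1..n. (cmod (f j z))\<^sup>2) \<le> 1 / \<epsilon>\<^sup>2"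
    "\<forall>z\<in>bidisc. (\<Sum>j=1..n. \<phi> j z * f j z) = 1"
    using psd_imp_corona[OF assms(3), where n = n and \<phi> = \<phi>] by blast
  have "(0, 0) \<in> bidisc" by (simp add: bidisc_def)
  then have "(SUP z\<in>bidisc. \<Sum>i=1..n. (cmod (f i z))\<^sup>2) \<le> 1 / \<epsilon>\<^sup>2" using f(2) by (intro cSUP_least) auto
  then show ?corona using f by blast
next
  assume ?psd
  then show ?decomposition
    by (intro psd_imp_decomposition) (auto simp: mult.commute)
next
  assume ?decomposition
  then obtain \<xi> \<eta> \<delta> where d: "positive_kernel_on pentablock \<xi>" "positive_kernel_on pentablock \<eta>" "psd_on pentablock \<delta>"
    "\<forall>z\<in>pentablock. \<forall>w\<in>pentablock.
            (\<Sum>j=1..n. \<phi> j (c1 z, c3 z) * cnj (\<phi> j (c1 w, c3 w))) - (of_real \<epsilon>)\<^sup>2 =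
              \<xi> z w (\<lambda>\<alpha>. 1 - Jpsi z \<alpha> * cnj (Jpsi w \<alpha>))
            + \<eta> z w (\<lambda>\<alpha>. 1 - jPhi z \<alpha> * cnj (jPhi w \<alpha>))
            + (1 - c2 z * cnj (c2 w) / 4) * \<delta> z w" by blast
  show ?psd
  proof
    fix k assume "k \<in> AK"
    then show "psd_on pentablock
         (\<lambda>z w. ((\<Sum>j=1..n. \<phi> j (c1 z, c3 z) * cnj (\<phi> j (c1 w, c3 w))) - (of_real \<epsilon>)\<^sup>2) * k z w)"
      using d(4) by (intro decomposition_imp_psd[OF d(1-3)]) auto
  qed
qed

end
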